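(* Let $\mathcal{C}_1,\dots,\mathcal{C}_n\in\mathbb{R}^{m\times m\times p}$ be TPD T-product tensors, let $\|\cdot\|_\rho$ be a unitarily invariant norm, and let $\beta_0(t)=\frac{\pi}{2(\cosh(\pi t)+1)}$ for $t\in\mathbb{R}$. Then: (1) for every continuous $f:(0,\infty)\to[0,\infty)$ such that $x\mapsto\log f(e^x)$ is convex on $\mathbb{R}$, $$\Big\|f\Big(\exp\Big(\sum_{i=1}^n\log\mathcal{C}_i\Big)\Big)\Big\|_\rho\le\exp\int_{-\infty}^{\infty}\log\Big\|f\Big(\Big|\prod_{i=1}^n\mathcal{C}_i^{1+\iota t}\Big|\Big)\Big\|_\rho\,\beta_0(t)\,dt;$$ (2) for every continuous $g:(0,\infty)\to[0,\infty)$ such that $x\mapsto g(e^x)$ is convex on $\mathbb{R}$, $$\Big\|g\Big(\exp\Big(\sum_{i=1}^n\log\mathcal{C}_i\Big)\Big)\Big\|_\rho\le\int_{-\infty}^{\infty}\Big\|g\Big(\Big|\prod_{i=1}^n\mathcal{C}_i^{1+\iota t}\Big|\Big)\Big\|_\rho\,\beta_0(t)\,dt.$$ Here $\prod_{i=1}^n\mathcal{C}_i^{1+\iota t}=\mathcal{C}_1^{1+\iota t}\star\cdots\star\mathcal{C}_n^{1+\iota t}$ and $\iota^2=-1$.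
   Context: T-product basics: for $\mathcal{C}\in\mathbb{C}^{m\times n\times p}$ with frontal slices $C^{(1)},\dots,C^{(p)}$, $\mathrm{bcirc}(\mathcal{C})$ is the $mp\times np$ block-circulant matrix with $(i,j)$ block $C^{(((i-j)\bmod p)+1)}$, $\mathrm{unfold}(\mathcal{C})$ stacks the slices vertically, $\mathrm{fold}=\mathrm{unfold}^{-1}$, and $\mathcal{C}\star\mathcal{D}=\mathrm{fold}(\mathrm{bcirc}(\mathcal{C})\mathrm{unfold}(\mathcal{D}))$. $\mathcal{C}^H=\mathrm{bcirc}^{-1}(\mathrm{bcirc}(\mathcal{C})^H)$, $\mathcal{C}^T=\mathrm{bcirc}^{-1}(\mathrm{bcirc}(\mathcal{C})^T)$; a real square tensor is symmetric if $\mathcal{C}^T=\mathcal{C}$. Every square $\mathcal{C}$ satisfies $\mathrm{bcirc}(\mathcal{C})=(F_p^H\otimes I_m)\mathrm{Diag}(C_1,\dots,C_p)(F_p\otimes I_m)$ with $F_p$ the normalized $p\times p$ DFT matrix; $C_1,\dots,C_p$ are the Fourier blocks. The T-eigenvalues of a symmetric (or Hermitian) $\mathcal{C}$ are the $mp$ eigenvalues of $C_1,\dots,C_p$; TPD means all T-eigenvalues $>0$. The T-singular values $\sigma_1(\mathcal{C})\ge\dots\ge\sigma_{mp}(\mathcal{C})$ are the singular values of $C_1,\dots,C_p$ together. For a function $h$ on the T-eigenvalues of a Hermitian/symmetric tensor (or on $(0,\infty)$ for a TPD tensor), $h(\mathcal{C})$ is defined by $\mathrm{bcirc}(h(\mathcal{C}))=(F_p^H\otimes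 I_m)\mathrm{Diag}(h(C_1),\dots,h(C_p))(F_p\otimes I_m)$; this defines $\exp$, $\log$ and complex powers $\mathcal{C}^{z}=\exp(z\log\mathcal{C})$ for TPD $\mathcal{C}$. $|\mathcal{H}|=(\mathcal{H}^H\star\mathcal{H})^{1/2}$. Unitarily invariant norms: for a symmetric gauge function $\rho$ on $\mathbb{R}^{mp}_{\ge 0}$ (restriction of a permutation-invariant absolute norm), $\|\mathcal{H}\|_\rho=\rho(\sigma_1(\mathcal{H}),\dots,\sigma_{mp}(\mathcal{H}))$. *)

theory Defs
  imports "HOL-Analysis.Analysis" "Jordan_Normal_Form.Schur_Decomposition"
    "Jordan_Normal_Form.Char_Poly" "HOL-Library.Multiset"
begin

text \<open>A tensor in C^(m x n x p) is represented by the list of its p frontal slices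
  C^(1),...,C^(p) (list positions 0..p-1), each an m x n complex matrix.\<close>

type_synonym tensor = "complex mat list"

definition is_tensor :: "nat \<Rightarrow> nat \<Rightarrow> nat \<Rightarrow> tensor \<Rightarrow> bool" where
  "is_tensor m n p C \<longleftrightarrow> 0 < p \<and> length C = p \<and> (\<forall>S\<in>set C. S \<in> carrier_mat m n)"

definition t_rows :: "tensor \<Rightarrow> nat" where "t_rows C = dim_row (hd C)"
definition t_cols :: "tensor \<Rightarrow> nat" where "t_cols C = dim_col (hd C)"

definition bcirc :: "tensor \<Rightarrow> complex mat" where
  "bcirc C = (let m = t_rows C; n = t_cols C; p = length C in
     mat (m * p) (n * p) (\<lambda>(r, c). (C ! ((r div m + p - c div n) mod p)) $$ (r mod m, c mod n)))"

definition unfold :: "tensor \<Rightarrow> complex mat" where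
  "unfold D = (let m = t_rows D; l = t_cols D; p = length D in
     mat (m * p) l (\<lambda>(r, c). (D ! (r div m)) $$ (r mod m, c)))"

definition fold :: "nat \<Rightarrow> nat \<Rightarrow> complex mat \<Rightarrow> tensor" where
  "fold m p M = map (\<lambda>k. mat m (dim_col M) (\<lambda>(r, c). M $$ (k * m + r, c))) [0..<p]"

definition tstar :: "tensor \<Rightarrow> tensor \<Rightarrow> tensor" (infixl "\<star>" 70) where
  "C \<star> D = fold (t_rows C) (length C) (bcirc C * unfold D)"

text \<open>bcirc inverse (on block circulant matrices): read off the first block column.\<close>
definition bcirc_inv :: "nat \<Rightarrow> nat \<Rightarrow> nat \<Rightarrow> complex mat \<Rightarrow> tensor" where
  "bcirc_inv m n p M = map (\<lambda>k. mat m n (\<lambda>(r, c). M $$ (k * m + r, c))) [0..<p]"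

definition t_adj :: "tensor \<Rightarrow> tensor" where
  "t_adj C = bcirc_inv (t_cols C) (t_rows C) (length C) (mat_adjoint (bcirc C))"

definition t_transpose :: "tensor \<Rightarrow> tensor" where
  "t_transpose C = bcirc_inv (t_cols C) (t_rows C) (length C) (transpose_mat (bcirc C))"

definition real_tensor :: "tensor \<Rightarrow> bool" where
  "real_tensor C \<longleftrightarrow> (\<forall>S\<in>set C. \<forall>i<dim_row S. \<forall>j<dim_col S. Im (S $$ (i, j)) = 0)"

definition t_symmetric :: "tensor \<Rightarrow> bool" where
  "t_symmetric C \<longleftrightarrow> real_tensor C \<and> t_transpose C = C"

definition t_hermitian :: "tensor \<Rightarrow> bool" where
  "t_hermitian C \<longleftrightarrow> t_adj C = C"

definition t_add :: "tensor \<Rightarrow> tensor \<Rightarrow> tensor" where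
  "t_add C D = map2 (+) C D"

fun t_sum :: "tensor list \<Rightarrow> tensor" where
  "t_sum [] = []"
| "t_sum [C] = C"
| "t_sum (C # D # Ds) = t_add C (t_sum (D # Ds))"

fun t_prod :: "tensor list \<Rightarrow> tensor" where
  "t_prod [] = []"
| "t_prod [C] = C"
| "t_prod (C # D # Ds) = C \<star> t_prod (D # Ds)"

definition omega :: "nat \<Rightarrow> complex" where
  "omega p = cis (- 2 * pi / real p)"

text \<open>Fourier block k (0-based): C_k = sum_j omega^(j k) C^(j), so that
  bcirc C = (F_p^H (x) I) Diag(C_0..C_(p-1)) (F_p (x) I) with F_p the normalized DFT
  matrix with entries omega^(a b)/sqrt p.\<close>
definition fblock :: "tensor \<Rightarrow> nat \<Rightarrow> complex mat" where
  "fblock C k = mat (t_rows C) (t_cols C)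
     (\<lambda>(r, c). \<Sum>j<length C. omega (length C) ^ (j * k) * (C ! j) $$ (r, c))"

definition mat_eigenvalues :: "complex mat \<Rightarrow> complex multiset" where
  "mat_eigenvalues A = proots (char_poly A)"

definition t_eigenvalues :: "tensor \<Rightarrow> complex multiset" where
  "t_eigenvalues C = (\<Sum>k<length C. mat_eigenvalues (fblock C k))"

definition mat_singular_values :: "complex mat \<Rightarrow> real multiset" where
  "mat_singular_values A = image_mset (\<lambda>z. sqrt (Re z)) (mat_eigenvalues (mat_adjoint A * A))"

definition t_singular_values :: "tensor \<Rightarrow> real multiset" where
  "t_singular_values C = (\<Sum>k<length C. mat_singular_values (fblock C k))"

definition TPD :: "tensor \<Rightarrow> bool" where
  "TPD C \<longleftrightarrow> (t_symmetric C \<or> t_hermitian C) \<and>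
     (\<forall>z\<in>#t_eigenvalues C. Im z = 0 \<and> 0 < Re z)"

definition unitary_mat :: "nat \<Rightarrow> complex mat \<Rightarrow> bool" where
  "unitary_mat k U \<longleftrightarrow> U \<in> carrier_mat k k \<and> U * mat_adjoint U = 1\<^sub>m k"

definition mat_fun :: "(real \<Rightarrow> complex) \<Rightarrow> complex mat \<Rightarrow> complex mat" where
  "mat_fun h A = (SOME B. \<exists>U d. unitary_mat (dim_row A) U \<and>
      A = U * mat_diag (dim_row A) (\<lambda>i. complex_of_real (d i)) * mat_adjoint U \<and>
      B = U * mat_diag (dim_row A) (\<lambda>i. h (d i)) * mat_adjoint U)"

text \<open>h(C) for a Hermitian/symmetric square tensor: apply h to each Fourier block,
  then transform back (inverse DFT of the blocks gives the frontal slices).\<close>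
definition t_fun :: "(real \<Rightarrow> complex) \<Rightarrow> tensor \<Rightarrow> tensor" where
  "t_fun h C = (let p = length C; m = t_rows C in
     map (\<lambda>j. mat m m (\<lambda>(r, c). (1 / of_nat p) *
        (\<Sum>k<p. cnj (omega p) ^ (j * k) * (mat_fun h (fblock C k)) $$ (r, c)))) [0..<p])"

definition t_exp :: "tensor \<Rightarrow> tensor" where
  "t_exp C = t_fun (\<lambda>x. complex_of_real (exp x)) C"

definition t_log :: "tensor \<Rightarrow> tensor" where
  "t_log C = t_fun (\<lambda>x. complex_of_real (ln x)) C"

definition t_cpow :: "tensor \<Rightarrow> complex \<Rightarrow> tensor" where
  "t_cpow C z = t_fun (\<lambda>x. exp (z * complex_of_real (ln x))) C"

definition t_abs :: "tensor \<Rightarrow> tensor" where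
  "t_abs H = t_fun (\<lambda>x. complex_of_real (sqrt x)) (t_adj H \<star> H)"

definition symmetric_gauge :: "nat \<Rightarrow> (real list \<Rightarrow> real) \<Rightarrow> bool" where
  "symmetric_gauge N \<rho> \<longleftrightarrow>
     (\<forall>x. length x = N \<longrightarrow> (\<rho> x = 0 \<longleftrightarrow> (\<forall>a\<in>set x. a = 0))) \<and>
     (\<forall>x c. length x = N \<longrightarrow> \<rho> (map (\<lambda>a. c * a) x) = \<bar>c\<bar> * \<rho> x) \<and>
     (\<forall>x y. length x = N \<longrightarrow> length y = N \<longrightarrow> \<rho> (map2 (+) x y) \<le> \<rho> x + \<rho> y) \<and>
     (\<forall>x y. length x = N \<longrightarrow> mset x = mset y \<longrightarrow> \<rho> x = \<rho> y) \<and>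
     (\<forall>x. length x = N \<longrightarrow> \<rho> (map abs x) = \<rho> x)"

definition ui_norm :: "(real list \<Rightarrow> real) \<Rightarrow> tensor \<Rightarrow> real" where
  "ui_norm \<rho> H = \<rho> (rev (sorted_list_of_multiset (t_singular_values H)))"

definition beta0 :: "real \<Rightarrow> real" where
  "beta0 t = pi / (2 * (cosh (pi * t) + 1))"

end

theory Submission
  imports Defs "HOL-Complex_Analysis.Conformal_Mappings" "HOL-Real_Asymp.Real_Asymp"
begin

text \<open>Discrete Fourier blocks turn the statement into one about positive definite matrices A1, ..., An. Put
  G(z) = A1^z * ... * An^z, so that G(0) = 1 and G'(0) = H = log A1 + ... + log An; let x be the
  eigenvalues of H and y(t) the logarithms of the singular values of G(1 + it). In an eigenbasis of H
  the leading k-th minor F of G satisfies F(0) = 1 and F'(0) = x1 + ... + xk. It is bounded by 1 on the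
  imaginary axis, where G is unitary, and by the product of the k largest singular values on the line
  Re z = 1. Comparing F with the Poisson integral of this bound on the strip and differentiating at the
  boundary point 0 shows that x1 + ... + xk is at most the integral of beta0 times the sum of the k
  largest y(t); for maximal k there is equality, by determinants. A convex symmetric function \<Phi> has a
  subgradient a at x. Numbering the eigenvalues so that a decreases, Abel summation shows that \<Phi>(x) is at
  most the integral of beta0 * \<Phi>(y(t)). The two claims are the cases \<Phi>(y) = ln (\<rho> (f (exp y))) and
  \<Phi>(y) = \<rho> (g (exp y)).\<close>

text \<open>The logarithm of a product of non-commuting matrices is intractable, but at
  \<open>z = 0\<close> every factor of \<open>G\<close> is the identity, so the product rule yields
  the sum of the logarithms at once: a derivative stands in for a limit of Lie--Trotter type. The
  price is that 0 lies on the boundary of the strip, where the harmonic measure of the line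
  \<open>Re z = 1\<close> vanishes; \<open>beta0\<close> is its first-order rate, the normal
  derivative of the Poisson kernel. The imaginary axis contributes nothing, since unitarity gives
  the bound log 1 = 0 there. Minors are scalar entire functions, so a scalar maximum principle
  replaces interpolation of operator norms. Their bound involves singular values only and holds for
  any ordering of the eigenbasis of \<open>H\<close>. This freedom allows the weights
  \<open>a\<close> to be sorted instead of \<open>x\<close>, so nothing has to be known about how a
  subgradient is ordered relative to \<open>x\<close>. Equality at maximal \<open>k\<close> is what
  admits weights of either sign.\<close>

hide_const (open) Finite_Cartesian_Product.mat Finite_Cartesian_Product.vec Finite_Cartesian_Product.row
  Determinants.det
no_notation inner (infix "\<bullet>" 70)
no_notation Finite_Cartesian_Product.vec_nth (infixl "$" 90)
no_notation fps_nth (infixl "$" 75)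

section \<open>Adjoints and the spectral theorem\<close>

abbreviation adj :: "complex mat \<Rightarrow> complex mat" where "adj \<equiv> mat_adjoint"

lemma adj_dim [simp]: "dim_row (adj A) = dim_col A" "dim_col (adj A) = dim_row A"
  by (auto simp: mat_adjoint_def)

lemma adj_carrier [simp]: "A \<in> carrier_mat n m \<Longrightarrow> adj A \<in> carrier_mat m n"
  by (rule carrier_matI) auto

lemma adj_index [simp]:
  "i < dim_col A \<Longrightarrow> j < dim_row A \<Longrightarrow> adj (A :: complex mat) $$ (i, j) = cnj (A $$ (j, i))"
  by (simp add: mat_adjoint_def mat_of_rows_def)

lemma mult_index: "i < dim_row A \<Longrightarrow> j < dim_col B \<Longrightarrow> dim_col A = dim_row B \<Longrightarrow>
    (A * B) $$ (i, j) = (\<Sum>k<dim_row B. A $$ (i, k) * B $$ (k, j))"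
  by (simp add: scalar_prod_def lessThan_atLeast0)

lemma adj_mult:
  assumes "A \<in> carrier_mat n k" "B \<in> carrier_mat k m"
  shows "adj (A * B :: complex mat) = adj B * adj A"
  by (rule eq_matI) (use assms in \<open>auto simp: mult_index mult.commute simp del: index_mult_mat(1)\<close>)

lemma adj_adj [simp]: "adj (adj A) = (A :: complex mat)"
  by (rule eq_matI) auto

lemma adj_mat_diag: "adj (mat_diag n d) = mat_diag n (\<lambda>i. cnj (d i))"
  by (rule eq_matI) (auto simp: mat_diag_def)

lemma adj_add: "A \<in> carrier_mat n m \<Longrightarrow> B \<in> carrier_mat n m \<Longrightarrow>
    adj (A + B :: complex mat) = adj A + adj B"
  by (rule eq_matI) auto

lemma adj_one [simp]: "adj (1\<^sub>m n :: complex mat) = 1\<^sub>m n"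
  by (rule eq_matI) auto

lemma mult_carrier_sq [simp]: "A \<in> carrier_mat n n \<Longrightarrow> B \<in> carrier_mat n n \<Longrightarrow> A * B \<in> carrier_mat n n"
  by (rule mult_carrier_mat)

lemma assoc_sq: "A \<in> carrier_mat n n \<Longrightarrow> B \<in> carrier_mat n n \<Longrightarrow> C \<in> carrier_mat n n \<Longrightarrow>
    A * B * C = A * (B * C :: complex mat)"
  by (rule assoc_mult_mat)

lemma mat_diag_dims [simp]: "dim_row (mat_diag n d) = n" "dim_col (mat_diag n d) = n"
  by (auto simp: mat_diag_def)

lemma unitary_matD:
  assumes "unitary_mat n U"
  shows "U \<in> carrier_mat n n" "U * adj U = 1\<^sub>m n" "adj U * U = 1\<^sub>m n"
    "adj U \<in> carrier_mat n n" "dim_row U = n" "dim_col U = n"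
  using assms mat_mult_left_right_inverse[of U n "adj U"]
  by (auto simp: unitary_mat_def)

lemma unitary_matI: "U \<in> carrier_mat n n \<Longrightarrow> adj U * U = 1\<^sub>m n \<Longrightarrow> unitary_mat n U"
  using mat_mult_left_right_inverse[of "adj U" n U] by (auto simp: unitary_mat_def)

lemma unitary_adj: "unitary_mat n U \<Longrightarrow> unitary_mat n (adj U)"
  by (rule unitary_matI) (auto dest: unitary_matD)

lemma unitary_mult:
  assumes "unitary_mat n U" "unitary_mat n V"
  shows "unitary_mat n (U * V)"
proof (rule unitary_matI)
  note U = unitary_matD[OF assms(1)] and V = unitary_matD[OF assms(2)]
  show "U * V \<in> carrier_mat n n" using U V by auto
  have "adj (U * V) * (U * V) = adj V * (adj U * U) * V"
    using U(1,4) V(1,4) by (simp add: adj_mult[OF U(1) V(1)] assoc_sq[where n=n])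
  then show "adj (U * V) * (U * V) = 1\<^sub>m n" using U V by simp
qed

lemma unitary_cancel:
  assumes "unitary_mat n U" "A \<in> carrier_mat n n"
  shows "U * (adj U * A) = A" "adj U * (U * A) = A"
  using unitary_matD[OF assms(1)] assms(2)
  by (simp_all flip: assoc_sq[where n=n])

text \<open>Positive matrices, their powers, logarithms and Gram matrices are all carried in this
  form: determinants, functional calculus and products over a common \<open>U\<close> become
  operations on \<open>d\<close>.\<close>

abbreviation udiag :: "nat \<Rightarrow> complex mat \<Rightarrow> (nat \<Rightarrow> complex) \<Rightarrow> complex mat" where
  "udiag n U d \<equiv> U * mat_diag n d * adj U"

abbreviation real_udiag :: "nat \<Rightarrow> complex mat \<Rightarrow> (nat \<Rightarrow> real) \<Rightarrow> complex mat" where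
  "real_udiag n U d \<equiv> udiag n U (\<lambda>i. of_real (d i))"

lemma udiag_adj:
  assumes "U \<in> carrier_mat n n"
  shows "adj (udiag n U d) = udiag n U (\<lambda>i. cnj (d i))"
  using assms
  by (simp add: adj_mult[where n=n and k=n and m=n] adj_mat_diag assoc_sq[where n=n])

lemma udiag_mult:
  assumes "unitary_mat n U"
  shows "udiag n U d * udiag n U e = udiag n U (\<lambda>i. d i * e i)"
proof -
  note U = unitary_matD[OF assms]
  have "udiag n U d * udiag n U e = U * (mat_diag n d * (adj U * (U * (mat_diag n e * adj U))))"
    using U(1,4) by (simp add: assoc_sq[where n=n])
  also have "\<dots> = U * (mat_diag n d * (mat_diag n e * adj U))"
    using U(1,4) by (simp add: unitary_cancel[OF assms])
  also have "\<dots> = udiag n U (\<lambda>i. d i * e i)"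
    using U(1,4) by (simp add: assoc_sq[where n=n, symmetric])
  finally show ?thesis .
qed

lemma udiag_index:
  assumes "U \<in> carrier_mat n n" "i < n" "j < n"
  shows "udiag n U d $$ (i, j) = (\<Sum>k<n. U $$ (i, k) * d k * cnj (U $$ (j, k)))"
proof -
  have "udiag n U d $$ (i, j) = (\<Sum>k<n. (U * mat_diag n d) $$ (i, k) * cnj (U $$ (j, k)))"
    using assms by (subst mult_index) auto
  also have "\<dots> = (\<Sum>k<n. U $$ (i, k) * d k * cnj (U $$ (j, k)))"
    using assms by (intro sum.cong) (auto simp: mat_diag_mult_right[of _ n])
  finally show ?thesis .
qed

lemma det_mat_diag: "det (mat_diag n d :: complex mat) = (\<Prod>i<n. d i)"
proof -
  have "det (mat_diag n d) = prod_list (diag_mat (mat_diag n d))"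
    by (rule det_upper_triangular[where n=n]) (auto simp: mat_diag_def)
  also have "diag_mat (mat_diag n d) = map d [0..<n]"
    by (auto simp: diag_mat_def mat_diag_def)
  finally show ?thesis by (simp add: prod.distinct_set_conv_list[symmetric] lessThan_atLeast0)
qed

lemma udiag_det:
  assumes "unitary_mat n U"
  shows "det (udiag n U d) = (\<Prod>i<n. d i)"
proof -
  note U = unitary_matD[OF assms]
  have "det (udiag n U d) = det U * det (mat_diag n d) * det (adj U)"
    using U(1,4) by (simp add: det_mult[where n=n])
  also have "\<dots> = det (mat_diag n d) * det (U * adj U)"
    using U(1,4) by (simp add: det_mult[OF U(1,4)] del: U)
  finally show ?thesis by (simp add: U det_mat_diag)
qed

lemma udiag_permute:
  assumes U: "unitary_mat n U" and p: "p permutes {..<n}"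
  defines "U' \<equiv> mat n n (\<lambda>(i, j). U $$ (i, p j))"
  shows "unitary_mat n U'" "udiag n U' (\<lambda>i. d (p i)) = udiag n U d"
proof -
  have plt: "p j < n" if "j < n" for j using p that permutes_in_image[OF p, of j] by auto
  have U'c: "U' \<in> carrier_mat n n" by (simp add: U'_def)
  \<comment> \<open>Kept general in \<open>e\<close>, because the case \<open>e = 1\<close> is the
    unitarity of \<open>U'\<close>.\<close>
  have eq: "udiag n U' (\<lambda>i. e (p i)) = udiag n U e" for e
  proof (rule eq_matI)
    fix i j assume "i < dim_row (udiag n U e)" "j < dim_col (udiag n U e)"
    then have ij: "i < n" "j < n" using unitary_matD[OF U] by auto
    have "udiag n U' (\<lambda>i. e (p i)) $$ (i, j) = (\<Sum>k<n. U $$ (i, p k) * e (p k) * cnj (U $$ (j, p k)))"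
      using ij by (subst udiag_index[OF U'c]) (auto simp: U'_def)
    also have "\<dots> = (\<Sum>k<n. U $$ (i, k) * e k * cnj (U $$ (j, k)))"
      by (rule sum.permute[OF p, symmetric, unfolded comp_def])
    finally show "udiag n U' (\<lambda>i. e (p i)) $$ (i, j) = udiag n U e $$ (i, j)"
      using ij by (simp add: udiag_index[OF unitary_matD(1)[OF U]] del: index_mult_mat)
  qed (use U'c unitary_matD[OF U] in auto)
  show "udiag n U' (\<lambda>i. d (p i)) = udiag n U d" by (rule eq)
  show "unitary_mat n U'"
    using eq[of "\<lambda>_. 1"] U'c unitary_matD[OF U] by (auto simp: unitary_mat_def)
qed

text \<open>Gram--Schmidt on a basis starting with \<open>v\<close> keeps \<open>v\<close> and
  orthogonalises without normalising, so each column is afterwards divided by its length;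
  \<open>c\<close> is the reciprocal length of \<open>v\<close>.\<close>

lemma exists_unitary_first_column:
  assumes v: "v \<in> carrier_vec n" "v \<noteq> 0\<^sub>v n"
  obtains W c where "unitary_mat n W" "\<And>i. i < n \<Longrightarrow> W $$ (i, 0) = c * (v $ i)"
proof -
  have n: "0 < n" using v by (cases n) auto
  interpret cof_vec_space n "TYPE(complex)" .
  define b where "b = basis_completion v"
  define ws where "ws = gram_schmidt n b"
  from basis_completion[OF v, folded b_def]
  have dist_b: "distinct b" and indep: "\<not> lin_dep (set b)" and b: "set b \<subseteq> carrier_vec n"
    and hdb: "hd b = v" and len_b: "length b = n" by auto
  from hdb len_b n obtain vs where bv: "b = v # vs" by (cases b) auto
  from gram_schmidt_result[OF b dist_b indep refl, folded ws_def]
  have ws: "set ws \<subseteq> carrier_vec n" "corthogonal ws" "length ws = n"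
    by (auto simp: len_b)
  from gram_schmidt_hd[OF v(1), of vs, folded bv] have hdws: "hd ws = v" unfolding ws_def .
  define s where "s i = (\<Sum>k<n. (cmod (ws ! i $ k))^2)" for i
  have ip: "ws ! j \<bullet>c ws ! i = (\<Sum>k<n. cnj (ws ! i $ k) * ws ! j $ k)" if "i < n" "j < n" for i j
  proof -
    have "dim_vec (ws ! i) = n" "dim_vec (ws ! j) = n" using ws that by (auto simp: subset_iff)
    then show ?thesis by (simp add: scalar_prod_def lessThan_atLeast0 mult.commute)
  qed
  have ss: "(\<Sum>k<n. cnj (ws ! i $ k) * ws ! i $ k) = of_real (s i)" for i
    unfolding s_def of_real_sum by (rule sum.cong) (auto simp: complex_norm_square mult.commute simp del: of_real_power)
  have spos: "0 < s i" if "i < n" for i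
  proof -
    \<comment> \<open>\<open>corthogonal\<close> includes that no vector of the list is orthogonal
      to itself.\<close>
    have "s i \<noteq> 0" using corthogonalD[OF ws(2), of i i] that ws(3) ip[of i i] ss[of i] by auto
    then show ?thesis by (simp add: s_def order_less_le sum_nonneg)
  qed
  define W where "W = mat n n (\<lambda>(k, i). ws ! i $ k / of_real (sqrt (s i)))"
  have Wc: "W \<in> carrier_mat n n" by (simp add: W_def)
  have "adj W * W = 1\<^sub>m n"
  proof (rule eq_matI)
    fix i j assume ij: "i < dim_row (1\<^sub>m n :: complex mat)" "j < dim_col (1\<^sub>m n :: complex mat)"
    then have "(adj W * W) $$ (i, j) =
        (\<Sum>k<n. cnj (ws ! i $ k) * ws ! j $ k / (of_real (sqrt (s i)) * of_real (sqrt (s j))))"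
      using Wc by (subst mult_index) (auto simp: W_def)
    also have "\<dots> = ws ! j \<bullet>c ws ! i / (of_real (sqrt (s i)) * of_real (sqrt (s j)))"
      using ij by (simp add: ip sum_divide_distrib)
    also have "\<dots> = (if i = j then 1 else 0)"
    proof (cases "i = j")
      case True
      have "complex_of_real (sqrt (s i)) * of_real (sqrt (s i)) = of_real (s i)"
        using spos[of i] ij by (simp flip: of_real_mult)
      then show ?thesis using True spos[of i] ij ip[of i i] ss[of i] by simp
    next
      case False
      then show ?thesis using corthogonalD[OF ws(2), of j i] ij ws(3) by auto
    qed
    finally show "(adj W * W) $$ (i, j) = 1\<^sub>m n $$ (i, j)" using ij by simp
  qed (use Wc in auto)
  then have "unitary_mat n W" using Wc by (rule unitary_matI[rotated])
  moreover have "ws ! 0 = v" using hdws n ws(3) by (cases ws) auto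
  then have "W $$ (i, 0) = 1 / of_real (sqrt (s 0)) * v $ i" if "i < n" for i
    using that n by (simp add: W_def)
  ultimately show ?thesis by (rule that)
qed

text \<open>Deflation: in a unitary basis starting with an eigenvector the first column is
  \<open>e\<close> times a unit vector, and self-adjointness clears the first row as well. A
  self-adjoint block of size one less remains.\<close>

theorem hermitian_udiag:
  assumes "A \<in> carrier_mat n n" "adj A = A"
  obtains U d where "unitary_mat n U" "A = real_udiag n U d"
proof -
  have "\<exists>U d. unitary_mat n U \<and> A = real_udiag n U d"
    using assms
  proof (induction n arbitrary: A)
    case 0
    then have "A = udiag 0 (1\<^sub>m 0) (\<lambda>i. of_real 0)" by (intro eq_matI) auto
    moreover have "unitary_mat 0 (1\<^sub>m 0)" by (simp add: unitary_mat_def)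
    ultimately show ?case by (intro exI[of _ "1\<^sub>m 0"] exI[of _ "\<lambda>_. 0"]) auto
  next
    case (Suc n)
    note A = Suc.prems
    have "degree (char_poly A) = Suc n" using degree_monic_char_poly[OF A(1)] by simp
    then have "\<exists>e. poly (char_poly A) e = 0"
      using Fundamental_Theorem_Algebra.fundamental_theorem_of_algebra[of "char_poly A"] by (auto simp: constant_degree)
    then obtain e where "eigenvalue A e" using eigenvalue_root_char_poly[OF A(1)] by auto
    then obtain v where v: "v \<in> carrier_vec (Suc n)" "v \<noteq> 0\<^sub>v (Suc n)" "A *\<^sub>v v = e \<cdot>\<^sub>v v"
      using A(1) by (auto simp: eigenvalue_def eigenvector_def)
    obtain W c where W: "unitary_mat (Suc n) W" and Wv: "\<And>i. i < Suc n \<Longrightarrow> W $$ (i, 0) = c * (v $ i)"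
      using exists_unitary_first_column[OF v(1,2)] by blast
    note W' = unitary_matD[OF W]
    define B where "B = adj W * (A * W)"
    have Bc: "B \<in> carrier_mat (Suc n) (Suc n)" using A W' by (simp add: B_def)
    have AW0: "(A * W) $$ (i, 0) = e * W $$ (i, 0)" if "i < Suc n" for i
    proof -
      have "(A * W) $$ (i, 0) = c * (\<Sum>k<Suc n. A $$ (i, k) * v $ k)"
        using that A W' by (subst mult_index) (auto simp: Wv sum_distrib_left mult_ac simp del: sum.lessThan_Suc intro!: sum.cong)
      also have "(\<Sum>k<Suc n. A $$ (i, k) * v $ k) = (A *\<^sub>v v) $ i"
        using that A(1) v(1) by (simp add: scalar_prod_def lessThan_atLeast0 del: sum.op_ivl_Suc)
      finally show ?thesis using that v by (simp add: Wv)
    qed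
    have B0: "B $$ (i, 0) = (if i = 0 then e else 0)" if "i < Suc n" for i
    proof -
      have "B $$ (i, 0) = (\<Sum>k<Suc n. adj W $$ (i, k) * (A * W) $$ (k, 0))"
        unfolding B_def using that A W' by (subst mult_index) auto
      also have "\<dots> = e * (\<Sum>k<Suc n. adj W $$ (i, k) * W $$ (k, 0))"
        unfolding sum_distrib_left using AW0 by (intro sum.cong) auto
      also have "(\<Sum>k<Suc n. adj W $$ (i, k) * W $$ (k, 0)) = (adj W * W) $$ (i, 0)"
        using that W' by (subst mult_index) auto
      finally show ?thesis using that W' by simp
    qed
    have Bh: "adj B = B"
      using A W' by (simp add: B_def adj_mult[where n="Suc n" and k="Suc n" and m="Suc n"] assoc_sq[where n="Suc n"])
    have Bh': "B $$ (i, j) = cnj (B $$ (j, i))" if "i < Suc n" "j < Suc n" for i j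
      using that Bc adj_index[of i B j] by (simp add: Bh)
    define A3 where "A3 = mat n n (\<lambda>(i, j). B $$ (Suc i, Suc j))"
    have "adj A3 = A3"
      by (rule eq_matI) (auto simp: A3_def intro!: Bh'[symmetric])
    then obtain U3 d3 where U3: "unitary_mat n U3" and A3: "A3 = real_udiag n U3 d3"
      using Suc.IH[of A3] by (auto simp: A3_def)
    note U3' = unitary_matD[OF U3]
    \<comment> \<open>The direct sum of the 1 by 1 identity and \<open>U3\<close>.\<close>
    define V where "V = mat (Suc n) (Suc n) (\<lambda>(i, j). case (i, j) of (0, 0) \<Rightarrow> 1 | (Suc i, Suc j) \<Rightarrow> U3 $$ (i, j) | _ \<Rightarrow> 0)"
    have Vc: "V \<in> carrier_mat (Suc n) (Suc n)" by (simp add: V_def)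
    have V00: "V $$ (0, 0) = 1" and V0S: "\<And>i. i < n \<Longrightarrow> V $$ (0, Suc i) = 0" "\<And>i. i < n \<Longrightarrow> V $$ (Suc i, 0) = 0"
      and VSS: "\<And>i j. i < n \<Longrightarrow> j < n \<Longrightarrow> V $$ (Suc i, Suc j) = U3 $$ (i, j)"
      by (auto simp: V_def)
    \<comment> \<open>Conjugation by a direct sum stays a direct sum. Taking \<open>f = 1\<close>
      gives unitarity of \<open>V\<close>, taking \<open>f = d\<close> the diagonal form of
      \<open>B\<close>.\<close>
    have key: "udiag (Suc n) V f $$ (i, j) = (case (i, j) of (0, 0) \<Rightarrow> f 0 | (Suc i, Suc j) \<Rightarrow> udiag n U3 (\<lambda>i. f (Suc i)) $$ (i, j) | _ \<Rightarrow> 0)"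
      if ij: "i < Suc n" "j < Suc n" for f i j
      using ij
      by (cases i; cases j)
        (simp_all add: udiag_index[OF Vc] udiag_index[OF U3'(1)] sum.lessThan_Suc_shift V00 V0S VSS
          del: index_mult_mat sum.lessThan_Suc)
    have V: "unitary_mat (Suc n) V"
    proof -
      have U31: "udiag n U3 (\<lambda>_. 1) = 1\<^sub>m n" using U3' by (simp add: right_mult_one_mat[of _ n n])
      have "udiag (Suc n) V (\<lambda>_. 1) = 1\<^sub>m (Suc n)"
      proof (rule eq_matI)
        fix i j assume "i < dim_row (1\<^sub>m (Suc n) :: complex mat)" "j < dim_col (1\<^sub>m (Suc n) :: complex mat)"
        then show "udiag (Suc n) V (\<lambda>_. 1) $$ (i, j) = 1\<^sub>m (Suc n) $$ (i, j)"
          by (auto simp: key U31 split: nat.splits simp del: index_mult_mat mat_diag_one)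
      qed (use Vc in auto)
      then show ?thesis using Vc by (simp add: unitary_mat_def right_mult_one_mat[of _ "Suc n" "Suc n"])
    qed
    define d where "d i = (case i of 0 \<Rightarrow> Re e | Suc i \<Rightarrow> d3 i)" for i
    have "Im e = 0" using Bh'[of 0 0] B0[of 0] by (simp add: complex_eq_iff)
    then have e: "complex_of_real (Re e) = e" by (simp add: complex_eq_iff)
    have B: "B = real_udiag (Suc n) V d"
    proof (rule eq_matI)
      fix i j assume "i < dim_row (real_udiag (Suc n) V d)" "j < dim_col (real_udiag (Suc n) V d)"
      then have ij: "i < Suc n" "j < Suc n" using Vc by auto
      then show "B $$ (i, j) = real_udiag (Suc n) V d $$ (i, j)"
        using B0[of i] B0[of j] Bh'[of i j] A3[symmetric]
        by (auto simp: key d_def e A3_def split: nat.splits simp del: index_mult_mat)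
    qed (use Bc Vc in auto)
    have "A = W * (B * adj W)"
      using A W' by (simp add: B_def assoc_sq[where n="Suc n"] unitary_cancel[OF W])
    also have "\<dots> = real_udiag (Suc n) (W * V) d"
      unfolding B using W' Vc by (simp add: adj_mult[where n="Suc n" and k="Suc n" and m="Suc n"] assoc_sq[where n="Suc n"])
    finally show ?case using unitary_mult[OF W V] by blast
  qed
  then show ?thesis using that by blast
qed

section \<open>Bounded holomorphic functions on a strip\<close>

text \<open>Phragmen--Lindelof: the strip is unbounded, so \<open>Q\<close> is multiplied by
  \<open>exp (\<epsilon> * (z^2 - 1))\<close>, whose modulus is at most 1 on the strip and decays
  like a Gaussian in \<open>Im z\<close>. The maximum principle on a tall rectangle applies to the
  product; then \<open>\<epsilon>\<close> is made small.\<close>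

lemma strip_maximum_modulus:
  fixes Q :: "complex \<Rightarrow> complex"
  assumes hol: "Q holomorphic_on {z. - 1 < Re z \<and> Re z < 1}" and r: "0 < r" "r < 1"
    and bnd: "\<And>z. 0 \<le> Re z \<Longrightarrow> Re z \<le> r \<Longrightarrow> cmod (Q z) \<le> B"
    and left: "\<And>y. cmod (Q (Complex 0 y)) \<le> 1" and right: "\<And>y. cmod (Q (Complex r y)) \<le> 1"
    and z: "0 \<le> Re z" "Re z \<le> r"
  shows "cmod (Q z) \<le> 1"
proof -
  have damped: "cmod (Q z) * exp (\<epsilon> * ((Re z)^2 - (Im z)^2 - 1)) \<le> 1" if e: "0 < \<epsilon>" for \<epsilon>
  proof -
    define P where "P w = Q w * exp (of_real \<epsilon> * (w^2 - 1))" for w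
    have nP: "cmod (P w) = cmod (Q w) * exp (\<epsilon> * ((Re w)^2 - (Im w)^2 - 1))" for w
      by (simp add: P_def norm_mult power2_eq_square)
    define B' where "B' = max B 1"
    \<comment> \<open>Tall enough that \<open>B' \<le> \<epsilon> * Y \<le> \<epsilon> * Y^2 \<le>
      exp (\<epsilon> * Y^2)\<close>: on the horizontal sides the damping beats the bound of
      \<open>Q\<close>.\<close>
    define Y where "Y = \<bar>Im z\<bar> + 1 + B' / \<epsilon>"
    have B': "1 \<le> B'" "B \<le> B'" by (auto simp: B'_def)
    have Y: "1 \<le> Y" "\<bar>Im z\<bar> \<le> Y" "B' \<le> \<epsilon> * Y" using e B' by (auto simp: Y_def field_simps)
    have small: "exp (\<epsilon> * ((Re w)^2 - (Im w)^2 - 1)) \<le> exp (- \<epsilon> * (Im w)^2)" if "0 \<le> Re w" "Re w \<le> r" for w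
    proof -
      have "(Re w)^2 \<le> 1" using that r by (intro power_le_one) auto
      then have "\<epsilon> * ((Re w)^2 - (Im w)^2 - 1) \<le> \<epsilon> * (- ((Im w)^2))" using e by (intro mult_left_mono) auto
      then show ?thesis by simp
    qed
    let ?R = "cbox (Complex 0 (- Y)) (Complex r Y)"
    have inR: "w \<in> ?R \<longleftrightarrow> 0 \<le> Re w \<and> Re w \<le> r \<and> - Y \<le> Im w \<and> Im w \<le> Y" for w
      by (auto simp: in_cbox_complex_iff)
    have "cmod (P z) \<le> 1"
    proof (rule maximum_modulus_frontier[where f = P and S = ?R])
      have holP: "P holomorphic_on {z. - 1 < Re z \<and> Re z < 1}"
        unfolding P_def by (intro holomorphic_intros hol)
      have sub: "?R \<subseteq> {z. - 1 < Re z \<and> Re z < 1}" using r by (auto simp: inR)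
      show "P holomorphic_on interior ?R" by (rule holomorphic_on_subset[OF holP]) (use sub interior_subset in blast)
      show "continuous_on (closure ?R) P"
        using holomorphic_on_imp_continuous_on[OF holomorphic_on_subset[OF holP sub]] by simp
      show "bounded ?R" by simp
      show "z \<in> ?R" using z Y by (auto simp: inR)
      fix w assume "w \<in> frontier ?R"
      then have w: "0 \<le> Re w" "Re w \<le> r" and "Re w = 0 \<or> Re w = r \<or> Im w = Y \<or> Im w = - Y"
        by (auto simp: frontier_cbox in_cbox_complex_iff in_box_complex_iff)
      then consider "Re w = 0 \<or> Re w = r" | "\<bar>Im w\<bar> = Y" using Y by linarith
      then show "cmod (P w) \<le> 1"
      proof cases
        case 1
        then have "cmod (Q w) \<le> 1" using left[of "Im w"] right[of "Im w"] by (metis complex_surj)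
        moreover have "exp (\<epsilon> * ((Re w)^2 - (Im w)^2 - 1)) \<le> 1"
        proof -
          have "exp (- \<epsilon> * (Im w)^2) \<le> 1" using e by simp
          then show ?thesis using small[OF w] by linarith
        qed
        ultimately show ?thesis unfolding nP by (intro mult_le_one) auto
      next
        case 2
        then have "(Im w)^2 = Y^2" by (metis power2_abs)
        have "\<epsilon> * Y \<le> \<epsilon> * Y^2" using e Y self_le_power[of Y 2] by (intro mult_left_mono) auto
        then have "B' \<le> \<epsilon> * Y^2" using Y by linarith
        then have "B' \<le> exp (\<epsilon> * Y^2)" using exp_ge_add_one_self[of "\<epsilon> * Y^2"] by linarith
        then have "B' * exp (- \<epsilon> * Y^2) \<le> 1" by (simp add: exp_minus divide_simps)
        moreover have "cmod (P w) \<le> B' * exp (- \<epsilon> * (Im w)^2)" unfolding nP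
          using bnd[OF w] B' small[OF w] by (intro mult_mono) auto
        ultimately show ?thesis using \<open>(Im w)^2 = Y^2\<close> by simp
      qed
    qed
    then show ?thesis by (simp add: nP)
  qed
  show ?thesis
  proof (rule ccontr)
    assume "\<not> cmod (Q z) \<le> 1"
    then have Q: "1 < cmod (Q z)" by simp
    \<comment> \<open>Instead of a limit, the single value \<open>\<epsilon> = L / (2 * c)\<close>
      makes the damping factor \<open>exp (- (L / 2))\<close>, which leaves
      \<open>exp (L / 2) \<le> 1\<close> against \<open>L > 0\<close>.\<close>
    define c where "c = 1 + (Im z)^2 - (Re z)^2"
    have "(Re z)^2 < 1" using z r by (simp add: power_less_one_iff abs_square_less_1)
    moreover have "0 \<le> (Im z)^2" by simp
    ultimately have c: "0 < c" unfolding c_def by linarith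
    define L where "L = ln (cmod (Q z))"
    have L: "0 < L" unfolding L_def by (rule ln_gt_zero[OF Q])
    have "0 < cmod (Q z)" using Q by linarith
    then have QL: "cmod (Q z) = exp L" unfolding L_def by (simp only: exp_ln)
    have "L / (2 * c) * ((Re z)^2 - (Im z)^2 - 1) = - (L / 2)"
      using c by (simp add: c_def field_simps)
    then have "exp L * exp (- (L / 2)) \<le> 1" using damped[of "L / (2 * c)"] L c by (simp add: QL)
    then have "exp (L / 2) \<le> 1" by (simp flip: exp_add)
    then show False using L by simp
  qed
qed

section \<open>The Poisson kernel of the strip and its holomorphic completion\<close>

lemma Re_tan: "Re (tan w) = sin (2 * Re w) / (cos (2 * Re w) + cosh (2 * Im w))"
proof -
  \<comment> \<open>Expanding the fraction \<open>sin w / cos w\<close> by the conjugate of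
    \<open>cos w\<close> makes its denominator real.\<close>
  have cc: "2 * cos w * cnj (cos w) = of_real (cos (2 * Re w) + cosh (2 * Im w))"
  proof -
    have "2 * cos w * cos (cnj w) = cos (w + cnj w) + cos (w - cnj w)"
      by (simp add: cos_add cos_diff)
    also have "w + cnj w = of_real (2 * Re w)" by (simp add: complex_eq_iff)
    also have "cos (w - cnj w) = of_real (cosh (2 * Im w))"
      by (simp add: complex_eq_iff Re_cos Im_cos cosh_def)
    finally show ?thesis by (simp add: cnj_cos flip: cos_of_real)
  qed
  have sc: "Re (2 * sin w * cnj (cos w)) = sin (2 * Re w)"
  proof -
    have "2 * sin w * cos (cnj w) = sin (w + cnj w) + sin (w - cnj w)"
      by (simp add: sin_add sin_diff)
    also have "w + cnj w = of_real (2 * Re w)" by (simp add: complex_eq_iff)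
    finally show ?thesis by (simp add: cnj_cos Re_sin)
  qed
  show ?thesis
  proof (cases "cos w = 0")
    \<comment> \<open>Both sides are quotients by 0 here, hence 0.\<close>
    case True
    then show ?thesis using cc by (auto simp: tan_def simp del: of_real_add simp flip: of_real_add)
  next
    case False
    then have "tan w = (2 * sin w * cnj (cos w)) / (2 * cos w * cnj (cos w))" by (simp add: tan_def)
    then show ?thesis unfolding cc by (simp only: Re_divide_of_real sc)
  qed
qed

text \<open>The poles of the tangent kernel have odd integers as real parts. So the kernel is
  holomorphic across the imaginary axis, and at 0 there is an ordinary complex derivative.\<close>

lemma cos_nonzero_strip:
  assumes "- 1 < Re z" "Re z < 1"
  shows "cos (of_real (pi / 2) * (z - \<i> * of_real t)) \<noteq> 0"
proof -
  have "- (pi / 2) < pi / 2 * Re z" "pi / 2 * Re z < pi / 2"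
    using mult_strict_left_mono[of "-1" "Re z" "pi / 2"] mult_strict_left_mono[of "Re z" 1 "pi / 2"] assms by simp_all
  then have "0 < cos (pi / 2 * Re z)" by (rule cos_gt_zero_pi)
  then have "Re (cos (of_real (pi / 2) * (z - \<i> * of_real t))) > 0"
    by (simp add: Re_cos add_pos_pos)
  then show ?thesis by auto
qed

text \<open>The Poisson kernel of the strip \<open>0 \<le> Re z \<le> 1\<close> for the line \<open>Re z = 1\<close>. It is the real part of
  \<open>tan (pi (z - \<i> t) / 2) / 2\<close>, whose derivative at \<open>z = 0\<close> is \<open>beta0 t\<close>.\<close>

definition poisson :: "real \<Rightarrow> real \<Rightarrow> real" where
  "poisson r s = sin (pi * r) / (2 * (cos (pi * r) + cosh (pi * s)))"

lemma poisson_denom_pos: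
  assumes "0 \<le> r" "r < 1"
  shows "0 < cos (pi * r) + cosh (pi * s)"
proof -
  have "- 1 < cos (pi * r)"
    using cos_monotone_0_pi[of "pi * r" pi] assms by simp
  then show ?thesis using cosh_real_ge_1[of "pi * s"] by linarith
qed

lemma poisson_nonneg: "0 \<le> r \<Longrightarrow> r < 1 \<Longrightarrow> 0 \<le> poisson r s"
  using poisson_denom_pos[of r s] by (auto simp: poisson_def intro!: divide_nonneg_pos sin_ge_zero)

text \<open>In half angles \<open>cos (pi * r) + cosh (pi * s) = 2 * (C^2 + ch^2 - 1)\<close>. The
  derivative of \<open>arctan\<close> produces the same expression, because
  \<open>C^2 * ch^2 + S^2 * sh^2 = C^2 + ch^2 - 1\<close>.\<close>

lemma poisson_antiderivative:
  assumes "0 \<le> r" "r < 1"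
  shows "((\<lambda>s. arctan (tan (pi * r / 2) * tanh (pi * s / 2)) / pi) has_real_derivative poisson r s) (at s)"
proof -
  define S where "S = sin (pi * r / 2)"
  define C where "C = cos (pi * r / 2)"
  define sh where "sh = sinh (pi * s / 2)"
  define ch where "ch = cosh (pi * s / 2)"
  have C: "0 < C" unfolding C_def using assms by (intro cos_gt_zero_pi) (auto intro: less_le_trans[of _ 0])
  have ch: "0 < ch" by (simp add: ch_def)
  have SC: "S^2 = 1 - C^2" by (simp add: S_def C_def sin_squared_eq)
  have hyp: "sh^2 = ch^2 - 1" by (simp add: sh_def ch_def sinh_square_eq)
  have "sin (pi * r) = 2 * S * C" using sin_double[of "pi * r / 2"] by (simp add: S_def C_def)
  moreover have "cos (pi * r) = 2 * C^2 - 1" using cos_double_cos[of "pi * r / 2"] by (simp add: C_def)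
  moreover have "cosh (pi * s) = 2 * ch^2 - 1" using cosh_double_cosh[of "pi * s / 2"] by (simp add: ch_def)
  ultimately have "poisson r s = 2 * S * C / (2 * (2 * C^2 - 1 + (2 * ch^2 - 1)))"
    by (simp only: poisson_def)
  also have "\<dots> = (2 * (S * C)) / (2 * (2 * (C^2 + ch^2 - 1)))"
    by (rule arg_cong2[where f = "(/)"]) (auto simp: algebra_simps)
  finally have P: "poisson r s = S * C / (2 * (C^2 + ch^2 - 1))"
    by (simp only: mult_divide_mult_cancel_left_if) simp
  have D: "1 + (S / C * (sh / ch))^2 = (C^2 + ch^2 - 1) / (C^2 * ch^2)"
    using C ch by (simp add: power_mult_distrib power_divide SC hyp field_simps)
  have pos: "0 < C^2 + ch^2 - 1"
  proof -
    have "0 < C^2" "1 \<le> ch^2" using C cosh_real_ge_1[of "pi * s / 2"] by (auto simp: ch_def)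
    then show ?thesis by linarith
  qed
  define \<tau> where "\<tau> = tan (pi * r / 2)"
  have "((\<lambda>s. \<tau> * tanh (pi * s / 2)) has_real_derivative \<tau> * ((1 - (tanh (pi * s / 2))^2) * (pi / 2))) (at s)"
    by (auto intro!: derivative_eq_intros)
  from DERIV_chain2[OF DERIV_arctan this]
  have "((\<lambda>s. arctan (\<tau> * tanh (pi * s / 2)) / pi) has_real_derivative
      (1 / (1 + (S / C * (sh / ch))^2) * (S / C * ((1 - (sh / ch)^2) * (pi / 2)))) / pi) (at s)"
    unfolding \<tau>_def S_def C_def sh_def ch_def tan_def tanh_def inverse_eq_divide by (rule DERIV_cdivide)
  also have "(1 / (1 + (S / C * (sh / ch))^2) * (S / C * ((1 - (sh / ch)^2) * (pi / 2)))) / pi = poisson r s"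
  proof -
    define X where "X = C^2 + ch^2 - 1"
    have e1: "1 - (sh / ch)^2 = 1 / ch^2" using ch by (simp add: power_divide hyp field_simps)
    show ?thesis unfolding D P e1 using C ch pos unfolding X_def[symmetric]
      by (simp add: field_simps power2_eq_square)
  qed
  finally show ?thesis by (simp only: \<tau>_def)
qed

lemma continuous_poisson:
  assumes "0 \<le> r" "r < 1"
  shows "continuous_on A (\<lambda>t. poisson r (y - t))"
  unfolding poisson_def using poisson_denom_pos[OF assms]
  by (intro continuous_intros) (metis less_irrefl mult_eq_0_iff zero_neq_numeral)

text \<open>The antiderivative varies by at most 1, because \<open>arctan\<close> stays within
  \<open>pi / 2\<close> of 0; the bound is uniform in \<open>r\<close>, \<open>y\<close> and
  \<open>T\<close>.\<close>

lemma poisson_mass: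
  assumes "0 \<le> r" "r < 1" "0 \<le> T"
  shows "integral {-T..T} (\<lambda>t. poisson r (y - t)) \<le> 1"
proof -
  define A where "A s = arctan (tan (pi * r / 2) * tanh (pi * s / 2)) / pi" for s
  have A': "(A has_real_derivative poisson r s) (at s)" for s
    unfolding A_def by (rule poisson_antiderivative[OF assms(1,2)])
  have "((\<lambda>t. poisson r (y - t)) has_integral (- A (y - T) - - A (y - - T))) {-T..T}"
  proof (rule fundamental_theorem_of_calculus)
    show "-T \<le> T" using assms by simp
    fix t
    have "((\<lambda>t. y - t) has_real_derivative -1) (at t)" by (auto intro!: derivative_eq_intros)
    from DERIV_minus[OF DERIV_chain2[OF A' this]]
    have "((\<lambda>t. - A (y - t)) has_real_derivative poisson r (y - t)) (at t)" by simp
    then show "((\<lambda>t. - A (y - t)) has_vector_derivative poisson r (y - t)) (at t within {-T..T})"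
      by (simp add: has_real_derivative_iff_has_vector_derivative has_vector_derivative_at_within)
  qed
  then have "integral {-T..T} (\<lambda>t. poisson r (y - t)) = A (y + T) - A (y - T)"
    by (simp add: integral_unique)
  also have "\<dots> \<le> 1"
  proof -
    have "A s \<le> 1 / 2" "- (1 / 2) \<le> A s" for s
      using arctan_bounded[of "tan (pi * r / 2) * tanh (pi * s / 2)"] pi_gt_zero
      by (auto simp: A_def field_simps)
    from this(1)[of "y + T"] this(2)[of "y - T"] show ?thesis by linarith
  qed
  finally show ?thesis .
qed

text \<open>On a compact interval one may differentiate in \<open>z\<close> under the integral sign.
  The derivative of the kernel at 0 is \<open>pi / (4 * cosh^2 (pi * t / 2))\<close>, which the
  half-angle formula turns into \<open>beta0 t\<close>: this is the origin of the weight in the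
  theorem.\<close>

lemma tan_kernel_integral:
  fixes q :: "real \<Rightarrow> real" and T :: real
  assumes q: "continuous_on UNIV q"
  defines "W \<equiv> \<lambda>z. integral {-T..T} (\<lambda>t. tan (of_real (pi / 2) * (z - \<i> * of_real t)) / 2 * of_real (q t))"
  shows "W holomorphic_on {z. - 1 < Re z \<and> Re z < 1}"
    and "(W has_field_derivative of_real (integral {-T..T} (\<lambda>t. beta0 t * q t))) (at 0)"
    and "\<And>x y. 0 \<le> x \<Longrightarrow> x < 1 \<Longrightarrow> Re (W (Complex x y)) = integral {-T..T} (\<lambda>t. poisson x (y - t) * q t)"
proof -
  let ?U = "{z. - 1 < Re z \<and> Re z < 1}"
  define f where "f z t = tan (of_real (pi / 2) * (z - \<i> * of_real t)) / 2 * of_real (q t)" for z :: complex and t :: real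
  define fx where "fx z t = inverse ((cos (of_real (pi / 2) * (z - \<i> * of_real t)))^2) * of_real (pi / 2) / 2 * of_real (q t)"
    for z :: complex and t :: real
  have qc: "continuous_on A (\<lambda>x. complex_of_real (q (g x)))" if "continuous_on A g" for A and g :: "'a::topological_space \<Rightarrow> real"
    by (intro continuous_intros continuous_on_compose2[OF q that]) auto
  have U: "convex ?U" "open ?U"
    by (simp_all add: Collect_conj_eq convex_Int open_Int convex_halfspace_Re_gt convex_halfspace_Re_lt
        open_halfspace_Re_gt open_halfspace_Re_lt)
  have W: "W = (\<lambda>z. integral (cbox (-T) T) (f z))" unfolding W_def f_def cbox_interval ..
  have d: "((\<lambda>z. f z t) has_field_derivative fx z t) (at z within ?U)" if "z \<in> ?U" for z t
    unfolding f_def fx_def using cos_nonzero_strip[of z t] that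
    by (auto intro!: derivative_eq_intros simp: inverse_eq_divide)
  have cf: "continuous_on (cbox (-T) T) (f z)" if "z \<in> ?U" for z
  proof -
    have c1: "continuous_on (cbox (-T) T) (\<lambda>t. of_real (pi / 2) * (z - \<i> * of_real t))"
      by (intro continuous_intros)
    have c2: "continuous_on {w :: complex. cos w \<noteq> 0} tan" by (rule continuous_on_tan) simp
    have "continuous_on (cbox (-T) T) (\<lambda>t. tan (of_real (pi / 2) * (z - \<i> * of_real t)))"
      by (rule continuous_on_compose2[OF c2 c1]) (use cos_nonzero_strip[of z] that in auto)
    then show ?thesis
      unfolding f_def by (intro continuous_on_mult continuous_on_divide continuous_on_const qc continuous_on_id) auto
  qed
  have int: "f z integrable_on cbox (-T) T" if "z \<in> ?U" for z
    by (rule integrable_continuous[OF cf[OF that]])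
  have cfx: "continuous_on (?U \<times> cbox (-T) T) (\<lambda>(z, t). fx z t)"
    unfolding fx_def case_prod_beta using cos_nonzero_strip
    by (intro continuous_intros qc) auto
  show "W holomorphic_on ?U" unfolding W
    by (rule leibniz_rule_holomorphic[OF d int cfx U(1)])
  have "(W has_field_derivative integral (cbox (-T) T) (fx 0)) (at 0 within ?U)" unfolding W
    by (rule leibniz_rule_field_derivative[OF d int cfx _ U(1)]) auto
  then have D: "(W has_field_derivative integral (cbox (-T) T) (fx 0)) (at 0)"
    using at_within_open[OF _ U(2), of 0] by simp
  have "fx 0 t = of_real (beta0 t * q t)" for t
  proof -
    define w where "w = of_real (pi / 2) * (0 - \<i> * of_real t)"
    have "cos w = of_real (cosh (pi / 2 * t))"
      by (simp add: w_def complex_eq_iff Re_cos Im_cos cosh_def)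
    moreover have "cosh (pi * t) = 2 * (cosh (pi / 2 * t))^2 - 1"
      using cosh_double_cosh[of "pi / 2 * t"] by simp
    then have "beta0 t = inverse ((cosh (pi / 2 * t))^2) * (pi / 2) / 2"
      by (simp add: beta0_def inverse_eq_divide)
    ultimately show ?thesis
      unfolding fx_def w_def[symmetric] by (simp only: of_real_mult of_real_divide of_real_inverse of_real_power) simp
  qed
  then have fx0: "fx 0 = (\<lambda>t. of_real (beta0 t * q t))" by (rule ext)
  have "continuous_on {-T..T} (\<lambda>t. beta0 t * q t)"
    unfolding beta0_def using cosh_real_ge_1
    by (intro continuous_intros continuous_on_subset[OF q]) (auto simp: add_nonneg_eq_0_iff)
  then have "((\<lambda>t. beta0 t * q t) has_integral integral {-T..T} (\<lambda>t. beta0 t * q t)) {-T..T}"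
    by (intro integrable_integral integrable_continuous_interval)
  then have "((\<lambda>t. complex_of_real (beta0 t * q t)) has_integral of_real (integral {-T..T} (\<lambda>t. beta0 t * q t))) {-T..T}"
    by (rule has_integral_of_real)
  with D show "(W has_field_derivative of_real (integral {-T..T} (\<lambda>t. beta0 t * q t))) (at 0)"
    unfolding fx0 by (simp add: integral_unique)
  fix x y :: real
  assume x: "0 \<le> x" "x < 1"
  then have z: "Complex x y \<in> ?U" by simp
  have "Re (f (Complex x y) t) = poisson x (y - t) * q t" for t
  proof -
    have half: "2 * (a / (2 * b)) = a / b" for a b :: real by simp
    have "2 * Re (of_real (pi / 2) * (Complex x y - \<i> * of_real t)) = pi * x"
      "2 * Im (of_real (pi / 2) * (Complex x y - \<i> * of_real t)) = pi * (y - t)" by simp_all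
    then have "Re (tan (of_real (pi / 2) * (Complex x y - \<i> * of_real t))) = 2 * poisson x (y - t)"
      unfolding Re_tan poisson_def by (simp only: half)
    then show ?thesis by (simp add: f_def)
  qed
  moreover have "Re (integral (cbox (-T) T) (f (Complex x y))) = integral (cbox (-T) T) (\<lambda>t. Re (f (Complex x y) t))"
    using integral_linear[OF int[OF z] bounded_linear_Re] by (simp add: o_def)
  ultimately show "Re (W (Complex x y)) = integral {-T..T} (\<lambda>t. poisson x (y - t) * q t)"
    unfolding W by simp
qed

section \<open>The boundary derivative estimate for compactly supported data\<close>

lemma uniformly_continuous_compact_support:
  fixes q :: "real \<Rightarrow> real"
  assumes "continuous_on UNIV q" "\<And>t. T \<le> \<bar>t\<bar> \<Longrightarrow> q t = 0" "0 < \<omega>"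
  obtains \<delta> where "0 < \<delta>" "\<And>s t. \<bar>s - t\<bar> < \<delta> \<Longrightarrow> \<bar>q s - q t\<bar> < \<omega>"
proof -
  have "uniformly_continuous_on {-T-1..T+1} q"
    by (rule compact_uniformly_continuous) (use assms(1) continuous_on_subset in auto)
  then obtain d where d: "0 < d" "\<And>s t. s \<in> {-T-1..T+1} \<Longrightarrow> t \<in> {-T-1..T+1} \<Longrightarrow> dist s t < d \<Longrightarrow> dist (q s) (q t) < \<omega>"
    using \<open>0 < \<omega>\<close> unfolding uniformly_continuous_on_def by metis
  have "\<bar>q s - q t\<bar> < \<omega>" if "\<bar>s - t\<bar> < min d 1" for s t
  proof (cases "T \<le> \<bar>s\<bar> \<and> T \<le> \<bar>t\<bar>")
    case True
    then show ?thesis using assms by simp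
  next
    case False
    then have "s \<in> {-T-1..T+1}" "t \<in> {-T-1..T+1}" using that by auto
    then show ?thesis using d(2)[of s t] that by (simp add: dist_real_def)
  qed
  then show ?thesis using that[of "min d 1"] d(1) by auto
qed

text \<open>A one-sided approximate identity, uniform in \<open>y\<close>. For \<open>t\<close>
  within \<open>\<delta>\<close> of \<open>y\<close> the value \<open>q t\<close> is at most
  \<open>q y + \<omega>\<close> and the kernel has mass at most 1. Elsewhere the kernel is at most
  \<open>sin (pi * r) / (2 * (cosh (pi * \<delta>) - 1))\<close>, which vanishes as \<open>r\<close>
  tends to 1. The Poisson integral later enters as an exponent, so only its upper bound
  matters.\<close>

lemma poisson_approx_upper:
  fixes q :: "real \<Rightarrow> real"
  assumes q: "continuous_on UNIV q" "\<And>t. 0 \<le> q t" "\<And>t. q t \<le> C" and T: "0 \<le> T" and r: "0 \<le> r" "r < 1"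
    and \<delta>: "0 < \<delta>" "\<And>s t. \<bar>s - t\<bar> < \<delta> \<Longrightarrow> \<bar>q s - q t\<bar> < \<omega>" and \<omega>: "0 < \<omega>"
  shows "integral {-T..T} (\<lambda>t. poisson r (y - t) * q t)
    \<le> q y + \<omega> + T * C * sin (pi * r) / (cosh (pi * \<delta>) - 1)"
proof -
  define D where "D = sin (pi * r) / (2 * (cosh (pi * \<delta>) - 1))"
  have C: "0 \<le> C" using q(2,3)[of 0] by linarith
  have sr: "0 \<le> sin (pi * r)" using r by (intro sin_ge_zero) auto
  have ch1: "1 < cosh (pi * \<delta>)" using \<delta>(1) cosh_real_nonneg_less_iff[of 0 "pi * \<delta>"] by simp
  have D: "0 \<le> D" unfolding D_def using sr ch1 by (intro divide_nonneg_pos) auto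
  have cont: "continuous_on {-T..T} (\<lambda>t. poisson r (y - t))" by (rule continuous_poisson[OF r])
  have far: "poisson r (y - t) \<le> D" if "\<delta> \<le> \<bar>y - t\<bar>" for t
  proof -
    have "cosh (pi * \<delta>) \<le> cosh \<bar>pi * (y - t)\<bar>"
      using that \<delta>(1) by (intro cosh_real_nonneg_le_iff[THEN iffD2]) (auto simp: abs_mult)
    then have "cosh (pi * \<delta>) \<le> cosh (pi * (y - t))" by simp
    then have "cosh (pi * \<delta>) - 1 \<le> cos (pi * r) + cosh (pi * (y - t))"
      using cos_ge_minus_one[of "pi * r"] by linarith
    then show ?thesis unfolding poisson_def D_def using sr ch1 by (intro divide_left_mono) auto
  qed
  have "poisson r (y - t) * q t \<le> poisson r (y - t) * (q y + \<omega>) + C * D" for t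
  proof (cases "\<bar>y - t\<bar> < \<delta>")
    case True
    then have "q t \<le> q y + \<omega>" using \<delta>(2)[of y t] by linarith
    then have "poisson r (y - t) * q t \<le> poisson r (y - t) * (q y + \<omega>)"
      using poisson_nonneg[OF r] by (intro mult_left_mono) auto
    moreover have "0 \<le> C * D" using C D by simp
    ultimately show ?thesis by linarith
  next
    case False
    then have "poisson r (y - t) * q t \<le> D * C"
      using far[of t] poisson_nonneg[OF r] q(2,3) D by (intro mult_mono) auto
    moreover have "0 \<le> poisson r (y - t) * (q y + \<omega>)"
      using poisson_nonneg[OF r] q(2)[of y] \<omega> by (intro mult_nonneg_nonneg) auto
    ultimately show ?thesis by (simp add: mult.commute)
  qed
  then have "integral {-T..T} (\<lambda>t. poisson r (y - t) * q t)
      \<le> integral {-T..T} (\<lambda>t. poisson r (y - t) * (q y + \<omega>) + C * D)"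
    by (intro integral_le integrable_continuous_interval continuous_intros cont continuous_on_subset[OF q(1)]) auto
  also have "\<dots> = integral {-T..T} (\<lambda>t. poisson r (y - t)) * (q y + \<omega>) + 2 * T * (C * D)"
    using T by (subst integral_add) (auto intro!: integrable_continuous_interval continuous_intros cont)
  also have "\<dots> \<le> 1 * (q y + \<omega>) + 2 * T * (C * D)"
    using poisson_mass[OF r T] q(2)[of y] \<omega> by (intro add_right_mono mult_right_mono) auto
  also have "2 * T * (C * D) = T * C * sin (pi * r) / (cosh (pi * \<delta>) - 1)"
  proof -
    have "2 * T * (C * (s / (2 * X))) = T * C * s / X" for s X by (cases "X = 0") (auto simp: field_simps)
    then show ?thesis unfolding D_def .
  qed
  finally show ?thesis by simp
qed

text \<open>With \<open>Re W\<close> the Poisson integral of \<open>q\<close>, the function \<open>F z * exp (W z - W 0 - (M + \<eta>) z)\<close> is bounded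
  by \<open>1\<close> on \<open>Re z = 0\<close> and on \<open>Re z = r\<close> for \<open>r\<close> near \<open>1\<close>. It equals \<open>1\<close> at \<open>0\<close>, so its derivative there has
  nonpositive real part.\<close>

lemma strip_derivative_bound_aux:
  fixes F :: "complex \<Rightarrow> complex" and q :: "real \<Rightarrow> real"
  assumes F: "F holomorphic_on UNIV" "\<And>z. - 1 \<le> Re z \<Longrightarrow> Re z \<le> 2 \<Longrightarrow> cmod (F z) \<le> B" "F 0 = 1"
    and left: "\<And>y. cmod (F (Complex 0 y)) \<le> 1"
    and right: "\<And>y. cmod (F (Complex 1 y)) \<le> exp (M - q y)"
    and q: "continuous_on UNIV q" "\<And>t. 0 \<le> q t" "\<And>t. q t \<le> C" "\<And>t. T \<le> \<bar>t\<bar> \<Longrightarrow> q t = 0"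
    and T: "0 \<le> T" and M: "0 \<le> M" and \<eta>: "0 < \<eta>"
  shows "Re (deriv F 0) \<le> M - integral {-T..T} (\<lambda>t. beta0 t * q t) + \<eta>"
proof -
  define W where "W z = integral {-T..T} (\<lambda>t. tan (of_real (pi / 2) * (z - \<i> * of_real t)) / 2 * of_real (q t))" for z
  note W = tan_kernel_integral[OF q(1), where T = T, folded W_def]
  define \<beta> where "\<beta> = integral {-T..T} (\<lambda>t. beta0 t * q t)"
  have WRe: "0 \<le> Re (W (Complex x y))" "Re (W (Complex x y)) \<le> C" if "0 \<le> x" "x < 1" for x y
  proof -
    have i: "(\<lambda>t. poisson x (y - t) * q t) integrable_on {-T..T}"
      by (intro integrable_continuous_interval continuous_intros continuous_poisson that continuous_on_subset[OF q(1)]) auto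
    show "0 \<le> Re (W (Complex x y))" unfolding W(3)[OF that]
      using i poisson_nonneg[OF that] q(2) by (intro integral_nonneg) auto
    have "Re (W (Complex x y)) \<le> integral {-T..T} (\<lambda>t. poisson x (y - t) * C)" unfolding W(3)[OF that]
      using poisson_nonneg[OF that] q(3)
      by (intro integral_le[OF i] integrable_continuous_interval continuous_on_mult continuous_on_const
          continuous_poisson that mult_left_mono) auto
    also have "\<dots> = integral {-T..T} (\<lambda>t. poisson x (y - t)) * C" by simp
    also have "\<dots> \<le> 1 * C" using poisson_mass[OF that T] q(2,3)[of 0] by (intro mult_right_mono) auto
    finally show "Re (W (Complex x y)) \<le> C" by simp
  qed
  have W0: "Re (W (Complex 0 y)) = 0" for y using W(3)[of 0 y] by (simp add: poisson_def)
  \<comment> \<open>Cauchy's inequality on unit discs around points of the closed strip; these discs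
    reach out to real parts -1 and 2.\<close>
  have dF: "cmod (deriv F z) \<le> B" if "0 \<le> Re z" "Re z \<le> 1" for z
  proof -
    have "cmod ((deriv ^^ 1) F z) \<le> fact 1 * B / 1 ^ 1"
    proof (rule Cauchy_inequality)
      show "F holomorphic_on ball z 1" using F(1) by (rule holomorphic_on_subset) auto
      show "continuous_on (cball z 1) F"
        by (intro holomorphic_on_imp_continuous_on holomorphic_on_subset[OF F(1)]) auto
      fix x assume "cmod (z - x) = 1"
      then have "\<bar>Re z - Re x\<bar> \<le> 1" by (metis abs_Re_le_cmod minus_complex.simps(1))
      then show "cmod (F x) \<le> B" using that by (intro F(2)) auto
    qed simp
    then show ?thesis by simp
  qed
  have B: "0 \<le> B" using F(2)[of 0] norm_ge_zero[of "F 0"] by (simp add: F(3))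
  \<comment> \<open>Scaled so that the additive error \<open>B * (1 - r)\<close> of moving from
    \<open>Re z = 1\<close> to \<open>Re z = r\<close> is absorbed into \<open>exp (M - q y)\<close>
    as a factor \<open>exp (B' * (1 - r))\<close>. The bound \<open>q y \<le> C\<close> keeps
    \<open>exp (M - q y)\<close> away from 0.\<close>
  define B' where "B' = B * exp (C - M)"
  have near: "cmod (F (Complex r y)) \<le> exp (M - q y + B' * (1 - r))" if "0 \<le> r" "r < 1" for r y
  proof -
    have "cmod (F (Complex r y) - F (Complex 1 y)) \<le> B * cmod (Complex r y - Complex 1 y)"
    proof (rule field_differentiable_bound[where S = "{z. 0 \<le> Re z \<and> Re z \<le> 1}" and f' = "deriv F"])
      show "convex {z. 0 \<le> Re z \<and> Re z \<le> 1}"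
        by (simp add: Collect_conj_eq convex_Int convex_halfspace_Re_ge convex_halfspace_Re_le)
      fix z
      have "F field_differentiable at z" using F(1) by (simp add: holomorphic_on_def)
      then show "(F has_field_derivative deriv F z) (at z within {z. 0 \<le> Re z \<and> Re z \<le> 1})"
        by (simp add: DERIV_deriv_iff_field_differentiable has_field_derivative_at_within)
    qed (use that dF in auto)
    also have "cmod (Complex r y - Complex 1 y) = 1 - r" using that by (simp add: cmod_def)
    finally have "cmod (F (Complex r y)) \<le> exp (M - q y) + B * (1 - r)"
      using right[of y] norm_triangle_sub[of "F (Complex r y)" "F (Complex 1 y)"] by linarith
    also have "B * (1 - r) \<le> B' * exp (M - q y) * (1 - r)"
    proof (intro mult_right_mono)
      have "1 \<le> exp (C - M) * exp (M - q y)" using q(3)[of y] by (simp flip: exp_add)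
      then show "B \<le> B' * exp (M - q y)" unfolding B'_def using B mult_left_mono[of 1 _ B] by (simp add: mult.assoc)
    qed (use that in auto)
    also have "exp (M - q y) + B' * exp (M - q y) * (1 - r) = exp (M - q y) * (1 + B' * (1 - r))"
      by (simp add: algebra_simps)
    also have "\<dots> \<le> exp (M - q y) * exp (B' * (1 - r))"
      by (intro mult_left_mono exp_ge_add_one_self) auto
    finally show ?thesis by (simp add: exp_add)
  qed
  define \<omega> where "\<omega> = \<eta> / 2"
  have \<omega>: "0 < \<omega>" using \<eta> by (simp add: \<omega>_def)
  obtain \<delta> where \<delta>: "0 < \<delta>" "\<And>s t. \<bar>s - t\<bar> < \<delta> \<Longrightarrow> \<bar>q s - q t\<bar> < \<omega>"
    using uniformly_continuous_compact_support[OF q(1,4) \<omega>] by metis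
  define K where "K = T * C / (cosh (pi * \<delta>) - 1)"
  \<comment> \<open>This is the exponent that will bound \<open>Q\<close> on
    \<open>Re z = r\<close>. At \<open>r = 1\<close> it equals \<open>\<omega> - \<eta> < 0\<close>,
    so it is negative for some \<open>r < 1\<close>; the surplus \<open>\<eta>\<close> in the
    conclusion pays for this.\<close>
  have "((\<lambda>r. (M + B') * (1 - r) + \<omega> + K * sin (pi * r) - \<eta> * r) \<longlongrightarrow>
      (M + B') * (1 - 1) + \<omega> + K * sin (pi * 1) - \<eta> * 1) (at_left 1)"
    by (intro tendsto_intros)
  moreover have "(M + B') * (1 - 1) + \<omega> + K * sin (pi * 1) - \<eta> * 1 < 0" using \<eta> by (simp add: \<omega>_def)
  ultimately have "\<forall>\<^sub>F r in at_left 1. (M + B') * (1 - r) + \<omega> + K * sin (pi * r) - \<eta> * r < 0"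
    by (rule order_tendstoD(2))
  moreover have "\<forall>\<^sub>F r in at_left (1::real). 0 < r \<and> r < 1"
    using eventually_at_left_real[of 0 1] by (auto elim: eventually_mono)
  ultimately have "\<forall>\<^sub>F r in at_left 1. (M + B') * (1 - r) + \<omega> + K * sin (pi * r) - \<eta> * r < 0 \<and> (0 < r \<and> r < 1)"
    by (rule eventually_conj)
  from eventually_happens'[OF trivial_limit_at_left_real this]
  obtain r where r: "0 < r" "r < 1" and small: "(M + B') * (1 - r) + \<omega> + K * sin (pi * r) - \<eta> * r < 0"
    by blast
  define Q where "Q z = F z * exp (W z - W 0 - of_real (M + \<eta>) * z)" for z
  have W00: "Re (W 0) = 0" using W0[of 0] by (simp add: zero_complex.code)
  have nQ: "cmod (Q z) = cmod (F z) * exp (Re (W z) - (M + \<eta>) * Re z)" for z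
    by (simp add: Q_def norm_mult W00)
  have Qle: "cmod (Q z) \<le> 1" if "0 \<le> Re z" "Re z \<le> r" for z
  proof (rule strip_maximum_modulus[OF _ r _ _ _ that])
    show "Q holomorphic_on {z. - 1 < Re z \<and> Re z < 1}"
      unfolding Q_def by (intro holomorphic_intros W(1) holomorphic_on_subset[OF F(1)]) auto
    show "cmod (Q z) \<le> B * exp C" if "0 \<le> Re z" "Re z \<le> r" for z
      unfolding nQ
    proof (rule mult_mono)
      show "cmod (F z) \<le> B" using that r by (intro F(2)) auto
      have "Re (W z) \<le> C" using WRe(2)[of "Re z" "Im z"] that r by simp
      moreover have "0 \<le> (M + \<eta>) * Re z" using M \<eta> that by (intro mult_nonneg_nonneg) auto
      ultimately show "exp (Re (W z) - (M + \<eta>) * Re z) \<le> exp C" by simp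
    qed (use B in auto)
    show "cmod (Q (Complex 0 y)) \<le> 1" for y using left[of y] by (simp add: nQ W0)
    show "cmod (Q (Complex r y)) \<le> 1" for y
    proof -
      have "Re (W (Complex r y)) \<le> q y + \<omega> + K * sin (pi * r)"
        using W(3)[of r y] poisson_approx_upper[OF q(1-3) T _ r(2) \<delta> \<omega>, of y] r by (simp add: K_def)
      then have "cmod (Q (Complex r y)) \<le> exp (M - q y + B' * (1 - r)) * exp (q y + \<omega> + K * sin (pi * r) - (M + \<eta>) * r)"
        unfolding nQ using near[of r y] r by (intro mult_mono) auto
      also have "\<dots> = exp ((M + B') * (1 - r) + \<omega> + K * sin (pi * r) - \<eta> * r)"
        by (simp add: algebra_simps flip: exp_add)
      also have "\<dots> \<le> 1" using small by simp
      finally show ?thesis .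
    qed
  qed
  have "F field_differentiable at 0" using F(1) by (simp add: holomorphic_on_def)
  then have "(F has_field_derivative deriv F 0) (at 0)" by (simp add: DERIV_deriv_iff_field_differentiable)
  moreover have "((\<lambda>z. exp (W z - W 0 - of_real (M + \<eta>) * z)) has_field_derivative
      exp (W 0 - W 0 - of_real (M + \<eta>) * 0) * (of_real \<beta> - 0 - of_real (M + \<eta>) * 1)) (at 0)"
    by (intro DERIV_chain2[OF DERIV_exp] DERIV_diff W(2)[folded \<beta>_def] DERIV_const DERIV_cmult DERIV_ident)
  ultimately have "(Q has_field_derivative deriv F 0 + (of_real \<beta> - of_real (M + \<eta>))) (at 0)"
    unfolding Q_def using DERIV_mult by (fastforce simp: F(3))
  then have "((\<lambda>x. Q (of_real x)) has_vector_derivative deriv F 0 + (of_real \<beta> - of_real (M + \<eta>))) (at 0)"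
    by (intro has_vector_derivative_real_field) simp
  then have dQ: "((\<lambda>x. Re (Q (of_real x))) has_real_derivative Re (deriv F 0) + (\<beta> - (M + \<eta>))) (at 0)"
    using has_field_derivative_Re by fastforce
  show ?thesis
  proof (rule ccontr)
    assume "\<not> ?thesis"
    then have "0 < Re (deriv F 0) + (\<beta> - (M + \<eta>))" by (simp add: \<beta>_def)
    from DERIV_pos_inc_right[OF dQ this] obtain d where d: "0 < d"
      "\<And>h. 0 < h \<Longrightarrow> h < d \<Longrightarrow> Re (Q 0) < Re (Q (of_real h))" by auto
    define h where "h = min (d / 2) r"
    have h: "0 < h" "h < d" "h \<le> r" using d r by (auto simp: h_def)
    have "Q 0 = 1" by (simp add: Q_def F(3))
    then have "1 < Re (Q (of_real h))" using d(2)[OF h(1,2)] by simp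
    also have "\<dots> \<le> cmod (Q (of_real h))" by (rule complex_Re_le_cmod)
    also have "\<dots> \<le> 1" using h by (intro Qle) auto
    finally show False by simp
  qed
qed

section \<open>The density \<open>beta0\<close> and bounded boundary data\<close>

lemma beta0_nonneg: "0 \<le> beta0 t"
  unfolding beta0_def using cosh_real_ge_1[of "pi * t"] by (intro divide_nonneg_nonneg) auto

lemma continuous_beta0: "continuous_on A beta0"
proof -
  have "cosh (pi * t) + 1 \<noteq> 0" for t using cosh_real_ge_1[of "pi * t"] by linarith
  then show ?thesis unfolding beta0_def by (intro continuous_intros) (metis mult_eq_0_iff zero_neq_numeral)
qed

text \<open>The antiderivative \<open>tanh (pi / 2 * t) / 2\<close> runs from -1/2 to 1/2.\<close>

lemma has_bochner_integral_beta0: "has_bochner_integral lborel beta0 1"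
proof -
  have d: "((\<lambda>t. tanh (pi / 2 * t) / 2) has_real_derivative beta0 t) (at t)" for t
  proof -
    have "((\<lambda>t. tanh (pi / 2 * t) / 2) has_real_derivative (1 - (tanh (pi / 2 * t))^2) * (pi / 2) / 2) (at t)"
      by (auto intro!: derivative_eq_intros)
    moreover have "cosh (pi * t) = 2 * (cosh (pi / 2 * t))^2 - 1"
      using cosh_double_cosh[of "pi / 2 * t"] by simp
    then have "beta0 t = pi / (4 * (cosh (pi / 2 * t))^2)" by (simp add: beta0_def)
    moreover have "1 - (tanh (pi / 2 * t))^2 = 1 / (cosh (pi / 2 * t))^2"
      by (simp add: tanh_def power_divide sinh_square_eq diff_divide_distrib)
    ultimately show ?thesis by (simp add: mult.commute)
  qed
  have lim: "((\<lambda>t. tanh (pi / 2 * t) / 2) \<longlongrightarrow> 1 / 2) at_top" "((\<lambda>t. tanh (pi / 2 * t) / 2) \<longlongrightarrow> - 1 / 2) at_bot"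
    by real_asymp+
  have "continuous (at x) beta0" for x using continuous_beta0[of UNIV] by (simp add: continuous_on_eq_continuous_at)
  have "(((\<lambda>t. tanh (pi / 2 * t) / 2) \<circ> real_of_ereal) \<longlongrightarrow> - 1 / 2) (at_right (-\<infinity>))"
    "(((\<lambda>t. tanh (pi / 2 * t) / 2) \<circ> real_of_ereal) \<longlongrightarrow> 1 / 2) (at_left \<infinity>)"
    using lim by (simp_all add: ereal_tendsto_simps1)
  note * = interval_integral_FTC_nonneg[OF _ d \<open>\<And>x. continuous (at x) beta0\<close> AE_I2 this]
  have "set_integrable lborel (einterval (-\<infinity>) \<infinity>) beta0" "(LBINT t=-\<infinity>..\<infinity>. beta0 t) = 1 / 2 - - 1 / 2"
    by (rule *; simp add: beta0_nonneg)+
  then show ?thesis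
    by (simp add: has_bochner_integral_iff set_integrable_def interval_lebesgue_integral_def set_lebesgue_integral_def einterval_def)
qed

text \<open>The preceding estimate wants a nonnegative \<open>q\<close> of compact support, so
  \<open>M - h\<close> is cut off. Then \<open>M - q n\<close> stays above \<open>h\<close> and
  decreases to it, dominated convergence passes to the limit, and the mass 1 of \<open>beta0\<close>
  cancels the shift by \<open>M\<close>.\<close>

theorem strip_derivative_bound:
  fixes F :: "complex \<Rightarrow> complex" and h :: "real \<Rightarrow> real"
  assumes F: "F holomorphic_on UNIV" "\<And>z. - 1 \<le> Re z \<Longrightarrow> Re z \<le> 2 \<Longrightarrow> cmod (F z) \<le> B" "F 0 = 1"
    and left: "\<And>y. cmod (F (Complex 0 y)) \<le> 1"
    and right: "\<And>y. cmod (F (Complex 1 y)) \<le> exp (h y)"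
    and h: "continuous_on UNIV h" "\<And>t. \<bar>h t\<bar> \<le> M"
  shows "Re (deriv F 0) \<le> (LINT t|lborel. h t * beta0 t)"
proof -
  have M: "0 \<le> M" using h(2)[of 0] by linarith
  \<comment> \<open>A piecewise linear cutoff: 1 for \<open>\<bar>t\<bar> \<le> n - 1\<close> and 0
    for \<open>\<bar>t\<bar> \<ge> n\<close>.\<close>
  define \<kappa> where "\<kappa> n t = max 0 (min 1 (real n - \<bar>t\<bar>))" for n t
  define q where "q n t = (M - h t) * \<kappa> n t" for n t
  have \<kappa>: "0 \<le> \<kappa> n t" "\<kappa> n t \<le> 1" for n t by (auto simp: \<kappa>_def)
  have q0: "0 \<le> M - h t" "M - h t \<le> 2 * M" for t using h(2)[of t] by linarith+
  have q: "0 \<le> q n t" "q n t \<le> M - h t" for n t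
    using q0[of t] \<kappa>[of n t] mult_left_mono[of "\<kappa> n t" 1 "M - h t"] by (auto simp: q_def)
  have qc: "continuous_on UNIV (q n)" for n
    unfolding q_def \<kappa>_def by (intro continuous_intros h)
  have step: "Re (deriv F 0) \<le> M - (LINT t|lborel. q n t * beta0 t)" for n
  proof (rule field_le_epsilon)
    fix \<eta> :: real assume \<eta>: "0 < \<eta>"
    have "Re (deriv F 0) \<le> M - integral {-real n..real n} (\<lambda>t. beta0 t * q n t) + \<eta>"
    proof (rule strip_derivative_bound_aux[OF F left _ qc q(1) _ _ _ M \<eta>])
      show "cmod (F (Complex 1 y)) \<le> exp (M - q n y)" for y
      proof (rule order_trans[OF right])
        show "exp (h y) \<le> exp (M - q n y)" using q(2)[of n y] by simp
      qed
      show "q n t \<le> 2 * M" for t using q(2)[of n t] q0(2)[of t] by linarith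
      show "q n t = 0" if "real n \<le> \<bar>t\<bar>" for t using that by (simp add: q_def \<kappa>_def)
    qed simp_all
    also have "integral {-real n..real n} (\<lambda>t. beta0 t * q n t) = (LINT t|lborel. q n t * beta0 t)"
    proof -
      have "set_integrable lborel {-real n..real n} (\<lambda>t. beta0 t * q n t)"
        by (rule borel_integrable_compact[folded set_integrable_def, unfolded real_scaleR_def])
          (auto intro!: continuous_intros continuous_beta0 continuous_on_subset[OF qc])
      then have "integral {-real n..real n} (\<lambda>t. beta0 t * q n t) = (LINT t:{-real n..real n}|lborel. beta0 t * q n t)"
        by (rule set_borel_integral_eq_integral(2)[symmetric])
      also have "\<dots> = (LINT t|lborel. q n t * beta0 t)"
        unfolding set_lebesgue_integral_def
        by (rule Bochner_Integration.integral_cong) (auto simp: q_def \<kappa>_def indicator_def)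
      finally show ?thesis .
    qed
    finally show "Re (deriv F 0) \<le> M - (LINT t|lborel. q n t * beta0 t) + \<eta>" .
  qed
  have ib: "integrable lborel beta0" and i1: "(LINT t|lborel. beta0 t) = 1"
    using has_bochner_integral_beta0 by (auto simp: has_bochner_integral_iff)
  have mb: "beta0 \<in> borel_measurable borel" using continuous_beta0 by (rule borel_measurable_continuous_onI)
  have mh: "h \<in> borel_measurable borel" using h(1) by (rule borel_measurable_continuous_onI)
  have mq: "q n \<in> borel_measurable borel" for n using qc by (rule borel_measurable_continuous_onI)
  have ih: "integrable lborel (\<lambda>t. h t * beta0 t)"
    by (rule Bochner_Integration.integrable_bound[OF integrable_mult_right[OF ib, of M]])
      (use mb mh h(2) M beta0_nonneg in \<open>auto simp: abs_mult intro!: mult_right_mono\<close>)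
  have "(\<lambda>n. LINT t|lborel. q n t * beta0 t) \<longlonglongrightarrow> (LINT t|lborel. (M - h t) * beta0 t)"
  proof (rule integral_dominated_convergence[where w = "\<lambda>t. 2 * M * beta0 t"])
    show "integrable lborel (\<lambda>t. 2 * M * beta0 t)" using ib by simp
    show "AE t in lborel. (\<lambda>n. q n t * beta0 t) \<longlonglongrightarrow> (M - h t) * beta0 t"
    proof (rule AE_I2)
      fix t :: real
      obtain n0 where "\<bar>t\<bar> + 1 < real n0" using reals_Archimedean2 by blast
      then have "\<forall>\<^sub>F n in sequentially. q n t * beta0 t = (M - h t) * beta0 t"
        by (intro eventually_sequentiallyI[of n0]) (auto simp: q_def \<kappa>_def)
      then show "(\<lambda>n. q n t * beta0 t) \<longlonglongrightarrow> (M - h t) * beta0 t" by (rule tendsto_eventually)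
    qed
    fix n
    have "q n t \<le> 2 * M" for t using q(2)[of n t] q0(2)[of t] by linarith
    then show "AE t in lborel. norm (q n t * beta0 t) \<le> 2 * M * beta0 t"
      using q(1) beta0_nonneg by (auto simp: abs_mult intro!: mult_right_mono)
  qed (use mb mh mq in auto)
  then have "Re (deriv F 0) \<le> M - (LINT t|lborel. (M - h t) * beta0 t)"
    by (intro LIMSEQ_le_const[OF tendsto_diff[OF tendsto_const]]) (use step in auto)
  also have "(LINT t|lborel. (M - h t) * beta0 t) = M - (LINT t|lborel. h t * beta0 t)"
    using ib ih i1 by (simp add: left_diff_distrib)
  finally show ?thesis by simp
qed

section \<open>Leading minors and singular values\<close>

lemma exists_sorting_permutation:
  fixes d :: "nat \<Rightarrow> 'a :: linorder"
  obtains p where "p permutes {..<n}" "\<forall>i j. i \<le> j \<longrightarrow> j < n \<longrightarrow> d (p j) \<le> d (p i)"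
proof -
  define xs where "xs = rev (sort_key d [0..<n])"
  have xs: "length xs = n" "set xs = {..<n}" "distinct xs"
    by (auto simp: xs_def)
  define p where "p i = (if i < n then xs ! i else i)" for i
  have "bij_betw ((!) xs) {..<n} {..<n}" by (rule bij_betw_nth[OF xs(3)]) (simp_all only: xs)
  moreover have "bij_betw p {..<n} {..<n} = bij_betw ((!) xs) {..<n} {..<n}"
    by (rule bij_betw_cong) (simp add: p_def)
  ultimately have "bij_betw p {..<n} {..<n}" by simp
  then have "p permutes {..<n}" by (rule bij_imp_permutes) (simp add: p_def)
  moreover have "d (p j) \<le> d (p i)" if "i \<le> j" "j < n" for i j
  proof -
    have s: "sorted (map d (sort_key d [0..<n]))" by simp
    have "d (sort_key d [0..<n] ! (n - Suc j)) \<le> d (sort_key d [0..<n] ! (n - Suc i))"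
      using sorted_nth_mono[OF s, of "n - Suc j" "n - Suc i"] that by simp
    then show ?thesis using that by (simp add: p_def xs_def rev_nth)
  qed
  ultimately show ?thesis using that by blast
qed

lemma udiag_sorted:
  fixes d :: "nat \<Rightarrow> real"
  assumes "unitary_mat n U"
  obtains V p where "unitary_mat n V" "p permutes {..<n}"
    "\<forall>i j. i \<le> j \<longrightarrow> j < n \<longrightarrow> d (p j) \<le> d (p i)"
    "real_udiag n U d = udiag n V (\<lambda>i. of_real (d (p i)))"
proof -
  obtain p where p: "p permutes {..<n}" "\<forall>i j. i \<le> j \<longrightarrow> j < n \<longrightarrow> d (p j) \<le> d (p i)"
    by (rule exists_sorting_permutation[where n = n and d = d])
  show ?thesis
    by (rule that[OF udiag_permute(1)[OF assms p(1)] p udiag_permute(2)[OF assms p(1), symmetric]])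
qed

text \<open>Courant--Fischer dimension count: some nonzero \<open>w\<close> supported on the first \<open>j + 1\<close> coordinates
  has an image \<open>R w\<close> vanishing on the first \<open>j\<close> coordinates.\<close>

lemma eigenvalue_comparison:
  fixes R :: "nat \<Rightarrow> nat \<Rightarrow> complex" and \<mu> lam :: "nat \<Rightarrow> real"
  assumes iso: "\<And>w. (\<Sum>i<N. (cmod (\<Sum>l<k. R i l * w l))^2) = (\<Sum>l<k. (cmod (w l))^2)"
    and le: "\<And>w. (\<Sum>l<k. \<mu> l * (cmod (w l))^2)
      \<le> (\<Sum>i<N. lam i * (cmod (\<Sum>l<k. R i l * w l))^2) + \<epsilon> * (\<Sum>l<k. (cmod (w l))^2)"
    and \<mu>: "\<And>i j. i \<le> j \<Longrightarrow> j < k \<Longrightarrow> \<mu> j \<le> \<mu> i"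
    and lam: "\<And>i j. i \<le> j \<Longrightarrow> j < N \<Longrightarrow> lam j \<le> lam i"
    and j: "j < k" "j < N"
  shows "\<mu> j \<le> lam j + \<epsilon>"
proof -
  \<comment> \<open>The \<open>j\<close> equations in \<open>j + 1\<close> unknowns are padded by a
    zero row. The resulting square matrix is singular, and a kernel vector solves them.\<close>
  define A where "A = mat (Suc j) (Suc j) (\<lambda>(i, l). if i < j then R i l else 0)"
  have A: "A \<in> carrier_mat (Suc j) (Suc j)" by (simp add: A_def)
  have "det A = (\<Sum>l<Suc j. A $$ (j, l) * cofactor A j l)"
    by (rule laplace_expansion_row[OF A]) simp
  also have "\<dots> = 0" by (rule sum.neutral) (auto simp: A_def)
  finally obtain v where v: "v \<in> carrier_vec (Suc j)" "v \<noteq> 0\<^sub>v (Suc j)" "A *\<^sub>v v = 0\<^sub>v (Suc j)"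
    using det_0_iff_vec_prod_zero[OF A] by auto
  define w where "w l = (if l \<le> j then v $ l else 0)" for l
  define S where "S = (\<Sum>l<k. (cmod (w l))^2)"
  have "\<exists>l<Suc j. v $ l \<noteq> 0"
  proof (rule ccontr)
    assume "\<not> ?thesis"
    then have "v = 0\<^sub>v (Suc j)" using v(1) by (intro eq_vecI) auto
    then show False using v(2) by simp
  qed
  then obtain l where l: "l \<le> j" "v $ l \<noteq> 0" by (auto simp: less_Suc_eq_le)
  have "0 < (cmod (w l))^2" using l by (simp add: w_def)
  also have "\<dots> \<le> S" unfolding S_def using l j by (intro member_le_sum) auto
  finally have S: "0 < S" .
  have zero: "(\<Sum>l<k. R i l * w l) = 0" if "i < j" for i
  proof -
    have "(\<Sum>l<k. R i l * w l) = (\<Sum>l<Suc j. R i l * v $ l)"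
      using j by (intro sum.mono_neutral_cong_right) (auto simp: w_def)
    also have "\<dots> = (A *\<^sub>v v) $ i"
      using that v(1) A by (simp add: scalar_prod_def lessThan_atLeast0 A_def del: sum.op_ivl_Suc)
    finally show ?thesis using that by (simp add: v(3))
  qed
  \<comment> \<open>\<open>w\<close> is supported on \<open>l \<le> j\<close>, where
    \<open>\<mu> l \<ge> \<mu> j\<close>; its image is supported on \<open>i \<ge> j\<close>, where
    \<open>lam i \<le> lam j\<close>.\<close>
  have "\<mu> j * S \<le> (\<Sum>l<k. \<mu> l * (cmod (w l))^2)"
    unfolding S_def sum_distrib_left
  proof (intro sum_mono)
    fix l show "\<mu> j * (cmod (w l))^2 \<le> \<mu> l * (cmod (w l))^2"
      using \<mu>[of l j] j by (cases "l \<le> j") (auto simp: w_def intro!: mult_right_mono)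
  qed
  also have "\<dots> \<le> (\<Sum>i<N. lam i * (cmod (\<Sum>l<k. R i l * w l))^2) + \<epsilon> * S"
    using le[of w] by (simp add: S_def)
  also have "(\<Sum>i<N. lam i * (cmod (\<Sum>l<k. R i l * w l))^2)
      \<le> lam j * (\<Sum>i<N. (cmod (\<Sum>l<k. R i l * w l))^2)"
    unfolding sum_distrib_left
  proof (intro sum_mono)
    fix i assume "i \<in> {..<N}"
    then show "lam i * (cmod (\<Sum>l<k. R i l * w l))^2 \<le> lam j * (cmod (\<Sum>l<k. R i l * w l))^2"
      using lam[of j i] zero[of i] by (cases "i < j") (auto intro!: mult_right_mono)
  qed
  also have "(\<Sum>i<N. (cmod (\<Sum>l<k. R i l * w l))^2) = S" using iso[of w] by (simp add: S_def)
  finally have "\<mu> j * S \<le> (lam j + \<epsilon>) * S" by (simp add: algebra_simps)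
  then show ?thesis using S by simp
qed

text \<open>Vectors are plain functions read only below the dimension, so passing between the first
  \<open>k\<close> and all \<open>N\<close> coordinates needs no coercion.\<close>

definition mat_apply :: "complex mat \<Rightarrow> (nat \<Rightarrow> complex) \<Rightarrow> nat \<Rightarrow> complex" where
  "mat_apply A w i = (\<Sum>l<dim_col A. A $$ (i, l) * w l)"

definition norm_sq :: "nat \<Rightarrow> (nat \<Rightarrow> complex) \<Rightarrow> real" where
  "norm_sq n w = (\<Sum>i<n. (cmod (w i))^2)"

lemma mat_apply_mult:
  assumes "A \<in> carrier_mat n k" "B \<in> carrier_mat k m" "i < n"
  shows "mat_apply (A * B) w i = mat_apply A (mat_apply B w) i"
proof -
  have "mat_apply (A * B) w i = (\<Sum>l<m. \<Sum>t<k. A $$ (i, t) * B $$ (t, l) * w l)"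
    using assms unfolding mat_apply_def by (intro sum.cong) (auto simp: mult_index sum_distrib_right simp del: index_mult_mat(1))
  also have "\<dots> = (\<Sum>t<k. \<Sum>l<m. A $$ (i, t) * B $$ (t, l) * w l)" by (rule sum.swap)
  also have "\<dots> = mat_apply A (mat_apply B w) i"
    using assms by (auto simp: mat_apply_def sum_distrib_left mult.assoc intro!: sum.cong)
  finally show ?thesis .
qed

lemma mat_apply_one: "i < n \<Longrightarrow> mat_apply (1\<^sub>m n) w i = w i"
proof -
  assume i: "i < n"
  have "mat_apply (1\<^sub>m n) w i = (\<Sum>l<n. if l = i then w l else 0)"
    unfolding mat_apply_def using i by (intro sum.cong) auto
  then show ?thesis using i by simp
qed

lemma norm_sq_gram:
  assumes "X \<in> carrier_mat n m"
  shows "complex_of_real (norm_sq n (mat_apply X w)) = (\<Sum>i<m. \<Sum>j<m. cnj (w i) * (adj X * X) $$ (i, j) * w j)"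
proof -
  have "complex_of_real (norm_sq n (mat_apply X w)) = (\<Sum>t<n. cnj (mat_apply X w t) * mat_apply X w t)"
    unfolding norm_sq_def of_real_sum by (intro sum.cong) (auto simp: complex_norm_square mult.commute simp del: of_real_power)
  also have "\<dots> = (\<Sum>t<n. \<Sum>i<m. \<Sum>j<m. cnj (w i) * (cnj (X $$ (t, i)) * X $$ (t, j)) * w j)"
    unfolding mat_apply_def cnj_sum sum_product using assms by (intro sum.cong) (auto simp: mult_ac)
  also have "\<dots> = (\<Sum>i<m. \<Sum>j<m. \<Sum>t<n. cnj (w i) * (cnj (X $$ (t, i)) * X $$ (t, j)) * w j)"
    by (subst sum.swap, rule sum.cong[OF refl], rule sum.swap)
  also have "\<dots> = (\<Sum>i<m. \<Sum>j<m. cnj (w i) * (adj X * X) $$ (i, j) * w j)"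
    using assms by (intro sum.cong refl) (auto simp: mult_index sum_distrib_left sum_distrib_right simp del: index_mult_mat(1))
  finally show ?thesis .
qed

lemma norm_sq_isometry:
  assumes "X \<in> carrier_mat n m" "adj X * X = 1\<^sub>m m"
  shows "norm_sq n (mat_apply X w) = norm_sq m w"
proof -
  have "complex_of_real (norm_sq n (mat_apply X w)) = (\<Sum>i<m. cnj (w i) * mat_apply (1\<^sub>m m) w i)"
    unfolding norm_sq_gram[OF assms(1)] assms(2) by (simp add: mat_apply_def sum_distrib_left mult.assoc)
  also have "\<dots> = of_real (norm_sq m w)"
    unfolding norm_sq_def of_real_sum
    by (intro sum.cong) (auto simp: mat_apply_one complex_norm_square mult.commute simp del: of_real_power)
  finally show ?thesis by (simp only: of_real_eq_iff)
qed

lemma norm_sq_udiag: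
  assumes X: "X \<in> carrier_mat n m" and V: "unitary_mat m V"
    and gram: "adj X * X = real_udiag m V s"
  shows "norm_sq n (mat_apply X w) = (\<Sum>i<m. s i * (cmod (mat_apply (adj V) w i))^2)"
proof -
  note V' = unitary_matD[OF V]
  have "complex_of_real (norm_sq n (mat_apply X w)) =
      (\<Sum>i<m. \<Sum>j<m. \<Sum>k<m. cnj (w i) * (V $$ (i, k) * of_real (s k) * cnj (V $$ (j, k))) * w j)"
    unfolding norm_sq_gram[OF X] gram
    by (intro sum.cong refl) (auto simp: udiag_index[OF V'(1)] sum_distrib_left sum_distrib_right simp del: index_mult_mat)
  also have "\<dots> = (\<Sum>i<m. \<Sum>k<m. \<Sum>j<m. cnj (w i) * (V $$ (i, k) * of_real (s k) * cnj (V $$ (j, k))) * w j)"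
    by (rule sum.cong[OF refl], rule sum.swap)
  also have "\<dots> = (\<Sum>k<m. \<Sum>i<m. \<Sum>j<m. cnj (w i) * (V $$ (i, k) * of_real (s k) * cnj (V $$ (j, k))) * w j)"
    by (rule sum.swap)
  also have "\<dots> = (\<Sum>k<m. of_real (s k) * (cnj (mat_apply (adj V) w k) * mat_apply (adj V) w k))"
  proof (rule sum.cong[OF refl])
    fix k assume "k \<in> {..<m}"
    then have "cnj (mat_apply (adj V) w k) * mat_apply (adj V) w k =
        (\<Sum>i<m. \<Sum>j<m. cnj (w i) * (V $$ (i, k) * cnj (V $$ (j, k))) * w j)"
      unfolding mat_apply_def cnj_sum sum_product using V' by (intro sum.cong) (auto simp: mult_ac)
    then show "(\<Sum>i<m. \<Sum>j<m. cnj (w i) * (V $$ (i, k) * of_real (s k) * cnj (V $$ (j, k))) * w j) =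
        of_real (s k) * (cnj (mat_apply (adj V) w k) * mat_apply (adj V) w k)"
      by (simp add: sum_distrib_left mult_ac)
  qed
  also have "\<dots> = of_real (\<Sum>i<m. s i * (cmod (mat_apply (adj V) w i))^2)"
    unfolding of_real_sum of_real_mult
    by (intro sum.cong) (auto simp: complex_norm_square mult.commute simp del: of_real_power)
  finally show ?thesis by (simp only: of_real_eq_iff)
qed

text \<open>Column \<open>j\<close> of \<open>V\<close> is the test vector: \<open>s j\<close> is
  the squared length of its image under \<open>X\<close>.\<close>

lemma gram_eigenvalue_nonneg:
  assumes X: "X \<in> carrier_mat n m" and V: "unitary_mat m V"
    and gram: "adj X * X = real_udiag m V s" and j: "j < m"
  shows "0 \<le> s j"
proof -
  note V' = unitary_matD[OF V]
  define e where "e l = (if l = j then 1 else 0 :: complex)" for l :: nat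
  have "mat_apply (adj V) (mat_apply V e) i = e i" if "i < m" for i
    using mat_apply_mult[OF V'(4,1) that, of e] V'(3) mat_apply_one[OF that] by simp
  then have "norm_sq n (mat_apply X (mat_apply V e)) = (\<Sum>i<m. s i * (cmod (e i))^2)"
    by (simp add: norm_sq_udiag[OF X V gram])
  also have "\<dots> = (\<Sum>i<m. if i = j then s i else 0)" by (intro sum.cong) (auto simp: e_def)
  also have "\<dots> = s j" using j by simp
  finally show ?thesis by (metis norm_sq_def sum_nonneg zero_le_power2)
qed

lemma det_adj:
  assumes Y: "Y \<in> carrier_mat k k"
  shows "det (adj Y) = cnj (det (Y :: complex mat))"
proof -
  have "det (transpose_mat (adj Y)) = cnj (det Y)"
    unfolding det_def'[OF Y] det_def'[OF iffD2[OF transpose_carrier_mat adj_carrier[OF Y]]] cnj_sum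
  proof (rule sum.cong[OF refl])
    fix p assume "p \<in> {p. p permutes {0..<k}}"
    then have "p i < k" if "i < k" for i using permutes_in_image[of p "{0..<k}" i] that by auto
    then show "of_int (sign p) * (\<Prod>i = 0..<k. transpose_mat (adj Y) $$ (i, p i)) =
        cnj (of_int (sign p) * (\<Prod>i = 0..<k. Y $$ (i, p i)))"
      using Y by simp
  qed
  then show ?thesis using det_transpose[OF adj_carrier[OF Y]] by simp
qed

text \<open>The leading block \<open>Y\<close> is a compression of \<open>X\<close>, so on vectors
  supported on the first \<open>k\<close> coordinates it never gives a longer image than
  \<open>X\<close>. By Courant--Fischer each ordered eigenvalue of \<open>adj Y * Y\<close> is at
  most that of \<open>adj X * X\<close> with the same index, and the former multiply to the squared
  modulus of \<open>det Y\<close>.\<close>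

lemma leading_minor_bound:
  assumes X: "X \<in> carrier_mat N N" and V: "unitary_mat N V"
    and gram: "adj X * X = real_udiag N V s"
    and s: "\<And>i j. i \<le> j \<Longrightarrow> j < N \<Longrightarrow> s j \<le> s i" and k: "k \<le> N"
  shows "(cmod (det (mat k k (\<lambda>(i, j). X $$ (i, j)))))^2 \<le> (\<Prod>j<k. s j)"
proof -
  note V' = unitary_matD[OF V]
  define Y where "Y = mat k k (\<lambda>(i, j). X $$ (i, j))"
  have Y: "Y \<in> carrier_mat k k" by (simp add: Y_def)
  have "adj (adj Y * Y) = adj Y * Y"
    using Y by (simp add: adj_mult[where n = k and k = k and m = k])
  then obtain P0 \<mu>0 where P0: "unitary_mat k P0" "adj Y * Y = real_udiag k P0 \<mu>0"
    using hermitian_udiag[of "adj Y * Y" k] Y by auto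
  obtain P p where P: "unitary_mat k P" and pk: "p permutes {..<k}"
    and p: "\<forall>i j. i \<le> j \<longrightarrow> j < k \<longrightarrow> \<mu>0 (p j) \<le> \<mu>0 (p i)"
    and P2: "real_udiag k P0 \<mu>0 = udiag k P (\<lambda>i. of_real (\<mu>0 (p i)))"
    by (rule udiag_sorted[OF P0(1), where d = \<mu>0])
  define \<mu> where "\<mu> i = \<mu>0 (p i)" for i
  have gramY: "adj Y * Y = real_udiag k P \<mu>"
    using P0(2) P2 by (simp add: \<mu>_def)
  note P' = unitary_matD[OF P]
  \<comment> \<open>The inclusion of the first \<open>k\<close> coordinates composed with
    \<open>P\<close>. Thus \<open>R = adj V * JP\<close> takes coefficients in the eigenbasis of
    \<open>adj Y * Y\<close> to coefficients in that of \<open>adj X * X\<close>.\<close>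
  define JP where "JP = mat N k (\<lambda>(i, l). if i < k then P $$ (i, l) else 0)"
  have JP: "JP \<in> carrier_mat N k" by (simp add: JP_def)
  have apJP: "mat_apply JP w i = (if i < k then mat_apply P w i else 0)" if "i < N" for w i
    using that P' JP by (auto simp: mat_apply_def JP_def)
  have nJP: "norm_sq N (mat_apply JP w) = norm_sq k w" for w
  proof -
    have "norm_sq N (mat_apply JP w) = norm_sq k (mat_apply P w)"
      unfolding norm_sq_def using k by (intro sum.mono_neutral_cong_right) (auto simp: apJP)
    then show ?thesis using norm_sq_isometry[OF P'(1,3)] by simp
  qed
  define R where "R = adj V * JP"
  have R: "R \<in> carrier_mat N k" unfolding R_def by (rule mult_carrier_mat[OF V'(4) JP])
  have apR: "(\<Sum>l<k. R $$ (i, l) * w l) = mat_apply (adj V) (mat_apply JP w) i" if "i < N" for w i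
    using mat_apply_mult[OF V'(4) JP that, of w] R unfolding R_def[symmetric] by (simp add: mat_apply_def)
  have comp: "\<mu> j \<le> s j + 0" if "j < k" for j
  proof (rule eigenvalue_comparison[where R = "\<lambda>i l. R $$ (i, l)" and N = N and k = k])
    fix w
    have "(\<Sum>i<N. (cmod (\<Sum>l<k. R $$ (i, l) * w l))^2) = norm_sq N (mat_apply (adj V) (mat_apply JP w))"
      by (simp add: norm_sq_def apR)
    also have "\<dots> = norm_sq k w" using norm_sq_isometry[OF V'(4)] V'(2) nJP by simp
    finally show "(\<Sum>i<N. (cmod (\<Sum>l<k. R $$ (i, l) * w l))^2) = (\<Sum>l<k. (cmod (w l))^2)"
      by (simp add: norm_sq_def)
    have "mat_apply (adj P) (mat_apply P w) i = w i" if "i < k" for i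
      using mat_apply_mult[OF P'(4,1) that, of w] P'(3) mat_apply_one[OF that] by simp
    then have "(\<Sum>l<k. \<mu> l * (cmod (w l))^2) = norm_sq k (mat_apply Y (mat_apply P w))"
      by (simp add: norm_sq_udiag[OF Y P gramY])
    also have "\<dots> = (\<Sum>i<k. (cmod (mat_apply X (mat_apply JP w) i))^2)"
      unfolding norm_sq_def
    proof (intro sum.cong refl arg_cong[of _ _ "\<lambda>z. (cmod z)^2"])
      fix i assume "i \<in> {..<k}"
      then show "mat_apply Y (mat_apply P w) i = mat_apply X (mat_apply JP w) i"
        using X Y k unfolding mat_apply_def[of Y] mat_apply_def[of X]
        by (intro sum.mono_neutral_cong_left) (auto simp: apJP Y_def)
    qed
    also have "\<dots> \<le> norm_sq N (mat_apply X (mat_apply JP w))"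
      unfolding norm_sq_def using k by (intro sum_mono2) auto
    also have "\<dots> = (\<Sum>i<N. s i * (cmod (\<Sum>l<k. R $$ (i, l) * w l))^2)"
      by (simp add: norm_sq_udiag[OF X V gram] apR)
    finally show "(\<Sum>l<k. \<mu> l * (cmod (w l))^2) \<le>
        (\<Sum>i<N. s i * (cmod (\<Sum>l<k. R $$ (i, l) * w l))^2) + 0 * (\<Sum>l<k. (cmod (w l))^2)" by simp
  qed (use p s that k in \<open>auto simp: \<mu>_def\<close>)
  have "complex_of_real ((cmod (det Y))^2) = det (adj Y * Y)"
    using Y by (simp add: det_mult[where n = k] det_adj[OF Y] complex_norm_square mult.commute del: of_real_power)
  also have "\<dots> = of_real (\<Prod>j<k. \<mu> j)"
    unfolding gramY by (simp add: udiag_det[OF P])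
  finally have "(cmod (det Y))^2 = (\<Prod>j<k. \<mu> j)" by (simp only: of_real_eq_iff)
  also have "\<dots> \<le> (\<Prod>j<k. s j)"
    using comp gram_eigenvalue_nonneg[OF Y P gramY] by (intro prod_mono) auto
  finally show ?thesis by (simp add: Y_def)
qed

text \<open>Weyl's inequality, with the sum of the entry moduli in place of the operator norm. It
  makes ordered eigenvalues depend continuously on the entries even where the eigenbases
  jump.\<close>

lemma singular_value_perturbation:
  assumes X: "X \<in> carrier_mat N N" "X' \<in> carrier_mat N N" and V: "unitary_mat N V" "unitary_mat N V'"
    and gram: "adj X * X = real_udiag N V s"
      "adj X' * X' = real_udiag N V' s'"
    and s: "\<And>i j. i \<le> j \<Longrightarrow> j < N \<Longrightarrow> s j \<le> s i" "\<And>i j. i \<le> j \<Longrightarrow> j < N \<Longrightarrow> s' j \<le> s' i" and j: "j < N"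
  shows "s j \<le> s' j + (\<Sum>i<N. \<Sum>j<N. cmod ((adj X * X) $$ (i, j) - (adj X' * X') $$ (i, j)))"
proof (rule eigenvalue_comparison[where R = "\<lambda>i l. (adj V' * V) $$ (i, l)" and N = N and k = N])
  note V' = unitary_matD[OF V(1)] unitary_matD[OF V(2)]
  fix w
  define c where "c = mat_apply V w"
  have R: "(\<Sum>l<N. (adj V' * V) $$ (i, l) * w l) = mat_apply (adj V') c i" if "i < N" for i
    using mat_apply_mult[OF V'(10,1) that, of w] V' by (simp add: c_def mat_apply_def del: index_mult_mat(1))
  have nc: "norm_sq N c = norm_sq N w" unfolding c_def by (rule norm_sq_isometry[OF V'(1,3)])
  have "(\<Sum>i<N. (cmod (\<Sum>l<N. (adj V' * V) $$ (i, l) * w l))^2) = norm_sq N (mat_apply (adj V') c)"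
    by (simp add: norm_sq_def R del: index_mult_mat(1))
  also have "\<dots> = norm_sq N w" using norm_sq_isometry[OF V'(10)] V'(8) nc by simp
  finally show "(\<Sum>i<N. (cmod (\<Sum>l<N. (adj V' * V) $$ (i, l) * w l))^2) = (\<Sum>l<N. (cmod (w l))^2)"
    by (simp add: norm_sq_def)
  let ?\<Delta> = "\<lambda>i j. (adj X * X) $$ (i, j) - (adj X' * X') $$ (i, j)"
  \<comment> \<open>By AM-GM; this converts entrywise differences into a multiple of
    \<open>norm_sq N c\<close>.\<close>
  have le: "cmod (c i) * cmod (c l) \<le> norm_sq N c" if "i < N" "l < N" for i l
  proof -
    have "(cmod (c i))^2 \<le> norm_sq N c" "(cmod (c l))^2 \<le> norm_sq N c"
      unfolding norm_sq_def using that by (auto intro!: member_le_sum)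
    moreover have "2 * (cmod (c i) * cmod (c l)) \<le> (cmod (c i))^2 + (cmod (c l))^2"
      using sum_squares_bound[of "cmod (c i)" "cmod (c l)"] by (simp add: mult.assoc)
    ultimately show ?thesis by linarith
  qed
  have "complex_of_real (norm_sq N (mat_apply X c) - norm_sq N (mat_apply X' c)) = (\<Sum>i<N. \<Sum>j<N. cnj (c i) * ?\<Delta> i j * c j)"
    by (simp add: norm_sq_gram[OF X(1)] norm_sq_gram[OF X(2)] sum_subtractf left_diff_distrib right_diff_distrib
        del: index_mult_mat(1))
  then have "norm_sq N (mat_apply X c) - norm_sq N (mat_apply X' c) \<le> cmod (\<Sum>i<N. \<Sum>j<N. cnj (c i) * ?\<Delta> i j * c j)"
    by (metis norm_of_real abs_ge_self)
  also have "\<dots> \<le> (\<Sum>i<N. \<Sum>j<N. cmod (cnj (c i) * ?\<Delta> i j * c j))"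
    by (intro order_trans[OF norm_sum] sum_mono norm_sum)
  also have "\<dots> \<le> (\<Sum>i<N. \<Sum>j<N. cmod (?\<Delta> i j) * norm_sq N c)"
  proof (intro sum_mono)
    fix i l assume "i \<in> {..<N}" "l \<in> {..<N}"
    then have "cmod (?\<Delta> i l) * (cmod (c i) * cmod (c l)) \<le> cmod (?\<Delta> i l) * norm_sq N c"
      using le by (intro mult_left_mono) auto
    then show "cmod (cnj (c i) * ?\<Delta> i l * c l) \<le> cmod (?\<Delta> i l) * norm_sq N c"
      by (simp add: norm_mult mult_ac)
  qed
  also have "\<dots> = (\<Sum>i<N. \<Sum>j<N. cmod (?\<Delta> i j)) * norm_sq N w" by (simp only: sum_distrib_right nc)
  finally have d: "norm_sq N (mat_apply X c) \<le> norm_sq N (mat_apply X' c) + (\<Sum>i<N. \<Sum>j<N. cmod (?\<Delta> i j)) * norm_sq N w" by simp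
  have "mat_apply (adj V) c i = w i" if "i < N" for i
    using mat_apply_mult[OF V'(4,1) that, of w] V'(3) mat_apply_one[OF that] by (simp add: c_def)
  then have "(\<Sum>l<N. s l * (cmod (w l))^2) = norm_sq N (mat_apply X c)" by (simp add: norm_sq_udiag[OF X(1) V(1) gram(1)])
  moreover have "norm_sq N (mat_apply X' c) = (\<Sum>i<N. s' i * (cmod (\<Sum>l<N. (adj V' * V) $$ (i, l) * w l))^2)"
    by (simp add: norm_sq_udiag[OF X(2) V(2) gram(2)] R del: index_mult_mat(1))
  ultimately show "(\<Sum>l<N. s l * (cmod (w l))^2) \<le>
      (\<Sum>i<N. s' i * (cmod (\<Sum>l<N. (adj V' * V) $$ (i, l) * w l))^2) +
      (\<Sum>i<N. \<Sum>j<N. cmod (?\<Delta> i j)) * (\<Sum>l<N. (cmod (w l))^2)"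
    using d by (simp add: norm_sq_def)
qed (use s j in auto)

section \<open>Convex functions of finitely many variables\<close>

text \<open>One step of the Hahn--Banach extension: a subgradient in the first \<open>k\<close> coordinates extends
  to coordinate \<open>k\<close> since all left difference quotients lie below all right ones.\<close>

lemma convex_subgradient:
  fixes \<Phi> :: "(nat \<Rightarrow> real) \<Rightarrow> real"
  assumes conv: "\<And>y z u. 0 \<le> u \<Longrightarrow> u \<le> 1 \<Longrightarrow>
      \<Phi> (\<lambda>j. (1 - u) * y j + u * z j) \<le> (1 - u) * \<Phi> y + u * \<Phi> z"
  shows "\<exists>a. \<forall>y. (\<forall>j\<ge>k. y j = x j) \<longrightarrow> \<Phi> x + (\<Sum>j<k. a j * (y j - x j)) \<le> \<Phi> y"
proof (induction k)
  case 0
  show ?case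
  proof (intro exI allI impI)
    fix y :: "nat \<Rightarrow> real" assume "\<forall>j\<ge>0. y j = x j"
    then have "y = x" by auto
    then show "\<Phi> x + (\<Sum>j<0. (\<lambda>_. 0) j * (y j - x j)) \<le> \<Phi> y" by simp
  qed
next
  case (Suc k)
  then obtain a where a: "\<And>y. (\<forall>j\<ge>k. y j = x j) \<Longrightarrow> \<Phi> x + (\<Sum>j<k. a j * (y j - x j)) \<le> \<Phi> y"
    by blast
  define L where "L y = (\<Sum>j<k. a j * (y j - x j))" for y :: "nat \<Rightarrow> real"
  define q where "q y = (\<Phi> y - \<Phi> x - L y) / (y k - x k)" for y
  define E where "E = {y :: nat \<Rightarrow> real. \<forall>j>k. y j = x j}"
  have sep: "q y \<le> q z" if y: "y \<in> E" "y k < x k" and z: "z \<in> E" "x k < z k" for y z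
  proof -
    define s where "s = x k - y k"
    define t where "t = z k - x k"
    have st: "0 < s" "0 < t" using y z by (auto simp: s_def t_def)
    \<comment> \<open>The weight at which the segment from \<open>y\<close> to \<open>z\<close>
      meets the value \<open>x k\<close> in coordinate \<open>k\<close>, so that the induction
      hypothesis applies.\<close>
    define u where "u = s / (s + t)"
    have u: "0 \<le> u" "u \<le> 1" "1 - u = t / (s + t)" using st by (auto simp: u_def field_simps)
    define v where "v j = (1 - u) * y j + u * z j" for j
    have "v k - x k = (1 - u) * (- s) + u * t" by (simp add: v_def s_def t_def algebra_simps)
    also have "\<dots> = 0" unfolding u(3) unfolding u_def using st by (simp add: field_simps)
    finally have "v k = x k" by simp
    moreover have "v j = x j" if "k < j" for j using that y z by (simp add: v_def E_def algebra_simps)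
    ultimately have "\<forall>j\<ge>k. v j = x j" by (auto simp: order_le_less)
    then have "\<Phi> x + L v \<le> \<Phi> v" unfolding L_def by (rule a)
    also have "\<dots> \<le> (1 - u) * \<Phi> y + u * \<Phi> z" unfolding v_def by (rule conv[OF u(1,2)])
    also have "L v = (1 - u) * L y + u * L z"
      unfolding L_def sum_distrib_left sum.distrib[symmetric]
      by (intro sum.cong refl) (simp add: v_def algebra_simps)
    finally have "0 \<le> (1 - u) * (\<Phi> y - \<Phi> x - L y) + u * (\<Phi> z - \<Phi> x - L z)"
      by (simp add: algebra_simps)
    then have "0 \<le> (s + t) * ((1 - u) * (\<Phi> y - \<Phi> x - L y) + u * (\<Phi> z - \<Phi> x - L z))"
      using st by simp
    also have "\<dots> = t * (\<Phi> y - \<Phi> x - L y) + s * (\<Phi> z - \<Phi> x - L z)"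
      unfolding u(3) unfolding u_def using st by (simp add: distrib_left)
    finally have "- (\<Phi> y - \<Phi> x - L y) / s \<le> (\<Phi> z - \<Phi> x - L z) / t"
      using st by (simp add: field_simps)
    moreover have "s = - (y k - x k)" by (simp add: s_def)
    ultimately show ?thesis by (simp only: q_def t_def minus_divide_divide)
  qed
  \<comment> \<open>Any number between the left and the right quotients would serve. Shifting
    \<open>x\<close> by one unit in coordinate \<open>k\<close>, either way, shows that neither
    family is empty.\<close>
  define c where "c = (SUP y \<in> {y \<in> E. y k < x k}. q y)"
  have ne: "x(k := x k - 1) \<in> {y \<in> E. y k < x k}" "x(k := x k + 1) \<in> {z \<in> E. x k < z k}" by (auto simp: E_def)
  have bdd: "bdd_above (q ` {y \<in> E. y k < x k})"
    using ne(2) sep by (intro bdd_aboveI2[where M = "q (x(k := x k + 1))"]) auto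
  have low: "q y \<le> c" if "y \<in> E" "y k < x k" for y
    unfolding c_def by (rule cSUP_upper[OF _ bdd]) (use that in auto)
  have up: "c \<le> q z" if "z \<in> E" "x k < z k" for z
    unfolding c_def by (rule cSUP_least) (use ne(1) that sep in auto)
  show ?case
  proof (intro exI[of _ "a(k := c)"] allI impI)
    fix y :: "nat \<Rightarrow> real" assume y: "\<forall>j\<ge>Suc k. y j = x j"
    then have yE: "y \<in> E" by (auto simp: E_def)
    have eq: "(\<Sum>j<Suc k. (a(k := c)) j * (y j - x j)) = L y + c * (y k - x k)" by (simp add: L_def)
    consider "y k < x k" | "y k = x k" | "x k < y k" by linarith
    then have "c * (y k - x k) \<le> \<Phi> y - \<Phi> x - L y"
    proof cases
      case 1
      then show ?thesis using low[OF yE 1] by (simp add: q_def field_simps)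
    next
      case 2
      then have "\<forall>j\<ge>k. y j = x j" using y by (metis not_less_eq_eq order_antisym)
      then show ?thesis using a[of y] 2 by (simp add: L_def)
    next
      case 3
      then show ?thesis using up[OF yE 3] by (simp add: q_def field_simps)
    qed
    then show "\<Phi> x + (\<Sum>j<Suc k. (a(k := c)) j * (y j - x j)) \<le> \<Phi> y" unfolding eq by simp
  qed
qed

text \<open>Summation by parts: the drops between consecutive weights are nonnegative and multiply
  nonnegative partial sums. The remaining term is the last weight, of unknown sign, times the total,
  which is 0.\<close>

lemma Abel_sum_nonneg:
  fixes b d :: "nat \<Rightarrow> real"
  assumes b: "\<And>i j. i \<le> j \<Longrightarrow> j < N \<Longrightarrow> b j \<le> b i"
    and part: "\<And>k. k < N \<Longrightarrow> 0 \<le> (\<Sum>j<k. d j)" and total: "(\<Sum>j<N. d j) = 0"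
  shows "0 \<le> (\<Sum>j<N. b j * d j)"
proof -
  \<comment> \<open>At \<open>n = 0\<close> the truncated index \<open>n - 1\<close> is harmless,
    since both sides are 0.\<close>
  have "b (n - 1) * (\<Sum>j<n. d j) \<le> (\<Sum>j<n. b j * d j)" if "n \<le> N" for n
    using that
  proof (induction n)
    case (Suc n)
    have "(b n - b (n - 1)) * (\<Sum>j<n. d j) \<le> 0"
      using part[of n] b[of "n - 1" n] Suc.prems by (intro mult_nonpos_nonneg) auto
    then show ?case using Suc by (simp add: algebra_simps)
  qed simp
  from this[of N] total show ?thesis by simp
qed

section \<open>Products of complex powers\<close>

text \<open>Closed under sums and products, hence under minors. The strip exceeds
  \<open>0 \<le> Re z \<le> 1\<close> by 1 on either side, which leaves room for Cauchy's
  inequality.\<close>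

definition strip_entire :: "(complex \<Rightarrow> complex) \<Rightarrow> bool" where
  "strip_entire F \<longleftrightarrow> F holomorphic_on UNIV \<and> (\<exists>B. \<forall>z. - 1 \<le> Re z \<longrightarrow> Re z \<le> 2 \<longrightarrow> cmod (F z) \<le> B)"

lemma strip_entire_const [intro]: "strip_entire (\<lambda>_. c)"
  unfolding strip_entire_def by (intro conjI holomorphic_intros exI[of _ "cmod c"]) auto

lemma strip_entire_mult [intro]:
  assumes "strip_entire F" "strip_entire G"
  shows "strip_entire (\<lambda>z. F z * G z)"
proof -
  obtain A B where A: "\<And>z. - 1 \<le> Re z \<Longrightarrow> Re z \<le> 2 \<Longrightarrow> cmod (F z) \<le> A"
    and B: "\<And>z. - 1 \<le> Re z \<Longrightarrow> Re z \<le> 2 \<Longrightarrow> cmod (G z) \<le> B"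
    using assms by (auto simp: strip_entire_def)
  have "0 \<le> A" by (rule order_trans[OF norm_ge_zero A[of 0]]) auto
  then show ?thesis
    using assms unfolding strip_entire_def norm_mult
    by (intro conjI holomorphic_intros exI[of _ "A * B"] allI impI mult_mono A B) auto
qed

lemma strip_entire_add:
  assumes "strip_entire F" "strip_entire G"
  shows "strip_entire (\<lambda>z. F z + G z)"
proof -
  obtain A B where A: "\<And>z. - 1 \<le> Re z \<Longrightarrow> Re z \<le> 2 \<Longrightarrow> cmod (F z) \<le> A"
    and B: "\<And>z. - 1 \<le> Re z \<Longrightarrow> Re z \<le> 2 \<Longrightarrow> cmod (G z) \<le> B"
    using assms by (auto simp: strip_entire_def)
  then show ?thesis
    using assms unfolding strip_entire_def
    by (intro conjI holomorphic_intros exI[of _ "A + B"] allI impI norm_triangle_le add_mono A B) auto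
qed

lemma strip_entire_sum: "(\<And>i. i \<in> I \<Longrightarrow> strip_entire (F i)) \<Longrightarrow> strip_entire (\<lambda>z. \<Sum>i\<in>I. F i z)"
  by (induction I rule: infinite_finite_induct) (auto intro: strip_entire_add)

lemma strip_entire_prod: "(\<And>i. i \<in> I \<Longrightarrow> strip_entire (F i)) \<Longrightarrow> strip_entire (\<lambda>z. \<Prod>i\<in>I. F i z)"
  by (induction I rule: infinite_finite_induct) auto

text \<open>Since \<open>l\<close> is real, the modulus depends on \<open>Re z\<close>
  alone.\<close>

lemma strip_entire_exp: "strip_entire (\<lambda>z. exp (z * of_real l))"
  unfolding strip_entire_def
proof (intro conjI holomorphic_intros exI[of _ "exp (2 * \<bar>l\<bar>)"] allI impI)
  fix z assume "- 1 \<le> Re z" "Re z \<le> 2"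
  then have "\<bar>Re z\<bar> * \<bar>l\<bar> \<le> 2 * \<bar>l\<bar>" by (intro mult_right_mono) auto
  then have "Re z * l \<le> 2 * \<bar>l\<bar>" using abs_ge_self[of "Re z * l"] by (simp add: abs_mult)
  then show "cmod (exp (z * of_real l)) \<le> exp (2 * \<bar>l\<bar>)" by simp
qed

lemma det_Leibniz:
  "det (mat k k (\<lambda>(i, j). M i j)) = (\<Sum>p | p permutes {0..<k}. of_int (sign p) * (\<Prod>i = 0..<k. M i (p i)) :: complex)"
  unfolding det_def'[OF mat_carrier]
proof (intro sum.cong refl arg_cong2[where f = "(*)"] prod.cong)
  fix p i assume "p \<in> {p. p permutes {0..<k}}" "i \<in> {0..<k}"
  then show "mat k k (\<lambda>(i, j). M i j) $$ (i, p i) = M i (p i)"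
    using permutes_in_image[of p "{0..<k}" i] by auto
qed

lemma strip_entire_det:
  assumes "\<And>i j. i < k \<Longrightarrow> j < k \<Longrightarrow> strip_entire (\<lambda>z. M z i j)"
  shows "strip_entire (\<lambda>z. det (mat k k (\<lambda>(i, j). M z i j)))"
  unfolding det_Leibniz
proof (intro strip_entire_sum strip_entire_mult strip_entire_const strip_entire_prod assms)
  fix p i assume "p \<in> {p. p permutes {0..<k}}" "i \<in> {0..<k}"
  then show "i < k" "p i < k" using permutes_in_image[of p "{0..<k}" i] by auto
qed

text \<open>Only the identity permutation contributes. Any other moves at least two indices, while
  the product rule differentiates one factor at a time, so a vanishing off-diagonal entry of the
  identity remains.\<close>

lemma det_deriv_at_identity:
  assumes D: "\<And>i j. i < k \<Longrightarrow> j < k \<Longrightarrow> ((\<lambda>z. M z i j) has_field_derivative D i j) (at (0 :: complex))"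
    and one: "\<And>i j. i < k \<Longrightarrow> j < k \<Longrightarrow> M 0 i j = (if i = j then 1 else 0)"
  shows "((\<lambda>z. det (mat k k (\<lambda>(i, j). M z i j))) has_field_derivative (\<Sum>i<k. D i i)) (at 0)"
proof -
  let ?P = "{p. p permutes {0..<k}}"
  have lt: "p i < k" if "p \<in> ?P" "i < k" for p i using that permutes_in_image[of p "{0..<k}" i] by auto
  have "((\<lambda>z. \<Sum>p\<in>?P. of_int (sign p) * (\<Prod>i = 0..<k. M z i (p i))) has_field_derivative
      (\<Sum>p\<in>?P. of_int (sign p) * (\<Sum>i = 0..<k. D i (p i) * (\<Prod>j\<in>{0..<k} - {i}. M 0 j (p j))))) (at 0)"
    by (intro DERIV_sum DERIV_cmult has_field_derivative_prod D) (use lt in auto)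
  also have "(\<Sum>p\<in>?P. of_int (sign p) * (\<Sum>i = 0..<k. D i (p i) * (\<Prod>j\<in>{0..<k} - {i}. M 0 j (p j)))) =
      (\<Sum>p\<in>?P. if p = id then (\<Sum>i<k. D i i) else 0)"
  proof (rule sum.cong[OF refl])
    fix p assume p: "p \<in> ?P"
    show "of_int (sign p) * (\<Sum>i = 0..<k. D i (p i) * (\<Prod>j\<in>{0..<k} - {i}. M 0 j (p j))) =
        (if p = id then (\<Sum>i<k. D i i) else 0)"
    proof (cases "p = id")
      case True
      then show ?thesis by (simp add: one lessThan_atLeast0)
    next
      case False
      then obtain a where a: "p a \<noteq> a" by (auto simp: fun_eq_iff)
      then have ak: "a < k" using p permutes_not_in[of p "{0..<k}" a] by auto
      have pa: "p (p a) \<noteq> p a" using a p permutes_inj[of p] by (auto dest: injD)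
      have "(\<Prod>j\<in>{0..<k} - {i}. M 0 j (p j)) = 0" for i
      proof -
        \<comment> \<open>A moved index other than the differentiated one.\<close>
        define j where "j = (if i = a then p a else a)"
        have "j < k" "j \<noteq> i" "p j \<noteq> j" using ak a pa lt[OF p ak] by (auto simp: j_def)
        then show ?thesis using lt[OF p] by (auto simp: one intro!: prod_zero bexI[of _ j])
      qed
      then show ?thesis using False by simp
    qed
  qed
  also have "\<dots> = (\<Sum>i<k. D i i)" by (simp add: finite_permutations permutes_id)
  finally show ?thesis by (simp only: det_Leibniz)
qed

text \<open>A pair \<open>(U, l)\<close> encodes the positive matrix with eigenbasis
  \<open>U\<close> and eigenvalue logarithms \<open>l\<close>. Storing logarithms makes every
  complex power an explicit entire function of \<open>z\<close>.\<close>

fun cpow_prod :: "nat \<Rightarrow> (complex mat \<times> (nat \<Rightarrow> real)) list \<Rightarrow> complex \<Rightarrow> complex mat" where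
  "cpow_prod N [] z = 1\<^sub>m N"
| "cpow_prod N ((U, l) # As) z = udiag N U (\<lambda>i. exp (z * of_real (l i))) * cpow_prod N As z"

fun log_sum :: "nat \<Rightarrow> (complex mat \<times> (nat \<Rightarrow> real)) list \<Rightarrow> complex mat" where
  "log_sum N [] = 0\<^sub>m N N"
| "log_sum N ((U, l) # As) = real_udiag N U l + log_sum N As"

abbreviation unitaries :: "nat \<Rightarrow> (complex mat \<times> (nat \<Rightarrow> real)) list \<Rightarrow> bool" where
  "unitaries N As \<equiv> \<forall>(U, l) \<in> set As. unitary_mat N U"

lemma cpow_prod_carrier [simp]: "unitaries N As \<Longrightarrow> cpow_prod N As z \<in> carrier_mat N N"
  by (induction N As z rule: cpow_prod.induct) (auto dest: unitary_matD)

lemma log_sum_carrier [simp]: "unitaries N As \<Longrightarrow> log_sum N As \<in> carrier_mat N N"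
  by (induction N As rule: log_sum.induct) (auto dest: unitary_matD)

lemma cpow_prod_dims [simp]:
  "unitaries N As \<Longrightarrow> dim_row (cpow_prod N As z) = N" "unitaries N As \<Longrightarrow> dim_col (cpow_prod N As z) = N"
  using cpow_prod_carrier[of As N z] by blast+

lemma log_sum_dims [simp]: "unitaries N As \<Longrightarrow> dim_row (log_sum N As) = N" "unitaries N As \<Longrightarrow> dim_col (log_sum N As) = N"
  using log_sum_carrier[of As N] by blast+

lemma udiag_one: "unitary_mat N U \<Longrightarrow> udiag N U (\<lambda>_. 1) = 1\<^sub>m N"
  by (frule unitary_matD(1)) (simp add: right_mult_one_mat[of U N N] unitary_matD(2))

lemma cpow_prod_0: "unitaries N As \<Longrightarrow> cpow_prod N As 0 = 1\<^sub>m N"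
proof (induction As)
  case (Cons A As)
  then show ?case using udiag_one[of N "fst A"] by (cases A) simp
qed simp

lemma unitary_udiag:
  assumes U: "unitary_mat N U" and d: "\<And>i. cmod (d i) = 1"
  shows "unitary_mat N (udiag N U d)"
proof -
  note U' = unitary_matD[OF U]
  have "d i * cnj (d i) = 1" for i using d[of i] complex_norm_square[of "d i"] by simp
  then have "udiag N U d * udiag N U (\<lambda>i. cnj (d i)) = 1\<^sub>m N"
    unfolding udiag_mult[OF U] using U' by (simp add: right_mult_one_mat[of _ N N])
  then show ?thesis using U'(1) by (simp add: unitary_mat_def udiag_adj)
qed

text \<open>For imaginary \<open>z\<close> the diagonal entries lie on the unit circle.\<close>

lemma cpow_prod_unitary: "unitaries N As \<Longrightarrow> Re z = 0 \<Longrightarrow> unitary_mat N (cpow_prod N As z)"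
proof (induction N As z rule: cpow_prod.induct)
  case (1 N z)
  then show ?case by (simp add: unitary_mat_def)
next
  case (2 N U l As z)
  then show ?case by (auto intro!: unitary_mult unitary_udiag)
qed

lemma det_cpow_prod:
  "unitaries N As \<Longrightarrow> det (cpow_prod N As z) = exp (z * of_real (\<Sum>(U, l)\<leftarrow>As. \<Sum>i<N. l i))"
proof (induction N As z rule: cpow_prod.induct)
  case (2 N U l As z)
  then have U: "unitary_mat N U" and As: "unitaries N As" by auto
  have "det (cpow_prod N ((U, l) # As) z) = (\<Prod>i<N. exp (z * of_real (l i))) * det (cpow_prod N As z)"
    using As unitary_matD[OF U] by (simp add: det_mult[where n = N] udiag_det[OF U, symmetric])
  also have "(\<Prod>i<N. exp (z * of_real (l i))) = exp (z * of_real (\<Sum>i<N. l i))"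
    by (simp add: exp_sum sum_distrib_left)
  finally show ?case using 2 by (simp add: exp_add distrib_left)
qed simp

lemma strip_entire_cpow_prod:
  "unitaries N As \<Longrightarrow> i < N \<Longrightarrow> j < N \<Longrightarrow> strip_entire (\<lambda>z. cpow_prod N As z $$ (i, j))"
proof (induction As arbitrary: i j)
  case (Cons A As)
  obtain U l where A: "A = (U, l)" by fastforce
  have U: "U \<in> carrier_mat N N" using Cons.prems A unitary_matD by auto
  have As: "unitaries N As" using Cons.prems by auto
  have "cpow_prod N (A # As) z $$ (i, j) =
      (\<Sum>k<N. (\<Sum>a<N. U $$ (i, a) * exp (z * of_real (l a)) * cnj (U $$ (k, a))) * cpow_prod N As z $$ (k, j))" for z
    using Cons.prems U cpow_prod_carrier[OF As, of z] unfolding A cpow_prod.simps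
    by (subst mult_index) (auto simp: udiag_index[OF U] simp del: index_mult_mat(1))
  then show ?case using Cons.IH[OF As] Cons.prems
    by (auto intro!: strip_entire_sum strip_entire_mult strip_entire_exp)
qed auto

lemma cpow_prod_deriv:
  "unitaries N As \<Longrightarrow> i < N \<Longrightarrow> j < N \<Longrightarrow>
    ((\<lambda>z. cpow_prod N As z $$ (i, j)) has_field_derivative log_sum N As $$ (i, j)) (at 0)"
proof (induction As arbitrary: i j)
  case (Cons A As)
  obtain U l where A: "A = (U, l)" by fastforce
  have Uu: "unitary_mat N U" using Cons.prems A by auto
  then have U: "U \<in> carrier_mat N N" using unitary_matD by auto
  have As: "unitaries N As" using Cons.prems by auto
  let ?g = "\<lambda>i k z. \<Sum>a<N. U $$ (i, a) * exp (z * of_real (l a)) * cnj (U $$ (k, a))"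
  have G: "cpow_prod N (A # As) z $$ (i, j) = (\<Sum>k<N. ?g i k z * cpow_prod N As z $$ (k, j))" for z
    using Cons.prems U cpow_prod_carrier[OF As, of z] unfolding A cpow_prod.simps
    by (subst mult_index) (auto simp: udiag_index[OF U] simp del: index_mult_mat(1))
  have g0: "?g i k 0 = (if i = k then 1 else 0)" if "k < N" for k
    using udiag_index[OF U, of i k "\<lambda>_. 1"] that Cons.prems unitary_matD[OF Uu]
    by (simp add: right_mult_one_mat[of _ N N])
  have gd: "(?g i k has_field_derivative real_udiag N U l $$ (i, k)) (at 0)" if "k < N" for k
    unfolding udiag_index[OF U \<open>i < N\<close> that]
    by (auto intro!: derivative_eq_intros sum.cong)
  have "((\<lambda>z. \<Sum>k<N. ?g i k z * cpow_prod N As z $$ (k, j)) has_field_derivative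
      (\<Sum>k<N. real_udiag N U l $$ (i, k) * cpow_prod N As 0 $$ (k, j)
        + log_sum N As $$ (k, j) * ?g i k 0)) (at 0)"
    by (intro DERIV_sum DERIV_mult gd Cons.IH[OF As]) (use Cons.prems in auto)
  \<comment> \<open>At 0 the undifferentiated factors are Kronecker deltas, so each of the two sums
    over \<open>k\<close> retains one term.\<close>
  also have "(\<Sum>k<N. real_udiag N U l $$ (i, k) * cpow_prod N As 0 $$ (k, j) + log_sum N As $$ (k, j) * ?g i k 0) =
      (\<Sum>k<N. (if k = j then real_udiag N U l $$ (i, j) else 0) + (if k = i then log_sum N As $$ (i, j) else 0))"
  proof (rule sum.cong[OF refl])
    fix k assume "k \<in> {..<N}"
    then have k: "k < N" by simp
    show "real_udiag N U l $$ (i, k) * cpow_prod N As 0 $$ (k, j) + log_sum N As $$ (k, j) * ?g i k 0 =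
        (if k = j then real_udiag N U l $$ (i, j) else 0) + (if k = i then log_sum N As $$ (i, j) else 0)"
      unfolding cpow_prod_0[OF As] g0[OF k] using k Cons.prems by (auto simp del: index_mult_mat(1))
  qed
  also have "\<dots> = log_sum N (A # As) $$ (i, j)"
    using Cons.prems log_sum_carrier[OF As] U by (simp add: A sum.distrib del: index_mult_mat(1))
  finally show ?case by (simp only: G)
qed auto

text \<open>Weyl's inequality against the zero matrix, whose Gram eigenvalues all vanish.\<close>

lemma gram_spectrum_bound:
  assumes X: "X \<in> carrier_mat N N" and V: "unitary_mat N V"
    and gram: "adj X * X = real_udiag N V s"
    and s: "\<And>i j. i \<le> j \<Longrightarrow> j < N \<Longrightarrow> s j \<le> s i" and j: "j < N"
  shows "s j \<le> (\<Sum>i<N. \<Sum>j<N. cmod ((adj X * X) $$ (i, j)))"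
proof -
  have one: "unitary_mat N (1\<^sub>m N)" by (simp add: unitary_mat_def)
  have zero: "adj (0\<^sub>m N N) * 0\<^sub>m N N = (0\<^sub>m N N :: complex mat)"
    by (rule eq_matI) (auto simp: mult_index simp del: index_mult_mat(1))
  have "udiag N (1\<^sub>m N) (\<lambda>i. of_real 0) = 0\<^sub>m N N"
    by (rule eq_matI) (auto simp: udiag_index mat_diag_def simp del: index_mult_mat(1))
  then have "adj (0\<^sub>m N N) * 0\<^sub>m N N = udiag N (1\<^sub>m N) (\<lambda>i. of_real 0)" by (simp only: zero)
  from singular_value_perturbation[OF X zero_carrier_mat V one gram this s _ j]
  have "s j \<le> 0 + (\<Sum>i<N. \<Sum>j<N. cmod ((adj X * X) $$ (i, j) - (adj (0\<^sub>m N N) * 0\<^sub>m N N) $$ (i, j)))"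
    by simp
  also have "\<dots> = (\<Sum>i<N. \<Sum>j<N. cmod ((adj X * X) $$ (i, j)))"
    unfolding zero by (simp del: index_mult_mat(1))
  finally show ?thesis .
qed

lemma mult3_index:
  assumes "A \<in> carrier_mat n n" "B \<in> carrier_mat n n" "C \<in> carrier_mat n n" "i < n" "j < n"
  shows "(A * (B * C)) $$ (i, j) = (\<Sum>a<n. \<Sum>b<n. A $$ (i, a) * (B $$ (a, b) * C $$ (b, j) :: complex))"
proof -
  have "(A * (B * C)) $$ (i, j) = (\<Sum>a<n. A $$ (i, a) * (B * C) $$ (a, j))"
    using assms by (subst mult_index) auto
  also have "\<dots> = (\<Sum>a<n. \<Sum>b<n. A $$ (i, a) * (B $$ (a, b) * C $$ (b, j)))"
    using assms by (intro sum.cong refl) (auto simp: mult_index sum_distrib_left simp del: index_mult_mat(1))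
  finally show ?thesis .
qed

text \<open>The exponent in \<open>det_cpow_prod\<close> is a real multiple of \<open>z\<close>, so
  the modulus of the determinant on \<open>Re z = 1\<close> does not depend on \<open>t\<close>;
  this later yields equality for the full sum. Nonnegative numbers with nonzero product are
  positive, so their logarithms are meaningful.\<close>

lemma cpow_prod_gram_spectrum:
  assumes As: "unitaries N As" and V: "unitary_mat N V"
    and gram: "adj (cpow_prod N As (Complex 1 t)) * cpow_prod N As (Complex 1 t) = real_udiag N V s"
  shows "(\<Prod>j<N. s j) = exp (2 * (\<Sum>(U, l)\<leftarrow>As. \<Sum>i<N. l i))" and "\<And>j. j < N \<Longrightarrow> 0 < s j"
proof -
  let ?L = "\<Sum>(U, l)\<leftarrow>As. \<Sum>i<N. l i"
  let ?G = "cpow_prod N As (Complex 1 t)"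
  note Gc = cpow_prod_carrier[OF As, of "Complex 1 t"]
  have "complex_of_real (\<Prod>j<N. s j) = det (real_udiag N V s)"
    unfolding udiag_det[OF V] by simp
  also have "\<dots> = cnj (det ?G) * det ?G"
    unfolding gram[symmetric] det_mult[OF adj_carrier[OF Gc] Gc] det_adj[OF Gc] ..
  also have "\<dots> = exp (cnj (Complex 1 t) * of_real ?L + Complex 1 t * of_real ?L)"
    unfolding det_cpow_prod[OF As] exp_add by (simp add: exp_cnj)
  also have "cnj (Complex 1 t) * of_real ?L + Complex 1 t * of_real ?L = of_real (2 * ?L)"
    by (simp add: complex_eq_iff)
  finally show prod: "(\<Prod>j<N. s j) = exp (2 * ?L)" by (simp only: exp_of_real of_real_eq_iff)
  fix j assume j: "j < N"
  have "0 \<le> s j" by (rule gram_eigenvalue_nonneg[OF Gc V gram j])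
  moreover have "s j \<noteq> 0" using prod j by (metis exp_not_eq_zero finite_lessThan lessThan_iff prod_zero)
  ultimately show "0 < s j" by simp
qed

text \<open>The last two clauses make \<open>\<lambda>t. \<Phi> (Y t)\<close> integrable against \<open>beta0\<close> for bounded continuous \<open>Y\<close>; the
  Lebesgue integral of a non-integrable function is \<open>0\<close>.\<close>

definition convex_symmetric :: "nat \<Rightarrow> ((nat \<Rightarrow> real) \<Rightarrow> real) \<Rightarrow> bool" where
  "convex_symmetric N \<Phi> \<longleftrightarrow>
     (\<forall>y z u. 0 \<le> u \<longrightarrow> u \<le> 1 \<longrightarrow> \<Phi> (\<lambda>j. (1 - u) * y j + u * z j) \<le> (1 - u) * \<Phi> y + u * \<Phi> z) \<and>
     (\<forall>y z. (\<forall>j<N. y j = z j) \<longrightarrow> \<Phi> y = \<Phi> z) \<and>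
     (\<forall>y \<pi>. \<pi> permutes {..<N} \<longrightarrow> \<Phi> (\<lambda>j. y (\<pi> j)) = \<Phi> y) \<and>
     (\<forall>Y. (\<forall>j<N. continuous_on UNIV (\<lambda>t :: real. Y t j)) \<longrightarrow> continuous_on UNIV (\<lambda>t. \<Phi> (Y t))) \<and>
     (\<forall>K. \<exists>B. \<forall>y. (\<forall>j<N. \<bar>y j\<bar> \<le> K) \<longrightarrow> \<bar>\<Phi> y\<bar> \<le> B)"

text \<open>The bases \<open>E0\<close> and \<open>V0 t\<close> and the numbering of
  \<open>s t\<close> are arbitrary, without regularity in \<open>t\<close>. Continuity and
  measurability are obtained from ordered eigenvalues, and the symmetry of \<open>\<Phi>\<close>
  hides the ordering in the conclusion.\<close>

theorem convex_symmetric_golden_thompson: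
  fixes \<Phi> :: "(nat \<Rightarrow> real) \<Rightarrow> real" and s :: "real \<Rightarrow> nat \<Rightarrow> real"
  assumes As: "unitaries N As"
    and E0: "unitary_mat N E0" and H: "log_sum N As = real_udiag N E0 x"
    and V0: "\<And>t. unitary_mat N (V0 t)"
    and gram0: "\<And>t. adj (cpow_prod N As (Complex 1 t)) * cpow_prod N As (Complex 1 t) = real_udiag N (V0 t) (s t)"
    and \<Phi>: "convex_symmetric N \<Phi>"
  shows "\<Phi> x \<le> (LINT t|lborel. \<Phi> (\<lambda>j. ln (s t j) / 2) * beta0 t)"
proof -
  note \<Phi>' = \<Phi>[unfolded convex_symmetric_def]
  have conv: "\<And>y z u. 0 \<le> u \<Longrightarrow> u \<le> 1 \<Longrightarrow> \<Phi> (\<lambda>j. (1 - u) * y j + u * z j) \<le> (1 - u) * \<Phi> y + u * \<Phi> z"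
    and cong: "\<And>y z. (\<And>j. j < N \<Longrightarrow> y j = z j) \<Longrightarrow> \<Phi> y = \<Phi> z"
    and sym: "\<And>y p. p permutes {..<N} \<Longrightarrow> \<Phi> (\<lambda>j. y (p j)) = \<Phi> y"
    using \<Phi>' by blast+
  have cont: "\<And>Y. (\<And>j. j < N \<Longrightarrow> continuous_on UNIV (\<lambda>t :: real. Y t j)) \<Longrightarrow> continuous_on UNIV (\<lambda>t. \<Phi> (Y t))"
    and bdd: "\<And>K. \<exists>B. \<forall>y. (\<forall>j<N. \<bar>y j\<bar> \<le> K) \<longrightarrow> \<bar>\<Phi> y\<bar> \<le> B"
    using \<Phi>' by blast+
  define G where "G t = cpow_prod N As (Complex 1 t)" for t
  have Gc: "G t \<in> carrier_mat N N" for t using As by (simp add: G_def)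
  define A where "A t = adj (G t) * G t" for t
  have "\<exists>V p. unitary_mat N V \<and> p permutes {..<N} \<and> (\<forall>i j. i \<le> j \<longrightarrow> j < N \<longrightarrow> s t (p j) \<le> s t (p i)) \<and>
      A t = udiag N V (\<lambda>i. of_real (s t (p i)))" for t
  proof -
    obtain V p where "unitary_mat N V" "p permutes {..<N}" "\<forall>i j. i \<le> j \<longrightarrow> j < N \<longrightarrow> s t (p j) \<le> s t (p i)"
      "real_udiag N (V0 t) (s t) = udiag N V (\<lambda>i. of_real (s t (p i)))"
      by (rule udiag_sorted[OF V0[of t], where d = "s t"])
    then show ?thesis using gram0[of t] unfolding A_def G_def by auto
  qed
  then obtain V \<pi> where V: "\<And>t. unitary_mat N (V t)" and \<pi>: "\<And>t. \<pi> t permutes {..<N}"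
    and s_sorted: "\<And>t. \<forall>i j. i \<le> j \<longrightarrow> j < N \<longrightarrow> s t (\<pi> t j) \<le> s t (\<pi> t i)"
    and A_udiag: "\<And>t. A t = udiag N (V t) (\<lambda>i. of_real (s t (\<pi> t i)))"
    by metis
  define \<sigma> where "\<sigma> t j = s t (\<pi> t j)" for t j
  have sorted: "\<sigma> t j \<le> \<sigma> t i" if "i \<le> j" "j < N" for t i j using s_sorted that by (simp add: \<sigma>_def)
  have gram: "adj (G t) * G t = real_udiag N (V t) (\<sigma> t)" for t
    using A_udiag by (simp add: A_def \<sigma>_def)
  define y where "y t j = ln (\<sigma> t j) / 2" for t j
  have \<Phi>y: "\<Phi> (\<lambda>j. ln (s t j) / 2) = \<Phi> (y t)" for t
    using sym[OF \<pi>[of t], of "\<lambda>j. ln (s t j) / 2"] by (simp add: y_def[abs_def] \<sigma>_def)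
  define L where "L = (\<Sum>(U, l)\<leftarrow>As. \<Sum>i<N. l i)"
  have detG: "det (cpow_prod N As z) = exp (z * of_real L)" for z
    unfolding L_def by (rule det_cpow_prod[OF As])
  have prod_\<sigma>: "(\<Prod>j<N. \<sigma> t j) = exp (2 * L)" and \<sigma>pos: "j < N \<Longrightarrow> 0 < \<sigma> t j" for t j
    using cpow_prod_gram_spectrum[OF As V gram[unfolded G_def]] by (auto simp: L_def)
  have \<sigma>nz: "\<sigma> t j \<noteq> 0" if "j < N" for t j using \<sigma>pos[OF that, of t] by simp
  have sum_y: "(\<Sum>j<N. y t j) = L" for t
  proof -
    have "(\<Sum>j<N. ln (\<sigma> t j)) = ln (\<Prod>j<N. \<sigma> t j)" using \<sigma>nz by (intro ln_prod[symmetric]) auto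
    then show ?thesis unfolding prod_\<sigma> by (simp add: y_def flip: sum_divide_distrib)
  qed
  have entries: "strip_entire (\<lambda>z. cpow_prod N As z $$ (i, j))" if "i < N" "j < N" for i j
    using strip_entire_cpow_prod[OF As that] .
  have A_index: "A t $$ (i, j) = (\<Sum>k<N. cnj (cpow_prod N As (Complex 1 t) $$ (k, i)) * cpow_prod N As (Complex 1 t) $$ (k, j))"
    if "i < N" "j < N" for t i j
    using that As unfolding A_def G_def by (subst mult_index) auto
  have contC: "continuous_on UNIV (\<lambda>t. Complex 1 t)"
  proof -
    have "(\<lambda>t. Complex 1 t) = (\<lambda>t. 1 + \<i> * of_real t)" by (auto simp: complex_eq_iff)
    then show ?thesis by (simp only:) (intro continuous_intros)
  qed
  have contG: "continuous_on UNIV (\<lambda>t. cpow_prod N As (Complex 1 t) $$ (i, j))" if "i < N" "j < N" for i j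
    using entries[OF that] contC
    by (intro continuous_on_compose2[OF holomorphic_on_imp_continuous_on contC, of _ UNIV]) (auto simp: strip_entire_def)
  have contA: "continuous_on UNIV (\<lambda>t. A t $$ (i, j))" if "i < N" "j < N" for i j
    by (simp only: A_index[OF that]) (intro continuous_intros contG; use that in simp)
  \<comment> \<open>The perturbation bound is used in both directions; its error
    \<open>\<delta> t u\<close> tends to 0 because the entries are continuous.\<close>
  have cont_\<sigma>: "continuous_on UNIV (\<lambda>t. \<sigma> t j)" if j: "j < N" for j
  proof -
    define \<delta> where "\<delta> t u = (\<Sum>a<N. \<Sum>b<N. cmod (A t $$ (a, b) - A u $$ (a, b)))" for t u
    have le: "\<sigma> t j \<le> \<sigma> u j + \<delta> t u" for t u
      unfolding \<delta>_def A_def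
      by (rule singular_value_perturbation[OF Gc Gc V V gram gram sorted sorted j])
    have sym\<delta>: "\<delta> u t = \<delta> t u" for t u by (simp add: \<delta>_def norm_minus_commute)
    have bound: "norm (\<sigma> t j - \<sigma> u j) \<le> \<delta> t u" for t u
      using le[of t u] le[of u t] sym\<delta>[of t u] by (simp add: abs_le_iff)
    have "((\<lambda>t. \<sigma> t j) \<longlongrightarrow> \<sigma> u j) (at u)" for u
    proof -
      have "continuous_on UNIV (\<lambda>t. \<delta> t u)"
        unfolding \<delta>_def by (intro continuous_intros contA) auto
      then have "((\<lambda>t. \<delta> t u) \<longlongrightarrow> \<delta> u u) (at u)" by (simp add: continuous_on_def)
      then have "((\<lambda>t. \<delta> t u) \<longlongrightarrow> 0) (at u)" by (simp add: \<delta>_def)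
      then have "((\<lambda>t. \<sigma> t j - \<sigma> u j) \<longlongrightarrow> 0) (at u)"
        by (rule Lim_null_comparison[OF always_eventually, rotated]) (use bound in blast)
      then show ?thesis by (simp add: LIM_zero_iff)
    qed
    then show ?thesis by (simp add: continuous_on_def)
  qed
  have cont_y: "continuous_on UNIV (\<lambda>t. y t j)" if "j < N" for j
    unfolding y_def using \<sigma>nz[OF that]
    by (intro continuous_intros cont_\<sigma>[OF that]) auto
  have "\<exists>K. \<forall>t. (\<Sum>i<N. \<Sum>j<N. cmod (A t $$ (i, j))) \<le> K"
  proof -
    have "\<exists>B. \<forall>t. cmod (cpow_prod N As (Complex 1 t) $$ (i, j)) \<le> B" if "i < N" "j < N" for i j
      using entries[OF that] unfolding strip_entire_def by force
    then obtain B where B: "\<And>i j t. i < N \<Longrightarrow> j < N \<Longrightarrow> cmod (cpow_prod N As (Complex 1 t) $$ (i, j)) \<le> B i j"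
      by metis
    have "cmod (A t $$ (i, j)) \<le> (\<Sum>k<N. B k i * B k j)" if "i < N" "j < N" for i j t
      unfolding A_index[OF that]
    proof (intro order_trans[OF norm_sum] sum_mono)
      fix k assume "k \<in> {..<N}"
      then have "cmod (cpow_prod N As (Complex 1 t) $$ (k, i)) * cmod (cpow_prod N As (Complex 1 t) $$ (k, j)) \<le> B k i * B k j"
        using B that by (intro mult_mono) (auto intro: order_trans[OF norm_ge_zero])
      then show "cmod (cnj (cpow_prod N As (Complex 1 t) $$ (k, i)) * cpow_prod N As (Complex 1 t) $$ (k, j)) \<le> B k i * B k j"
        by (simp add: norm_mult)
    qed
    then have "(\<Sum>i<N. \<Sum>j<N. cmod (A t $$ (i, j))) \<le> (\<Sum>i<N. \<Sum>j<N. \<Sum>k<N. B k i * B k j)" for t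
      by (intro sum_mono) auto
    then show ?thesis by blast
  qed
  then obtain K0 where K0: "\<And>t. (\<Sum>i<N. \<Sum>j<N. cmod (A t $$ (i, j))) \<le> K0" by blast
  \<comment> \<open>A uniform upper bound for \<open>y\<close>; the maximum with 1 keeps it
    nonnegative.\<close>
  define K1 where "K1 = ln (max 1 K0) / 2"
  have K1: "0 \<le> K1" by (simp add: K1_def)
  have y_upper: "y t j \<le> K1" if "j < N" for t j
  proof -
    have "\<sigma> t j \<le> K0"
      using gram_spectrum_bound[OF Gc V gram sorted that, of t] K0[of t] unfolding A_def by (rule order_trans)
    then show ?thesis using \<sigma>pos[OF that, of t] by (simp add: y_def K1_def)
  qed
  \<comment> \<open>The lower bound comes from the fixed total: \<open>y t j\<close> is
    \<open>L\<close> minus the other coordinates, each at most \<open>K1\<close>.\<close>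
  define K where "K = \<bar>L\<bar> + real N * K1"
  have y_bound: "\<bar>y t j\<bar> \<le> K" if j: "j < N" for t j
  proof -
    have "(\<Sum>i\<in>{..<N} - {j}. y t i) \<le> (\<Sum>i\<in>{..<N} - {j}. K1)" by (intro sum_mono y_upper) auto
    also have "\<dots> = real (N - 1) * K1" using j by simp
    also have "\<dots> \<le> real N * K1" using K1 by (intro mult_right_mono) auto
    finally have "L - y t j \<le> real N * K1"
      using sum_y[of t] j by (simp add: sum.remove[of "{..<N}" j])
    moreover have "K1 \<le> real N * K1" using j K1 mult_right_mono[of 1 "real N" K1] by simp
    ultimately show ?thesis using y_upper[OF j, of t] unfolding K_def by linarith
  qed
  have ib: "integrable lborel beta0" and i1: "(LINT t|lborel. beta0 t) = 1"
    using has_bochner_integral_beta0 by (auto simp: has_bochner_integral_iff)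
  have mb: "beta0 \<in> borel_measurable borel" using continuous_beta0 by (rule borel_measurable_continuous_onI)
  have integrable_beta: "integrable lborel (\<lambda>t. f t * beta0 t)"
    if f: "continuous_on UNIV f" and B: "\<And>t. \<bar>f t\<bar> \<le> B" for f B
  proof (rule Bochner_Integration.integrable_bound[OF integrable_mult_right[OF ib, of B]])
    show "(\<lambda>t. f t * beta0 t) \<in> borel_measurable lborel"
      using mb borel_measurable_continuous_onI[OF f] by simp
    show "AE t in lborel. norm (f t * beta0 t) \<le> norm (B * beta0 t)"
      using B beta0_nonneg by (auto simp: abs_mult intro!: mult_right_mono order_trans[OF _ abs_ge_self])
  qed
  obtain a where a: "\<And>z. (\<forall>j\<ge>N. z j = x j) \<Longrightarrow> \<Phi> x + (\<Sum>j<N. a j * (z j - x j)) \<le> \<Phi> z"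
    using convex_subgradient[of \<Phi> N x] conv by blast
  obtain p where p: "p permutes {..<N}" and b_sorted: "\<forall>i j. i \<le> j \<longrightarrow> j < N \<longrightarrow> a (p j) \<le> a (p i)"
    by (rule exists_sorting_permutation[where n = N and d = a])
  have plt: "p j < N" if "j < N" for j using permutes_in_image[OF p, of j] that by simp
  define E where "E = mat N N (\<lambda>(i, j). E0 $$ (i, p j))"
  have E: "unitary_mat N E" and HE: "log_sum N As = udiag N E (\<lambda>i. of_real (x (p i)))"
    unfolding E_def H using udiag_permute(1)[OF E0 p] udiag_permute(2)[OF E0 p, of "\<lambda>i. of_real (x i)"] by simp_all
  note E' = unitary_matD[OF E]
  define X where "X z = adj E * (cpow_prod N As z * E)" for z
  have Xc: "X z \<in> carrier_mat N N" for z using As E' by (simp add: X_def)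
  have X_index: "X z $$ (i, j) = (\<Sum>a<N. \<Sum>b<N. cnj (E $$ (a, i)) * (cpow_prod N As z $$ (a, b) * E $$ (b, j)))"
    if "i < N" "j < N" for z i j
    unfolding X_def mult3_index[OF E'(4) cpow_prod_carrier[OF As] E'(1) that]
    using that E' by (intro sum.cong) auto
  have X_entire: "strip_entire (\<lambda>z. X z $$ (i, j))" if "i < N" "j < N" for i j
    unfolding X_index[OF that] by (intro strip_entire_sum strip_entire_mult strip_entire_const entries) auto
  have X_deriv: "((\<lambda>z. X z $$ (i, j)) has_field_derivative (if i = j then of_real (x (p i)) else 0)) (at 0)"
    if ij: "i < N" "j < N" for i j
  proof -
    have "((\<lambda>z. X z $$ (i, j)) has_field_derivative
        (\<Sum>a<N. \<Sum>b<N. cnj (E $$ (a, i)) * (log_sum N As $$ (a, b) * E $$ (b, j)))) (at 0)"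
      unfolding X_index[OF ij] by (intro DERIV_sum DERIV_cmult DERIV_cmult_right cpow_prod_deriv As) auto
    also have "(\<Sum>a<N. \<Sum>b<N. cnj (E $$ (a, i)) * (log_sum N As $$ (a, b) * E $$ (b, j))) =
        (adj E * (log_sum N As * E)) $$ (i, j)"
      unfolding mult3_index[OF E'(4) log_sum_carrier[OF As] E'(1) ij]
      using ij E' by (intro sum.cong) auto
    also have "adj E * (log_sum N As * E) = mat_diag N (\<lambda>i. of_real (x (p i)))"
      unfolding HE using E' by (simp add: assoc_sq[where n = N] unitary_cancel[OF E] right_mult_one_mat[where nr = N and nc = N])
    also have "\<dots> $$ (i, j) = (if i = j then of_real (x (p i)) else 0)" using ij by (simp add: mat_diag_def)
    finally show ?thesis .
  qed
  have X0: "X 0 = 1\<^sub>m N" unfolding X_def using cpow_prod_0[OF As] E' by simp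
  define F where "F k z = det (mat k k (\<lambda>(i, j). X z $$ (i, j)))" for k z
  have F_deriv: "(F k has_field_derivative (\<Sum>i<k. of_real (x (p i)))) (at 0)" if "k \<le> N" for k
    using det_deriv_at_identity[of k "\<lambda>z i j. X z $$ (i, j)" "\<lambda>i j. if i = j then of_real (x (p i)) else 0"]
      X_deriv that by (simp add: F_def[abs_def] X0)
  have F0: "F k 0 = 1" if "k \<le> N" for k
  proof -
    have "mat k k (\<lambda>(i, j). X 0 $$ (i, j)) = 1\<^sub>m k" unfolding X0 by (rule eq_matI) (use that in auto)
    then show ?thesis by (simp add: F_def)
  qed
  \<comment> \<open>The full determinant has the trace of \<open>H\<close> as derivative at 0 and
    also equals \<open>exp (z * of_real L)\<close>.\<close>
  have total: "(\<Sum>j<N. x (p j)) = L"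
  proof -
    have "F N z = exp (z * of_real L)" for z
    proof -
      have "mat N N (\<lambda>(i, j). X z $$ (i, j)) = X z" by (rule eq_matI) (use Xc[of z] in auto)
      then have "F N z = det (adj E) * (det (cpow_prod N As z) * det E)"
        using E' As by (simp add: F_def X_def det_mult[where n = N])
      also have "\<dots> = det (adj E * E) * det (cpow_prod N As z)"
        using det_mult[OF E'(4,1)] by simp
      finally show ?thesis by (simp add: E' detG)
    qed
    then have "F N = (\<lambda>z. exp (z * of_real L))" by (rule ext)
    then have "(F N has_field_derivative of_real L) (at 0)"
      by (auto intro!: derivative_eq_intros)
    from DERIV_unique[OF F_deriv[OF order_refl] this] show ?thesis
      by (simp only: of_real_sum[symmetric] of_real_eq_iff)
  qed
  have partial: "(\<Sum>j<k. x (p j)) \<le> (LINT t|lborel. (\<Sum>j<k. y t j) * beta0 t)" if k: "k \<le> N" for k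
  proof -
    have "strip_entire (F k)"
      unfolding F_def[abs_def] by (intro strip_entire_det X_entire) (use k in auto)
    then obtain B where hol: "F k holomorphic_on UNIV"
      and B: "\<And>z. - 1 \<le> Re z \<Longrightarrow> Re z \<le> 2 \<Longrightarrow> cmod (F k z) \<le> B" by (auto simp: strip_entire_def)
    have "Re (deriv (F k) 0) \<le> (LINT t|lborel. (\<Sum>j<k. y t j) * beta0 t)"
    proof (rule strip_derivative_bound[OF hol B F0[OF k]])
      show "cmod (F k (Complex 0 t)) \<le> 1" for t
      proof -
        have U: "unitary_mat N (X (Complex 0 t))"
          unfolding X_def using unitary_mult[OF unitary_adj[OF E] unitary_mult[OF cpow_prod_unitary[OF As] E]] by simp
        have one: "unitary_mat N (1\<^sub>m N)" by (simp add: unitary_mat_def)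
        have "adj (X (Complex 0 t)) * X (Complex 0 t) = udiag N (1\<^sub>m N) (\<lambda>i. of_real 1)"
          using unitary_matD(3)[OF U] udiag_one[OF one] by simp
        from leading_minor_bound[OF Xc one this _ k]
        have "(cmod (F k (Complex 0 t)))^2 \<le> 1" by (simp add: F_def)
        then show ?thesis by (simp add: power_le_one_iff abs_square_le_1)
      qed
      show "cmod (F k (Complex 1 t)) \<le> exp (\<Sum>j<k. y t j)" for t
      proof -
        have W: "unitary_mat N (adj E * V t)" by (rule unitary_mult[OF unitary_adj[OF E] V])
        \<comment> \<open>Conjugation by the unitary \<open>E\<close> changes the eigenbasis of the
          Gram matrix but not its spectrum.\<close>
        have "adj (X (Complex 1 t)) * X (Complex 1 t) = adj E * (adj (G t) * G t * E)"
          using E' Gc[of t] unfolding X_def G_def[symmetric]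
          by (simp add: adj_mult[where n = N and k = N and m = N] assoc_sq[where n = N] unitary_cancel[OF E])
        also have "\<dots> = real_udiag N (adj E * V t) (\<sigma> t)"
          unfolding gram using E' unitary_matD[OF V[of t]]
          by (simp add: adj_mult[where n = N and k = N and m = N] assoc_sq[where n = N])
        finally have "(cmod (F k (Complex 1 t)))^2 \<le> (\<Prod>j<k. \<sigma> t j)"
          unfolding F_def by (rule leading_minor_bound[OF Xc W _ sorted k])
        also have "\<dots> = (\<Prod>j<k. exp (2 * y t j))" using \<sigma>pos k by (intro prod.cong) (auto simp: y_def)
        also have "\<dots> = exp (\<Sum>j<k. 2 * y t j)" by (simp add: exp_sum)
        also have "\<dots> = (exp (\<Sum>j<k. y t j))^2" unfolding sum_distrib_left[symmetric] by (rule exp_double)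
        finally show ?thesis by (rule power2_le_imp_le) simp
      qed
      show "continuous_on UNIV (\<lambda>t. \<Sum>j<k. y t j)" using k by (intro continuous_intros cont_y) auto
      show "\<bar>\<Sum>j<k. y t j\<bar> \<le> real k * K" for t
        using sum_bounded_above[of "{..<k}" "\<lambda>j. \<bar>y t j\<bar>" K] y_bound k
        by (intro order_trans[OF sum_abs]) auto
    qed
    also have "deriv (F k) 0 = (\<Sum>i<k. of_real (x (p i)))" by (rule DERIV_imp_deriv[OF F_deriv[OF k]])
    finally show ?thesis by simp
  qed
  have iy: "integrable lborel (\<lambda>t. y t j * beta0 t)" if "j < N" for j
    by (rule integrable_beta[OF cont_y[OF that] y_bound[OF that]])
  define Iy where "Iy j = (LINT t|lborel. y t j * beta0 t)" for j
  have I_sum: "(LINT t|lborel. (\<Sum>j<k. y t j) * beta0 t) = (\<Sum>j<k. Iy j)" if "k \<le> N" for k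
    unfolding Iy_def sum_distrib_right using iy that by (intro Bochner_Integration.integral_sum) auto
  have abel: "0 \<le> (\<Sum>j<N. a (p j) * (Iy j - x (p j)))"
  proof (rule Abel_sum_nonneg)
    show "0 \<le> (\<Sum>j<k. Iy j - x (p j))" if "k < N" for k
      using partial[of k] I_sum[of k] that by (simp add: sum_subtractf)
    have "(LINT t|lborel. (\<Sum>j<N. y t j) * beta0 t) = L" unfolding sum_y using i1 by simp
    then show "(\<Sum>j<N. Iy j - x (p j)) = 0" using I_sum[of N] total by (simp add: sum_subtractf)
  qed (use b_sorted in auto)
  have pointwise: "\<Phi> x + (\<Sum>j<N. a (p j) * (y t j - x (p j))) \<le> \<Phi> (y t)" for t
  proof -
    \<comment> \<open>Coordinate \<open>p j\<close> of \<open>z\<close> is \<open>y t j\<close>, so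
      the decreasing \<open>y t\<close> meets the decreasing weights \<open>a (p j)\<close>. From
      \<open>N\<close> on \<open>z\<close> agrees with \<open>x\<close>, as the subgradient
      inequality requires.\<close>
    define z where "z j = (if j < N then y t (Hilbert_Choice.inv p j) else x j)" for j
    have "\<Phi> x + (\<Sum>j<N. a j * (z j - x j)) \<le> \<Phi> z" by (rule a) (simp add: z_def)
    also have "\<Phi> z = \<Phi> (\<lambda>j. y t (Hilbert_Choice.inv p j))" by (rule cong) (simp add: z_def)
    also have "\<dots> = \<Phi> (y t)" by (rule sym[OF permutes_inv[OF p]])
    also have "(\<Sum>j<N. a j * (z j - x j)) = (\<Sum>j<N. a (p j) * (z (p j) - x (p j)))"
      by (rule sum.permute[OF p, unfolded comp_def])
    also have "\<dots> = (\<Sum>j<N. a (p j) * (y t j - x (p j)))"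
      using plt permutes_inverses(2)[OF p] by (intro sum.cong) (auto simp: z_def)
    finally show ?thesis .
  qed
  obtain B where B: "\<And>t. \<bar>\<Phi> (y t)\<bar> \<le> B" using bdd[of K] y_bound by blast
  have i\<Phi>: "integrable lborel (\<lambda>t. \<Phi> (y t) * beta0 t)"
    by (rule integrable_beta[OF cont[OF cont_y] B])
  have ij: "integrable lborel (\<lambda>t. a (p j) * (y t j * beta0 t - x (p j) * beta0 t))" if "j < N" for j
    using iy[OF that] ib by simp
  have eq: "(\<Phi> x + (\<Sum>j<N. a (p j) * (y t j - x (p j)))) * beta0 t =
      \<Phi> x * beta0 t + (\<Sum>j<N. a (p j) * (y t j * beta0 t - x (p j) * beta0 t))" for t
    by (simp add: distrib_right sum_distrib_right left_diff_distrib mult.assoc)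
  have il: "integrable lborel (\<lambda>t. (\<Phi> x + (\<Sum>j<N. a (p j) * (y t j - x (p j)))) * beta0 t)"
    unfolding eq
    by (intro Bochner_Integration.integrable_add integrable_mult_right ib Bochner_Integration.integrable_sum ij) auto
  \<comment> \<open>Since \<open>beta0\<close> has mass 1, integrating the affine lower bound
    replaces each \<open>y t j\<close> by its mean \<open>Iy j\<close>.\<close>
  have "\<Phi> x \<le> \<Phi> x + (\<Sum>j<N. a (p j) * (Iy j - x (p j)))" using abel by simp
  also have "\<dots> = (LINT t|lborel. (\<Phi> x + (\<Sum>j<N. a (p j) * (y t j - x (p j)))) * beta0 t)"
  proof -
    have "(LINT t|lborel. (\<Sum>j<N. a (p j) * (y t j * beta0 t - x (p j) * beta0 t))) =
        (\<Sum>j<N. LINT t|lborel. a (p j) * (y t j * beta0 t - x (p j) * beta0 t))"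
      by (rule Bochner_Integration.integral_sum) (use ij in auto)
    also have "\<dots> = (\<Sum>j<N. a (p j) * (Iy j - x (p j)))"
      using iy ib i1 by (intro sum.cong) (auto simp: Iy_def)
    finally have "(LINT t|lborel. (\<Sum>j<N. a (p j) * (y t j * beta0 t - x (p j) * beta0 t))) = (\<Sum>j<N. a (p j) * (Iy j - x (p j)))" .
    moreover have "integrable lborel (\<lambda>t. \<Sum>j<N. a (p j) * (y t j * beta0 t - x (p j) * beta0 t))"
      by (intro Bochner_Integration.integrable_sum ij) auto
    ultimately show ?thesis unfolding eq using ib i1 by simp
  qed
  also have "\<dots> \<le> (LINT t|lborel. \<Phi> (y t) * beta0 t)"
    by (rule integral_mono[OF il i\<Phi>]) (use pointwise beta0_nonneg in \<open>auto intro!: mult_right_mono\<close>)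
  finally show ?thesis by (simp only: \<Phi>y)
qed

section \<open>Symmetric gauge functions\<close>

locale gauge =
  fixes N :: nat and \<rho> :: "real list \<Rightarrow> real"
  assumes symmetric_gauge: "symmetric_gauge N \<rho>"
begin

lemma gauge_zero: "length xs = N \<Longrightarrow> \<rho> xs = 0 \<longleftrightarrow> (\<forall>a\<in>set xs. a = 0)"
  and gauge_scale: "length xs = N \<Longrightarrow> \<rho> (map (\<lambda>a. c * a) xs) = \<bar>c\<bar> * \<rho> xs"
  and gauge_triangle: "length xs = N \<Longrightarrow> length ys = N \<Longrightarrow> \<rho> (map2 (+) xs ys) \<le> \<rho> xs + \<rho> ys"
  and gauge_mset: "length xs = N \<Longrightarrow> mset xs = mset ys \<Longrightarrow> \<rho> xs = \<rho> ys"
  and gauge_abs: "length xs = N \<Longrightarrow> \<rho> (map abs xs) = \<rho> xs"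
  using symmetric_gauge unfolding symmetric_gauge_def by blast+

definition R :: "(nat \<Rightarrow> real) \<Rightarrow> real" where "R y = \<rho> (map y [0..<N])"

lemma R_cong: "(\<And>j. j < N \<Longrightarrow> y j = z j) \<Longrightarrow> R y = R z"
  unfolding R_def by (rule arg_cong[of _ _ \<rho>]) simp

lemma R_scale: "R (\<lambda>j. c * y j) = \<bar>c\<bar> * R y"
  using gauge_scale[of "map y [0..<N]" c] by (simp add: R_def comp_def)

lemma R_triangle: "R (\<lambda>j. y j + z j) \<le> R y + R z"
proof -
  have "map2 (+) (map y [0..<N]) (map z [0..<N]) = map (\<lambda>j. y j + z j) [0..<N]"
    by (simp add: list_eq_iff_nth_eq)
  then show ?thesis using gauge_triangle[of "map y [0..<N]" "map z [0..<N]"] by (simp add: R_def)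
qed

lemma R_abs: "R (\<lambda>j. \<bar>y j\<bar>) = R y"
  using gauge_abs[of "map y [0..<N]"] by (simp add: R_def comp_def)

text \<open>This discards the descending order in which \<open>ui_norm\<close> hands the singular
  values to \<open>\<rho>\<close>.\<close>

lemma R_mset:
  assumes "mset xs = image_mset y (mset_set {..<N})"
  shows "\<rho> xs = R y"
proof -
  have "mset xs = mset (map y [0..<N])" using assms by (simp add: lessThan_atLeast0)
  then show ?thesis unfolding R_def by (intro gauge_mset[symmetric]) simp_all
qed

lemma R_permute:
  assumes "p permutes {..<N}"
  shows "R (\<lambda>j. y (p j)) = R y"
proof -
  have "image_mset p (mset_set {..<N}) = mset_set {..<N}"
    using assms by (simp add: image_mset_mset_set permutes_inj_on permutes_image)
  then have "image_mset (\<lambda>j. y (p j)) (mset_set {..<N}) = image_mset y (mset_set {..<N})"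
    using image_mset.compositionality[of y p "mset_set {..<N}"] by (simp add: comp_def)
  then show ?thesis unfolding R_def[of "\<lambda>j. y (p j)"] by (intro R_mset) (simp add: lessThan_atLeast0)
qed

lemma R_zero_iff: "R y = 0 \<longleftrightarrow> (\<forall>j<N. y j = 0)"
  using gauge_zero[of "map y [0..<N]"] by (auto simp: R_def)

lemma R_nonneg: "0 \<le> R y"
proof -
  have "0 = R (\<lambda>j. y j + - 1 * y j)" by (simp add: R_zero_iff)
  also have "\<dots> \<le> R y + R (\<lambda>j. - 1 * y j)" by (rule R_triangle)
  also have "R (\<lambda>j. - 1 * y j) = R y" unfolding R_scale by simp
  finally show ?thesis by simp
qed

lemma R_convex: "0 \<le> u \<Longrightarrow> u \<le> 1 \<Longrightarrow> R (\<lambda>j. (1 - u) * y j + u * z j) \<le> (1 - u) * R y + u * R z"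
  using R_triangle[of "\<lambda>j. (1 - u) * y j" "\<lambda>j. u * z j"] by (simp add: R_scale)

text \<open>Shrinking one coordinate of \<open>w\<close> is a convex combination of \<open>w\<close> and its reflection in
  that coordinate, and the two have the same gauge.\<close>

lemma R_update_mono:
  assumes "0 \<le> a" "a \<le> w k"
  shows "R (w(k := a)) \<le> R w"
proof (cases "w k = 0")
  case True
  then have "w(k := a) = w" using assms by auto
  then show ?thesis by simp
next
  case False
  \<comment> \<open>The solution of \<open>(1 - 2 * u) * w k = a\<close>.\<close>
  define u where "u = (1 - a / w k) / 2"
  have u: "0 \<le> u" "u \<le> 1" using assms False by (auto simp: u_def field_simps)
  have "R (w(k := a)) = R (\<lambda>j. (1 - u) * w j + u * (w(k := - w k)) j)"
    using False by (intro R_cong) (auto simp: u_def field_simps)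
  also have "\<dots> \<le> (1 - u) * R w + u * R (w(k := - w k))" by (rule R_convex[OF u])
  also have "R (w(k := - w k)) = R w"
    using R_abs[of w] R_abs[of "w(k := - w k)"] R_cong[of "\<lambda>j. \<bar>w j\<bar>" "\<lambda>j. \<bar>(w(k := - w k)) j\<bar>"] by auto
  also have "(1 - u) * R w + u * R w = R w" by (simp add: algebra_simps)
  finally show ?thesis .
qed

text \<open>Coordinates are lowered one at a time; \<open>w k\<close> is the vector after
  \<open>k\<close> replacements.\<close>

lemma R_mono:
  assumes "\<And>j. j < N \<Longrightarrow> 0 \<le> y j" "\<And>j. j < N \<Longrightarrow> y j \<le> z j"
  shows "R y \<le> R z"
proof -
  define w where "w k j = (if j < k then y j else z j)" for k j
  have "R (w k) \<le> R z" if "k \<le> N" for k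
    using that
  proof (induction k)
    case 0
    then show ?case by (simp add: w_def[abs_def])
  next
    case (Suc k)
    have "w (Suc k) = (w k)(k := y k)" by (auto simp: w_def fun_eq_iff less_Suc_eq)
    then have "R (w (Suc k)) \<le> R (w k)" using R_update_mono[of "y k" "w k" k] assms[of k] Suc by (simp add: w_def)
    then show ?case using Suc by simp
  qed
  from this[of N] show ?thesis using R_cong[of "w N" y] by (simp add: w_def)
qed

text \<open>Each coordinate difference is at most the sum of all of them, so monotonicity compares
  the difference vector with a constant one.\<close>

lemma R_abs_diff_le: "\<bar>R y - R z\<bar> \<le> (\<Sum>j<N. \<bar>y j - z j\<bar>) * R (\<lambda>_. 1)"
proof -
  have *: "R y - R z \<le> (\<Sum>j<N. \<bar>y j - z j\<bar>) * R (\<lambda>_. 1)" for y z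
  proof -
    have "R y \<le> R (\<lambda>j. y j - z j) + R z" using R_triangle[of "\<lambda>j. y j - z j" z] by simp
    moreover have "R (\<lambda>j. y j - z j) = R (\<lambda>j. \<bar>y j - z j\<bar>)" by (rule R_abs[symmetric])
    moreover have "\<dots> \<le> R (\<lambda>_. (\<Sum>j<N. \<bar>y j - z j\<bar>) * 1)"
      by (intro R_mono) (auto intro: member_le_sum)
    moreover have "\<dots> = (\<Sum>j<N. \<bar>y j - z j\<bar>) * R (\<lambda>_. 1)" unfolding R_scale by (simp add: sum_nonneg)
    ultimately show ?thesis by linarith
  qed
  have "(\<Sum>j<N. \<bar>z j - y j\<bar>) = (\<Sum>j<N. \<bar>y j - z j\<bar>)" by (simp add: abs_minus_commute)
  then show ?thesis using *[of y z] *[of z y] by (simp add: abs_le_iff)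
qed

lemma continuous_R:
  fixes Y :: "real \<Rightarrow> nat \<Rightarrow> real"
  assumes "\<And>j. j < N \<Longrightarrow> continuous_on UNIV (\<lambda>t. Y t j)"
  shows "continuous_on UNIV (\<lambda>t. R (Y t))"
  unfolding continuous_on_def
proof
  fix u :: real
  have "continuous_on UNIV (\<lambda>t. (\<Sum>j<N. \<bar>Y t j - Y u j\<bar>) * R (\<lambda>_. 1))"
    using assms by (intro continuous_intros) auto
  then have "((\<lambda>t. (\<Sum>j<N. \<bar>Y t j - Y u j\<bar>) * R (\<lambda>_. 1)) \<longlongrightarrow> (\<Sum>j<N. \<bar>Y u j - Y u j\<bar>) * R (\<lambda>_. 1)) (at u)"
    unfolding continuous_on_def by blast
  then have "((\<lambda>t. (\<Sum>j<N. \<bar>Y t j - Y u j\<bar>) * R (\<lambda>_. 1)) \<longlongrightarrow> 0) (at u)" by simp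
  then have "((\<lambda>t. R (Y t) - R (Y u)) \<longlongrightarrow> 0) (at u)"
    by (rule Lim_null_comparison[rotated]) (simp add: R_abs_diff_le)
  then show "((\<lambda>t. R (Y t)) \<longlongrightarrow> R (Y u)) (at u)" by (simp add: LIM_zero_iff)
qed

lemma continuous_bounded_interval:
  fixes \<phi> :: "real \<Rightarrow> real"
  assumes "continuous_on UNIV \<phi>"
  shows "\<exists>C. \<forall>x. \<bar>x\<bar> \<le> K \<longrightarrow> \<bar>\<phi> x\<bar> \<le> C"
proof -
  have "bounded (\<phi> ` {- K..K})"
    by (intro compact_imp_bounded compact_continuous_image continuous_on_subset[OF assms]) auto
  then obtain C where "\<forall>x\<in>{- K..K}. norm (\<phi> x) \<le> C" by (auto simp: bounded_iff)
  then have "\<bar>\<phi> x\<bar> \<le> C" if "\<bar>x\<bar> \<le> K" for x using that by (auto simp: abs_le_iff)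
  then show ?thesis by blast
qed

lemma R_compose_convex:
  assumes \<phi>: "convex_on UNIV \<phi>" "\<And>x. 0 \<le> \<phi> x" and u: "0 \<le> u" "u \<le> 1"
  shows "R (\<lambda>j. \<phi> ((1 - u) * y j + u * z j)) \<le> (1 - u) * R (\<lambda>j. \<phi> (y j)) + u * R (\<lambda>j. \<phi> (z j))"
proof -
  have "R (\<lambda>j. \<phi> ((1 - u) * y j + u * z j)) \<le> R (\<lambda>j. (1 - u) * \<phi> (y j) + u * \<phi> (z j))"
    using convex_onD[OF \<phi>(1) u] \<phi>(2) by (intro R_mono) auto
  also have "\<dots> \<le> (1 - u) * R (\<lambda>j. \<phi> (y j)) + u * R (\<lambda>j. \<phi> (z j))" by (rule R_convex[OF u])
  finally show ?thesis .
qed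

lemma R_compose_bounded:
  fixes \<phi> :: "real \<Rightarrow> real"
  assumes "continuous_on UNIV \<phi>"
  shows "\<exists>B. \<forall>y. (\<forall>j<N. \<bar>y j\<bar> \<le> K) \<longrightarrow> \<bar>R (\<lambda>j. \<phi> (y j))\<bar> \<le> B"
proof -
  obtain C where C: "\<forall>x. \<bar>x\<bar> \<le> K \<longrightarrow> \<bar>\<phi> x\<bar> \<le> C" using continuous_bounded_interval[OF assms] ..
  have "\<bar>R (\<lambda>j. \<phi> (y j))\<bar> \<le> R (\<lambda>_. C)" if "\<forall>j<N. \<bar>y j\<bar> \<le> K" for y
  proof -
    have "R (\<lambda>j. \<bar>\<phi> (y j)\<bar>) \<le> R (\<lambda>_. C)" using C that by (intro R_mono) auto
    then show ?thesis using R_nonneg[of "\<lambda>j. \<phi> (y j)"] by (simp add: R_abs)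
  qed
  then show ?thesis by blast
qed

lemma R_pos:
  assumes "0 < N" "\<And>j. j < N \<Longrightarrow> 0 < y j"
  shows "0 < R y"
proof -
  have "y 0 \<noteq> 0" using assms(2)[OF assms(1)] by simp
  then have "R y \<noteq> 0" unfolding R_zero_iff using assms(1) by blast
  then show ?thesis using R_nonneg[of y] by simp
qed

text \<open>Normalising both vectors, weighted AM--GM bounds the geometric mean entrywise.\<close>

lemma ln_R_exp_convex:
  assumes N: "0 < N" and \<psi>: "convex_on UNIV \<psi>" and u: "0 \<le> u" "u \<le> 1"
  shows "ln (R (\<lambda>j. exp (\<psi> ((1 - u) * y j + u * z j)))) \<le>
    (1 - u) * ln (R (\<lambda>j. exp (\<psi> (y j)))) + u * ln (R (\<lambda>j. exp (\<psi> (z j))))"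
proof -
  define a where "a = R (\<lambda>j. exp (\<psi> (y j)))"
  define b where "b = R (\<lambda>j. exp (\<psi> (z j)))"
  have ab: "0 < a" "0 < b" unfolding a_def b_def by (intro R_pos N; simp)+
  \<comment> \<open>The weighted geometric mean of the two gauges \<open>a\<close> and
    \<open>b\<close>.\<close>
  define c where "c = exp ((1 - u) * ln a + u * ln b)"
  have "exp (\<psi> ((1 - u) * y j + u * z j)) \<le> c * ((1 - u) * (exp (\<psi> (y j)) / a) + u * (exp (\<psi> (z j)) / b))" for j
  proof -
    have "exp (\<psi> ((1 - u) * y j + u * z j)) \<le> exp ((1 - u) * \<psi> (y j) + u * \<psi> (z j))"
      using convex_onD[OF \<psi> u, of "y j" "z j"] by simp
    also have "\<dots> = c * exp ((1 - u) * (\<psi> (y j) - ln a) + u * (\<psi> (z j) - ln b))"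
      by (simp add: c_def algebra_simps flip: exp_add)
    also have "\<dots> \<le> c * ((1 - u) * exp (\<psi> (y j) - ln a) + u * exp (\<psi> (z j) - ln b))"
      using convex_onD[OF exp_convex u, of "\<psi> (y j) - ln a" "\<psi> (z j) - ln b"]
      by (intro mult_left_mono) (auto simp: c_def)
    finally show ?thesis using ab by (simp add: exp_diff)
  qed
  then have "R (\<lambda>j. exp (\<psi> ((1 - u) * y j + u * z j)))
      \<le> R (\<lambda>j. c * ((1 - u) * (exp (\<psi> (y j)) / a) + u * (exp (\<psi> (z j)) / b)))"
    by (intro R_mono) auto
  also have "\<dots> = c * R (\<lambda>j. (1 - u) * (exp (\<psi> (y j)) / a) + u * (exp (\<psi> (z j)) / b))"
    unfolding R_scale by (simp add: c_def)
  also have "\<dots> \<le> c * ((1 - u) * R (\<lambda>j. exp (\<psi> (y j)) / a) + u * R (\<lambda>j. exp (\<psi> (z j)) / b))"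
    by (intro mult_left_mono R_convex u) (simp add: c_def)
  also have "R (\<lambda>j. exp (\<psi> (y j)) / a) = 1"
    using R_scale[of "1 / a" "\<lambda>j. exp (\<psi> (y j))"] ab by (simp add: a_def[symmetric])
  also have "R (\<lambda>j. exp (\<psi> (z j)) / b) = 1"
    using R_scale[of "1 / b" "\<lambda>j. exp (\<psi> (z j))"] ab by (simp add: b_def[symmetric])
  finally have le: "R (\<lambda>j. exp (\<psi> ((1 - u) * y j + u * z j))) \<le> c" by simp
  have pos: "0 < R (\<lambda>j. exp (\<psi> ((1 - u) * y j + u * z j)))" by (intro R_pos N) simp
  have "0 < c" by (simp add: c_def)
  then have "ln (R (\<lambda>j. exp (\<psi> ((1 - u) * y j + u * z j)))) \<le> ln c"
    using le pos by (subst ln_le_cancel_iff) auto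
  then show ?thesis by (simp add: c_def a_def b_def)
qed

text \<open>The logarithm demands a positive lower bound as well, so \<open>R\<close> is squeezed
  between \<open>exp (- C)\<close> and \<open>exp C\<close> times its value on the all-one
  vector.\<close>

lemma ln_R_exp_bounded:
  fixes \<psi> :: "real \<Rightarrow> real"
  assumes N: "0 < N" and \<psi>: "continuous_on UNIV \<psi>"
  shows "\<exists>B. \<forall>y. (\<forall>j<N. \<bar>y j\<bar> \<le> K) \<longrightarrow> \<bar>ln (R (\<lambda>j. exp (\<psi> (y j))))\<bar> \<le> B"
proof -
  obtain C where C: "\<forall>x. \<bar>x\<bar> \<le> K \<longrightarrow> \<bar>\<psi> x\<bar> \<le> C" using continuous_bounded_interval[OF \<psi>] ..
  define r where "r = R (\<lambda>_. 1)"
  have r: "0 < r" unfolding r_def by (intro R_pos N) simp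
  have "\<bar>ln (R (\<lambda>j. exp (\<psi> (y j))))\<bar> \<le> C + \<bar>ln r\<bar>" if y: "\<forall>j<N. \<bar>y j\<bar> \<le> K" for y
  proof -
    have pos: "0 < R (\<lambda>j. exp (\<psi> (y j)))" by (intro R_pos N) simp
    have 1: "\<psi> (y j) \<le> C" "- C \<le> \<psi> (y j)" if "j < N" for j
    proof -
      have "\<bar>\<psi> (y j)\<bar> \<le> C" using C y that by blast
      then show "\<psi> (y j) \<le> C" "- C \<le> \<psi> (y j)" by (auto simp: abs_le_iff)
    qed
    have "R (\<lambda>j. exp (\<psi> (y j))) \<le> R (\<lambda>_. exp C * 1)" using 1 by (intro R_mono) auto
    then have up: "R (\<lambda>j. exp (\<psi> (y j))) \<le> exp C * r" unfolding R_scale r_def by simp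
    have "R (\<lambda>_. exp (- C) * 1) \<le> R (\<lambda>j. exp (\<psi> (y j)))" using 1 by (intro R_mono) auto
    then have low: "exp (- C) * r \<le> R (\<lambda>j. exp (\<psi> (y j)))" unfolding R_scale r_def by simp
    have "ln (R (\<lambda>j. exp (\<psi> (y j)))) \<le> ln (exp C * r)"
      using up pos r by (subst ln_le_cancel_iff) auto
    moreover have "ln (exp (- C) * r) \<le> ln (R (\<lambda>j. exp (\<psi> (y j))))"
      using low pos r by (subst ln_le_cancel_iff) auto
    ultimately show ?thesis using r by (simp add: ln_mult)
  qed
  then show ?thesis by blast
qed

end

section \<open>Block-diagonal matrices and Fourier blocks\<close>

text \<open>With the Fourier blocks for \<open>B\<close> this is \<open>bcirc\<close> after
  conjugation by \<open>F_p \<otimes> I\<close>. Working with it directly means that the DFT matrix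
  is never formed.\<close>

definition bdiag :: "nat \<Rightarrow> nat \<Rightarrow> (nat \<Rightarrow> complex mat) \<Rightarrow> complex mat" where
  "bdiag p m B = mat (m * p) (m * p) (\<lambda>(r, c). if r div m = c div m then B (r div m) $$ (r mod m, c mod m) else 0)"

lemma bdiag_carrier [simp]: "bdiag p m B \<in> carrier_mat (m * p) (m * p)"
  and bdiag_dims [simp]: "dim_row (bdiag p m B) = m * p" "dim_col (bdiag p m B) = m * p"
  by (simp_all add: bdiag_def)

lemma block_position:
  fixes r m p :: nat
  assumes "r < m * p"
  shows "r div m < p" "r mod m < m"
  using assms by (auto simp: less_mult_imp_div_less mult.commute intro!: mod_less_divisor) (cases m; simp)

lemma block_index:
  fixes j r m p :: nat
  assumes "j < p" "r < m"
  shows "j * m + r < m * p" "(j * m + r) div m = j" "(j * m + r) mod m = r"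
proof -
  have "j * m + r < Suc j * m" using assms by simp
  also have "\<dots> \<le> p * m" using assms by (intro mult_le_mono1) simp
  finally show "j * m + r < m * p" by (simp add: mult.commute)
qed (use assms in simp_all)

lemma sum_blocks:
  fixes f :: "nat \<Rightarrow> 'a :: comm_monoid_add"
  shows "(\<Sum>j<m * p. f j) = (\<Sum>k<p. \<Sum>i<m. f (i + k * m))"
  unfolding mult.commute[of m p] by (rule sum_mult_product)

lemma bdiag_index:
  "r < m * p \<Longrightarrow> c < m * p \<Longrightarrow>
    bdiag p m B $$ (r, c) = (if r div m = c div m then B (r div m) $$ (r mod m, c mod m) else 0)"
  by (simp add: bdiag_def)

lemma bdiag_cong: "(\<And>k. k < p \<Longrightarrow> B k = C k) \<Longrightarrow> bdiag p m B = bdiag p m C"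
  by (rule eq_matI) (auto simp: bdiag_index block_position)

lemma bdiag_mult:
  assumes "\<And>k. k < p \<Longrightarrow> B k \<in> carrier_mat m m" "\<And>k. k < p \<Longrightarrow> C k \<in> carrier_mat m m"
  shows "bdiag p m B * bdiag p m C = bdiag p m (\<lambda>k. B k * C k)"
proof (rule eq_matI)
  fix r c assume "r < dim_row (bdiag p m (\<lambda>k. B k * C k))" "c < dim_col (bdiag p m (\<lambda>k. B k * C k))"
  then have rc: "r < m * p" "c < m * p" by auto
  note pos = block_position[OF rc(1)] block_position[OF rc(2)]
  have lt: "i + k * m < m * p" if "i < m" "k < p" for i k
    using block_index(1)[OF that(2,1)] by (simp only: add.commute)
  have "(bdiag p m B * bdiag p m C) $$ (r, c) = (\<Sum>j<m * p. bdiag p m B $$ (r, j) * bdiag p m C $$ (j, c))"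
    using rc by (subst mult_index) auto
  also have "\<dots> = (\<Sum>k<p. \<Sum>i<m. bdiag p m B $$ (r, i + k * m) * bdiag p m C $$ (i + k * m, c))"
    by (rule sum_blocks)
  also have "\<dots> = (\<Sum>k<p. if k = r div m then
      (if r div m = c div m then (B (r div m) * C (r div m)) $$ (r mod m, c mod m) else 0) else 0)"
  proof (rule sum.cong[OF refl])
    fix k assume k: "k \<in> {..<p}"
    have "(\<Sum>i<m. bdiag p m B $$ (r, i + k * m) * bdiag p m C $$ (i + k * m, c)) =
        (\<Sum>i<m. (if r div m = k then B k $$ (r mod m, i) else 0) * (if k = c div m then C k $$ (i, c mod m) else 0))"
      using k rc lt by (intro sum.cong) (auto simp: bdiag_index)
    also have "\<dots> = (if k = r div m then
        (if r div m = c div m then (B (r div m) * C (r div m)) $$ (r mod m, c mod m) else 0) else 0)"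
      using pos assms[of k] k by (auto simp: mult_index simp del: index_mult_mat(1))
    finally show "(\<Sum>i<m. bdiag p m B $$ (r, i + k * m) * bdiag p m C $$ (i + k * m, c)) = \<dots>" .
  qed
  also have "\<dots> = bdiag p m (\<lambda>k. B k * C k) $$ (r, c)" using pos rc by (simp add: bdiag_index)
  finally show "(bdiag p m B * bdiag p m C) $$ (r, c) = bdiag p m (\<lambda>k. B k * C k) $$ (r, c)" .
qed auto

lemma bdiag_adj:
  assumes "\<And>k. k < p \<Longrightarrow> B k \<in> carrier_mat m m"
  shows "adj (bdiag p m B) = bdiag p m (\<lambda>k. adj (B k))"
proof (rule eq_matI)
  fix r c assume "r < dim_row (bdiag p m (\<lambda>k. adj (B k)))" "c < dim_col (bdiag p m (\<lambda>k. adj (B k)))"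
  then have rc: "r < m * p" "c < m * p" by auto
  then show "adj (bdiag p m B) $$ (r, c) = bdiag p m (\<lambda>k. adj (B k)) $$ (r, c)"
    using assms[of "r div m"] block_position[OF rc(1)] block_position[OF rc(2)] by (auto simp: bdiag_index)
qed auto

lemma bdiag_add:
  assumes "\<And>k. k < p \<Longrightarrow> B k \<in> carrier_mat m m" "\<And>k. k < p \<Longrightarrow> C k \<in> carrier_mat m m"
  shows "bdiag p m B + bdiag p m C = bdiag p m (\<lambda>k. B k + C k)"
proof (rule eq_matI)
  fix r c assume "r < dim_row (bdiag p m (\<lambda>k. B k + C k))" "c < dim_col (bdiag p m (\<lambda>k. B k + C k))"
  then have rc: "r < m * p" "c < m * p" by auto
  then show "(bdiag p m B + bdiag p m C) $$ (r, c) = bdiag p m (\<lambda>k. B k + C k) $$ (r, c)"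
    using assms[of "r div m"] block_position[OF rc(1)] block_position[OF rc(2)] by (auto simp: bdiag_index)
qed auto

lemma bdiag_diag: "bdiag p m (\<lambda>k. mat_diag m (d k)) = mat_diag (m * p) (\<lambda>i. d (i div m) (i mod m))"
proof (rule eq_matI)
  fix r c
  assume "r < dim_row (mat_diag (m * p) (\<lambda>i. d (i div m) (i mod m)))"
    "c < dim_col (mat_diag (m * p) (\<lambda>i. d (i div m) (i mod m)))"
  then have rc: "r < m * p" "c < m * p" by auto
  have "r = c" if "r div m = c div m" "r mod m = c mod m" using that by (metis div_mult_mod_eq)
  then show "bdiag p m (\<lambda>k. mat_diag m (d k)) $$ (r, c) = mat_diag (m * p) (\<lambda>i. d (i div m) (i mod m)) $$ (r, c)"
    using block_position[OF rc(1)] block_position[OF rc(2)] rc by (auto simp: bdiag_index mat_diag_def)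
qed auto

lemma bdiag_unitary:
  assumes "\<And>k. k < p \<Longrightarrow> unitary_mat m (U k)"
  shows "unitary_mat (m * p) (bdiag p m U)"
proof -
  have "bdiag p m U * adj (bdiag p m U) = bdiag p m (\<lambda>k. U k * adj (U k))"
    using unitary_matD[OF assms] by (simp add: bdiag_adj bdiag_mult)
  also have "\<dots> = bdiag p m (\<lambda>k. mat_diag m (\<lambda>_. 1))" using unitary_matD[OF assms] by (intro bdiag_cong) simp
  also have "\<dots> = 1\<^sub>m (m * p)" unfolding bdiag_diag by simp
  finally show ?thesis by (simp add: unitary_mat_def)
qed

lemma bdiag_udiag:
  assumes "\<And>k. k < p \<Longrightarrow> unitary_mat m (U k)"
  shows "bdiag p m (\<lambda>k. udiag m (U k) (d k)) = udiag (m * p) (bdiag p m U) (\<lambda>i. d (i div m) (i mod m))"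
proof -
  note U = unitary_matD[OF assms]
  have "udiag (m * p) (bdiag p m U) (\<lambda>i. d (i div m) (i mod m)) =
      bdiag p m U * bdiag p m (\<lambda>k. mat_diag m (d k)) * bdiag p m (\<lambda>k. adj (U k))"
    using U by (simp add: bdiag_adj bdiag_diag)
  also have "\<dots> = bdiag p m (\<lambda>k. udiag m (U k) (d k))"
    using U by (simp add: bdiag_mult)
  finally show ?thesis by simp
qed

section \<open>Spectra and functional calculus of diagonalised matrices\<close>

lemma sum_single_mset: "finite A \<Longrightarrow> (\<Sum>x\<in>A. {#f x#}) = image_mset f (mset_set A)"
  by (induction A rule: finite_induct) auto

lemma mat_eigenvalues_udiag:
  assumes U: "unitary_mat n U"
  shows "mat_eigenvalues (udiag n U d) = image_mset d (mset_set {..<n})"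
proof -
  note U' = unitary_matD[OF U]
  have "similar_mat_wit (udiag n U d) (mat_diag n d) U (adj U)"
    by (rule similar_mat_witI[where n = n]) (use U' in auto)
  then have "char_poly (udiag n U d) = char_poly (mat_diag n d)"
    by (intro char_poly_similar) (auto simp: similar_mat_def)
  also have "\<dots> = (\<Prod>a\<leftarrow>diag_mat (mat_diag n d). [:- a, 1:])"
    by (rule char_poly_upper_triangular[where n = n]) (auto simp: mat_diag_def)
  also have "diag_mat (mat_diag n d) = map d [0..<n]" by (auto simp: diag_mat_def mat_diag_def)
  also have "(\<Prod>a\<leftarrow>map d [0..<n]. [:- a, 1:]) = (\<Prod>i<n. [:- d i, 1:])"
    by (simp add: comp_def prod.distinct_set_conv_list[symmetric] lessThan_atLeast0)
  finally have "mat_eigenvalues (udiag n U d) = (\<Sum>i<n. proots [:- d i, 1:])"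
    unfolding mat_eigenvalues_def by (simp add: proots_prod)
  also have "\<dots> = (\<Sum>i<n. {#d i#})" by (intro sum.cong) simp_all
  finally show ?thesis by (simp add: sum_single_mset)
qed

lemma mat_singular_values_udiag:
  assumes U: "unitary_mat n U"
  shows "mat_singular_values (real_udiag n U v) = image_mset (\<lambda>i. \<bar>v i\<bar>) (mset_set {..<n})"
proof -
  have "adj (real_udiag n U v) * real_udiag n U v =
      udiag n U (\<lambda>i. of_real (v i * v i))"
    using unitary_matD[OF U] by (simp add: udiag_adj udiag_mult[OF U])
  then show ?thesis
    unfolding mat_singular_values_def
    by (simp add: mat_eigenvalues_udiag[OF U] image_mset.compositionality comp_def del: of_real_mult)
qed

text \<open>\<open>mat_fun\<close> selects some diagonalisation, so independence of the selection is
  at stake. For two of them, \<open>Q = adj W * U\<close> intertwines the diagonal matrices of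
  \<open>d\<close> and \<open>e\<close>, so \<open>Q $$ (i, j)\<close> vanishes unless
  \<open>d j = e i\<close>. Hence \<open>Q\<close> also intertwines their images under an arbitrary
  \<open>h\<close>.\<close>

lemma mat_fun_udiag:
  assumes U: "unitary_mat n U"
  shows "mat_fun h (real_udiag n U d) = udiag n U (\<lambda>i. h (d i))"
proof -
  note U' = unitary_matD[OF U]
  let ?A = "real_udiag n U d"
  have dim: "dim_row ?A = n" using U' by simp
  have uniq: "udiag n W (\<lambda>i. h (e i)) = udiag n U (\<lambda>i. h (d i))"
    if W: "unitary_mat n W" and eq: "?A = real_udiag n W e" for W e
  proof -
    note W' = unitary_matD[OF W]
    define Q where "Q = adj W * U"
    have Q: "Q \<in> carrier_mat n n" using U' W' by (simp add: Q_def)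
    have "Q * mat_diag n (\<lambda>i. of_real (d i)) = adj W * (?A * U)"
      using U' W' by (simp add: Q_def assoc_sq[where n = n] right_mult_one_mat[where nr = n and nc = n])
    also have "\<dots> = mat_diag n (\<lambda>i. of_real (e i)) * Q"
      unfolding eq using U' W' by (simp add: Q_def assoc_sq[where n = n] unitary_cancel[OF W])
    finally have comm: "Q * mat_diag n (\<lambda>i. of_real (d i)) = mat_diag n (\<lambda>i. of_real (e i)) * Q" .
    have "Q $$ (i, j) * of_real (d j) = of_real (e i) * Q $$ (i, j)" if "i < n" "j < n" for i j
      using arg_cong[OF comm, of "\<lambda>M. M $$ (i, j)"] that Q
      by (simp add: mat_diag_mult_left[OF Q] mat_diag_mult_right[OF Q])
    then have "Q $$ (i, j) = 0 \<or> d j = e i" if "i < n" "j < n" for i j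
      using that by (metis mult.commute mult_cancel_left of_real_eq_iff)
    then have "Q $$ (i, j) * h (d j) = h (e i) * Q $$ (i, j)" if "i < n" "j < n" for i j
      using that by fastforce
    then have "Q * mat_diag n (\<lambda>i. h (d i)) = mat_diag n (\<lambda>i. h (e i)) * Q"
      unfolding mat_diag_mult_left[OF Q] mat_diag_mult_right[OF Q] by (intro eq_matI) auto
    then have "W * (Q * mat_diag n (\<lambda>i. h (d i))) * adj U = W * (mat_diag n (\<lambda>i. h (e i)) * Q) * adj U"
      by simp
    then show ?thesis
      using U' W' by (simp add: Q_def assoc_sq[where n = n] unitary_cancel[OF W] right_mult_one_mat[where nr = n and nc = n])
  qed
  show ?thesis
    unfolding mat_fun_def dim
  proof (rule some_equality)
    show "\<exists>W e. unitary_mat n W \<and> ?A = real_udiag n W e \<and>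
        udiag n U (\<lambda>i. h (d i)) = udiag n W (\<lambda>i. h (e i))"
      using U by blast
  next
    fix B
    assume "\<exists>W e. unitary_mat n W \<and> ?A = real_udiag n W e \<and> B = udiag n W (\<lambda>i. h (e i))"
    then obtain W e where "unitary_mat n W" "?A = real_udiag n W e" "B = udiag n W (\<lambda>i. h (e i))"
      by blast
    then show "B = udiag n U (\<lambda>i. h (d i))" using uniq by simp
  qed
qed

section \<open>Fourier blocks under the tensor operations\<close>

lemma is_tensorD:
  assumes "is_tensor m n p C"
  shows "t_rows C = m" "t_cols C = n" "length C = p" "0 < p" "\<And>j. j < p \<Longrightarrow> C ! j \<in> carrier_mat m n"
proof -
  show "length C = p" "0 < p" using assms by (auto simp: is_tensor_def)
  then have "hd C \<in> set C" by (cases C) auto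
  then have "hd C \<in> carrier_mat m n" using assms by (auto simp: is_tensor_def)
  then show "t_rows C = m" "t_cols C = n" by (auto simp: t_rows_def t_cols_def)
  show "C ! j \<in> carrier_mat m n" if "j < p" for j using assms that by (auto simp: is_tensor_def)
qed

lemma is_tensorI: "0 < p \<Longrightarrow> length C = p \<Longrightarrow> (\<And>j. j < p \<Longrightarrow> C ! j \<in> carrier_mat m n) \<Longrightarrow> is_tensor m n p C"
  by (auto simp: is_tensor_def in_set_conv_nth)

lemma omega_cnj: "omega p * cnj (omega p) = 1"
  using complex_norm_square[of "omega p"] by (simp add: omega_def)

lemma omega_cnj_power: "omega p ^ j * cnj (omega p) ^ j = 1"
  by (simp add: omega_cnj flip: power_mult_distrib)

lemma omega_power: "0 < p \<Longrightarrow> omega p ^ p = 1"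
proof -
  assume "0 < p"
  then have "real p * (- 2 * pi / real p) = - (2 * pi)" by simp
  then have "omega p ^ p = cis (- (2 * pi))" unfolding omega_def Complex.DeMoivre by (simp only:)
  then show ?thesis by (simp add: complex_eq_iff)
qed

lemma omega_power_mod: "0 < p \<Longrightarrow> omega p ^ (x mod p) = omega p ^ x"
  using omega_power[of p] by (metis mod_div_mult_eq mult.commute mult.right_neutral power_add power_mult power_one)

lemma omega_power_inj:
  assumes "k < p" "l < p" "omega p ^ k = omega p ^ l"
  shows "k = l"
proof -
  have p: "0 < p" "1 \<le> p" using assms by auto
  \<comment> \<open>Conjugation turns the negative angle in \<open>omega\<close> into that of the
    standard root of unity.\<close>
  have *: "cnj (omega p ^ j) = exp (2 * of_real pi * \<i> * of_nat j / of_nat p)" for j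
    unfolding omega_def Complex.DeMoivre cis_cnj by (simp add: cis_conv_exp mult_ac)
  from assms(3) have "cnj (omega p ^ k) = cnj (omega p ^ l)" by simp
  then have "k mod p = l mod p" unfolding * complex_root_unity_eq[OF p(2)] by simp
  then show ?thesis using assms by simp
qed

text \<open>A geometric sum whose ratio \<open>w\<close> is a \<open>p\<close>-th root of unity,
  different from 1 if \<open>k \<noteq> l\<close>.\<close>

lemma omega_orthogonal:
  assumes "k < p" "l < p"
  shows "(\<Sum>j<p. omega p ^ (j * k) * cnj (omega p) ^ (j * l)) = (if k = l then of_nat p else 0)"
proof -
  define w where "w = omega p ^ k * cnj (omega p) ^ l"
  have p: "0 < p" using assms by simp
  have trm: "omega p ^ (j * k) * cnj (omega p) ^ (j * l) = w ^ j" for j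
    by (simp add: w_def power_mult_distrib power_mult[symmetric] mult.commute)
  show ?thesis
  proof (cases "k = l")
    case True
    then show ?thesis unfolding trm w_def by (simp add: omega_cnj_power)
  next
    case False
    have "w \<noteq> 1"
    proof
      assume "w = 1"
      have "omega p ^ k = omega p ^ k * (omega p ^ l * cnj (omega p) ^ l)" by (simp only: omega_cnj_power mult_1_right)
      also have "\<dots> = w * omega p ^ l" by (simp add: w_def mult_ac)
      finally show False using omega_power_inj[OF assms] False \<open>w = 1\<close> by simp
    qed
    moreover have "w ^ p = (omega p ^ p) ^ k * cnj (omega p ^ p) ^ l"
      by (simp add: w_def power_mult_distrib power_mult[symmetric] mult.commute)
    then have "w ^ p = 1" by (simp only: omega_power[OF p]) simp
    ultimately have "(\<Sum>j<p. w ^ j) = 0" by (simp add: geometric_sum)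
    then show ?thesis unfolding trm using False by simp
  qed
qed

lemma fblock_carrier: "is_tensor m n p C \<Longrightarrow> fblock C k \<in> carrier_mat m n"
  by (simp add: fblock_def is_tensorD)

lemma fblock_index:
  assumes "is_tensor m n p C" "r < m" "c < n"
  shows "fblock C k $$ (r, c) = (\<Sum>j<p. omega p ^ (j * k) * (C ! j) $$ (r, c))"
  using assms by (simp add: fblock_def is_tensorD[OF assms(1)])

lemma t_fun_tensor: "is_tensor m m p C \<Longrightarrow> is_tensor m m p (t_fun h C)"
  by (rule is_tensorI) (auto simp: t_fun_def is_tensorD Let_def)

text \<open>\<open>t_fun\<close> ends with an inverse DFT, which the orthogonality of the characters
  cancels against the DFT in \<open>fblock\<close>.\<close>

lemma fblock_t_fun:
  assumes C: "is_tensor m m p C" and M: "mat_fun h (fblock C k) \<in> carrier_mat m m" and k: "k < p"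
  shows "fblock (t_fun h C) k = mat_fun h (fblock C k)"
proof (rule eq_matI)
  fix r c assume "r < dim_row (mat_fun h (fblock C k))" "c < dim_col (mat_fun h (fblock C k))"
  then have rc: "r < m" "c < m" using M by auto
  let ?M = "\<lambda>l. mat_fun h (fblock C l) $$ (r, c)"
  have "fblock (t_fun h C) k $$ (r, c) = (\<Sum>j<p. omega p ^ (j * k) * ((1 / of_nat p) * (\<Sum>l<p. cnj (omega p) ^ (j * l) * ?M l)))"
    using rc by (subst fblock_index[OF t_fun_tensor[OF C]]) (auto simp: t_fun_def is_tensorD[OF C] Let_def)
  also have "\<dots> = (\<Sum>j<p. \<Sum>l<p. (1 / of_nat p) * ?M l * (omega p ^ (j * k) * cnj (omega p) ^ (j * l)))"
    unfolding sum_distrib_left by (intro sum.cong refl) (simp add: mult_ac)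
  also have "\<dots> = (\<Sum>l<p. \<Sum>j<p. (1 / of_nat p) * ?M l * (omega p ^ (j * k) * cnj (omega p) ^ (j * l)))"
    by (rule sum.swap)
  also have "\<dots> = (\<Sum>l<p. if l = k then ?M k else 0)"
    unfolding sum_distrib_left[symmetric] using k by (intro sum.cong refl) (auto simp: omega_orthogonal)
  also have "\<dots> = ?M k" using k by simp
  finally show "fblock (t_fun h C) k $$ (r, c) = ?M k" .
qed (use M fblock_carrier[OF t_fun_tensor[OF C], of h k] in auto)

lemma fblock_t_fun_udiag:
  assumes C: "is_tensor m m p C" and U: "unitary_mat m U" and k: "k < p"
    and eq: "fblock C k = real_udiag m U d"
  shows "fblock (t_fun h C) k = udiag m U (\<lambda>i. h (d i))"
proof -
  have "mat_fun h (fblock C k) = udiag m U (\<lambda>i. h (d i))" unfolding eq by (rule mat_fun_udiag[OF U])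
  moreover have "udiag m U (\<lambda>i. h (d i)) \<in> carrier_mat m m" using unitary_matD[OF U] by simp
  ultimately show ?thesis using fblock_t_fun[OF C _ k, of h] by simp
qed

lemma mod_less_double: "x < 2 * p \<Longrightarrow> x mod p = (if x < p then x else x - p)" for x p :: nat
  by (simp add: mod_if)

lemma sum_shift_mod:
  fixes g :: "nat \<Rightarrow> 'a :: comm_monoid_add"
  assumes "l < p"
  shows "(\<Sum>j<p. g j) = (\<Sum>a<p. g ((a + l) mod p))"
proof -
  have "bij_betw (\<lambda>a. (a + l) mod p) {..<p} {..<p}"
    by (rule bij_betw_byWitness[where f' = "\<lambda>j. (j + p - l) mod p"])
      (use assms in \<open>auto simp: mod_less_double\<close>)
  then show ?thesis by (rule sum.reindex_bij_betw[symmetric])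
qed

lemma tstar_index:
  assumes C: "is_tensor m n p C" and D: "is_tensor n q p D" and j: "j < p" and rc: "r < m" "c < q"
  shows "((C \<star> D) ! j) $$ (r, c) = (\<Sum>l<p. \<Sum>i<n. (C ! ((j + p - l) mod p)) $$ (r, i) * (D ! l) $$ (i, c))"
proof -
  note C' = is_tensorD[OF C] and D' = is_tensorD[OF D]
  have lt: "j * m + r < m * p" by (rule block_index(1)[OF j rc(1)])
  have lt2: "i + l * n < n * p" if "i < n" "l < p" for i l
    using block_index(1)[OF that(2,1)] by (simp only: add.commute)
  have "((C \<star> D) ! j) $$ (r, c) = (bcirc C * Defs.unfold D) $$ (j * m + r, c)"
    using j rc by (simp add: tstar_def fold_def C' D' unfold_def Let_def)
  also have "\<dots> = (\<Sum>s<n * p. bcirc C $$ (j * m + r, s) * Defs.unfold D $$ (s, c))"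
    using lt rc by (subst mult_index) (auto simp: bcirc_def unfold_def C' D' Let_def)
  also have "\<dots> = (\<Sum>l<p. \<Sum>i<n. bcirc C $$ (j * m + r, i + l * n) * Defs.unfold D $$ (i + l * n, c))"
    by (rule sum_blocks)
  also have "\<dots> = (\<Sum>l<p. \<Sum>i<n. (C ! ((j + p - l) mod p)) $$ (r, i) * (D ! l) $$ (i, c))"
    using lt lt2 rc by (intro sum.cong refl) (simp add: bcirc_def unfold_def C' D' Let_def)
  finally show ?thesis .
qed

lemma tstar_tensor:
  assumes C: "is_tensor m n p C" and D: "is_tensor n q p D"
  shows "is_tensor m q p (C \<star> D)"
  by (rule is_tensorI)
    (auto simp: tstar_def fold_def is_tensorD[OF C] is_tensorD[OF D] unfold_def Let_def)

text \<open>The convolution theorem: \<open>\<star>\<close> is a cyclic convolution of slices, and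
  substituting \<open>j = a + l\<close> modulo \<open>p\<close> splits the character into a
  product.\<close>

lemma fblock_tstar:
  assumes C: "is_tensor m n p C" and D: "is_tensor n q p D"
  shows "fblock (C \<star> D) k = fblock C k * fblock D k"
proof (rule eq_matI)
  note p = is_tensorD(4)[OF C]
  fix r c assume "r < dim_row (fblock C k * fblock D k)" "c < dim_col (fblock C k * fblock D k)"
  then have rc: "r < m" "c < q" using fblock_carrier[OF C, of k] fblock_carrier[OF D, of k] by auto
  let ?h = "\<lambda>j l i. omega p ^ (j * k) * ((C ! ((j + p - l) mod p)) $$ (r, i) * (D ! l) $$ (i, c))"
  let ?g = "\<lambda>l i a. (omega p ^ (a * k) * (C ! a) $$ (r, i)) * (omega p ^ (l * k) * (D ! l) $$ (i, c))"
  have "fblock (C \<star> D) k $$ (r, c) =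
      (\<Sum>j<p. \<Sum>l<p. \<Sum>i<n. ?h j l i)"
    using rc by (subst fblock_index[OF tstar_tensor[OF C D]]) (auto simp: tstar_index[OF C D] sum_distrib_left)
  also have "\<dots> = (\<Sum>l<p. \<Sum>j<p. \<Sum>i<n. ?h j l i)"
    by (rule sum.swap)
  also have "\<dots> = (\<Sum>l<p. \<Sum>a<p. \<Sum>i<n. ?g l i a)"
  proof (rule sum.cong[OF refl])
    fix l assume "l \<in> {..<p}"
    then have l: "l < p" by simp
    have sh: "((a + l) mod p + p - l) mod p = a" if "a < p" for a using that l by (auto simp: mod_less_double)
    have om: "omega p ^ ((a + l) mod p * k) = omega p ^ (a * k) * omega p ^ (l * k)" for a
      using p by (simp add: power_mult omega_power_mod power_add power_mult_distrib)
    show "(\<Sum>j<p. \<Sum>i<n. ?h j l i) = (\<Sum>a<p. \<Sum>i<n. ?g l i a)"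
    proof (subst sum_shift_mod[OF l], intro sum.cong refl)
      fix a i assume "a \<in> {..<p}"
      then have "((a + l) mod p + p - l) mod p = a" using sh by simp
      then show "omega p ^ ((a + l) mod p * k) * ((C ! (((a + l) mod p + p - l) mod p)) $$ (r, i) * (D ! l) $$ (i, c)) = ?g l i a"
        by (simp only: om) (simp add: mult_ac)
    qed
  qed
  also have "\<dots> = (\<Sum>l<p. \<Sum>i<n. \<Sum>a<p. ?g l i a)" by (rule sum.cong[OF refl], rule sum.swap)
  also have "\<dots> = (\<Sum>i<n. \<Sum>l<p. \<Sum>a<p. ?g l i a)" by (rule sum.swap)
  also have "\<dots> = (\<Sum>i<n. fblock C k $$ (r, i) * fblock D k $$ (i, c))"
  proof (rule sum.cong[OF refl])
    fix i assume "i \<in> {..<n}"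
    then have i: "i < n" by simp
    show "(\<Sum>l<p. \<Sum>a<p. ?g l i a) = fblock C k $$ (r, i) * fblock D k $$ (i, c)"
      unfolding fblock_index[OF C rc(1) i] fblock_index[OF D i rc(2)] sum_product by (rule sum.swap)
  qed
  also have "\<dots> = (fblock C k * fblock D k) $$ (r, c)"
    using rc fblock_carrier[OF C, of k] fblock_carrier[OF D, of k] by (subst mult_index) auto
  finally show "fblock (C \<star> D) k $$ (r, c) = (fblock C k * fblock D k) $$ (r, c)" .
qed (use fblock_carrier[OF C, of k] fblock_carrier[OF D, of k] fblock_carrier[OF tstar_tensor[OF C D], of k] in auto)

lemma t_adj_tensor: "is_tensor m n p C \<Longrightarrow> is_tensor n m p (t_adj C)"
  by (rule is_tensorI) (auto simp: t_adj_def bcirc_inv_def is_tensorD)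

text \<open>Transposing a block circulant reverses the cyclic order of the slices; the index
  \<open>(p - j) mod p\<close> does so while fixing slice 0.\<close>

lemma t_adj_index:
  assumes C: "is_tensor m n p C" and j: "j < p" and rc: "r < n" "c < m"
  shows "(t_adj C ! j) $$ (r, c) = cnj ((C ! ((p - j) mod p)) $$ (c, r))"
    and t_transpose_index: "(t_transpose C ! j) $$ (r, c) = (C ! ((p - j) mod p)) $$ (c, r)"
proof -
  note C' = is_tensorD[OF C]
  have lt: "c < m * p" using rc C'(4) by (simp add: less_le_trans)
  show "(t_adj C ! j) $$ (r, c) = cnj ((C ! ((p - j) mod p)) $$ (c, r))"
    "(t_transpose C ! j) $$ (r, c) = (C ! ((p - j) mod p)) $$ (c, r)"
    using j rc lt block_index[OF j rc(1)]
    by (simp_all add: t_adj_def t_transpose_def bcirc_inv_def C' bcirc_def Let_def)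
qed

text \<open>The substitution of \<open>- j\<close> for \<open>j\<close> modulo \<open>p\<close>
  undoes the slice reversal and replaces \<open>omega\<close> by its conjugate.\<close>

lemma fblock_t_adj:
  assumes C: "is_tensor m n p C"
  shows "fblock (t_adj C) k = adj (fblock C k)"
proof (rule eq_matI)
  note p = is_tensorD(4)[OF C]
  fix r c assume "r < dim_row (adj (fblock C k))" "c < dim_col (adj (fblock C k))"
  then have rc: "r < n" "c < m" using fblock_carrier[OF C, of k] by auto
  let ?g = "\<lambda>j. omega p ^ (j * k) * cnj ((C ! ((p - j) mod p)) $$ (c, r))"
  have bij: "bij_betw (\<lambda>a. (p - a) mod p) {..<p} {..<p}"
    by (rule bij_betw_byWitness[where f' = "\<lambda>j. (p - j) mod p"]) (use p in \<open>auto simp: mod_if\<close>)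
  have "fblock (t_adj C) k $$ (r, c) = (\<Sum>j<p. ?g j)"
    using rc by (subst fblock_index[OF t_adj_tensor[OF C]]) (auto simp: t_adj_index[OF C])
  also have "\<dots> = (\<Sum>a<p. ?g ((p - a) mod p))" by (rule sum.reindex_bij_betw[OF bij, symmetric])
  also have "\<dots> = (\<Sum>a<p. cnj (omega p ^ (a * k) * (C ! a) $$ (c, r)))"
  proof (intro sum.cong refl)
    fix a assume "a \<in> {..<p}"
    then have a: "a < p" by simp
    have idx: "(p - (p - a) mod p) mod p = a" using a by (auto simp: mod_if)
    have "omega p ^ ((p - a) mod p) = omega p ^ (p - a) * (omega p ^ a * cnj (omega p) ^ a)"
      using p by (simp only: omega_power_mod omega_cnj_power mult_1_right)
    also have "\<dots> = omega p ^ p * cnj (omega p) ^ a" using a by (simp add: mult.assoc[symmetric] flip: power_add)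
    also have "\<dots> = cnj (omega p) ^ a" by (simp add: omega_power[OF p])
    finally show "?g ((p - a) mod p) = cnj (omega p ^ (a * k) * (C ! a) $$ (c, r))"
      by (simp add: idx power_mult)
  qed
  also have "\<dots> = adj (fblock C k) $$ (r, c)"
    using rc fblock_carrier[OF C, of k] by (simp add: fblock_index[OF C])
  finally show "fblock (t_adj C) k $$ (r, c) = adj (fblock C k) $$ (r, c)" .
qed (use fblock_carrier[OF C, of k] fblock_carrier[OF t_adj_tensor[OF C], of k] in auto)

lemma t_add_tensor:
  assumes "is_tensor m n p C" "is_tensor m n p D"
  shows "is_tensor m n p (t_add C D)"
  by (rule is_tensorI) (use is_tensorD[OF assms(1)] is_tensorD[OF assms(2)] in \<open>auto simp: t_add_def\<close>)

lemma fblock_t_add: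
  assumes C: "is_tensor m n p C" and D: "is_tensor m n p D"
  shows "fblock (t_add C D) k = fblock C k + fblock D k"
proof (rule eq_matI)
  fix r c assume "r < dim_row (fblock C k + fblock D k)" "c < dim_col (fblock C k + fblock D k)"
  then have rc: "r < m" "c < n" using fblock_carrier[OF C, of k] fblock_carrier[OF D, of k] by auto
  have "fblock (t_add C D) k $$ (r, c) = (\<Sum>j<p. omega p ^ (j * k) * ((C ! j) $$ (r, c) + (D ! j) $$ (r, c)))"
    unfolding fblock_index[OF t_add_tensor[OF C D] rc]
  proof (rule sum.cong[OF refl])
    fix j assume "j \<in> {..<p}"
    then have j: "j < p" by simp
    have "t_add C D ! j = C ! j + D ! j" using j is_tensorD(3)[OF C] is_tensorD(3)[OF D] by (simp add: t_add_def)
    then show "omega p ^ (j * k) * (t_add C D ! j) $$ (r, c) = omega p ^ (j * k) * ((C ! j) $$ (r, c) + (D ! j) $$ (r, c))"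
      using is_tensorD(5)[OF D j] rc by simp
  qed
  also have "\<dots> = fblock C k $$ (r, c) + fblock D k $$ (r, c)"
    unfolding fblock_index[OF C rc] fblock_index[OF D rc] by (simp add: distrib_left sum.distrib)
  finally show "fblock (t_add C D) k $$ (r, c) = (fblock C k + fblock D k) $$ (r, c)"
    using rc fblock_carrier[OF C, of k] fblock_carrier[OF D, of k] by simp
qed (use fblock_carrier[OF C, of k] fblock_carrier[OF D, of k] fblock_carrier[OF t_add_tensor[OF C D], of k] in auto)

text \<open>For real tensors the symmetric and the Hermitian alternative in \<open>TPD\<close>
  therefore coincide, and both lead to self-adjoint Fourier blocks.\<close>

lemma t_adj_real:
  assumes C: "is_tensor m m p C" and real: "real_tensor C"
  shows "t_adj C = t_transpose C"
proof (rule nth_equalityI)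
  show "length (t_adj C) = length (t_transpose C)" by (simp add: t_adj_def t_transpose_def bcirc_inv_def)
  fix j assume "j < length (t_adj C)"
  then have j: "j < p" using is_tensorD(3)[OF t_adj_tensor[OF C]] by simp
  have adj: "t_adj C ! j \<in> carrier_mat m m" using is_tensorD(5)[OF t_adj_tensor[OF C] j] .
  have tr: "t_transpose C ! j \<in> carrier_mat m m"
    using j is_tensorD[OF C] by (simp add: t_transpose_def bcirc_inv_def)
  show "t_adj C ! j = t_transpose C ! j"
  proof (rule eq_matI)
    fix r c assume "r < dim_row (t_transpose C ! j)" "c < dim_col (t_transpose C ! j)"
    then have rc: "r < m" "c < m" using tr by auto
    have q: "(p - j) mod p < p" using j by simp
    have "Im ((C ! ((p - j) mod p)) $$ (c, r)) = 0"
      using real is_tensorD(3)[OF C] is_tensorD(5)[OF C q] q rc unfolding real_tensor_def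
      by (metis carrier_matD nth_mem)
    then show "(t_adj C ! j) $$ (r, c) = (t_transpose C ! j) $$ (r, c)"
      using t_adj_index[OF C j rc] t_transpose_index[OF C j rc] by (simp add: complex_eq_iff)
  qed (use adj tr in auto)
qed

text \<open>The T-eigenvalues contain the spectrum of every block, so positivity passes to each
  block separately.\<close>

lemma TPD_fblock:
  assumes C: "is_tensor m m p C" and real: "real_tensor C" and TPD: "TPD C" and k: "k < p"
  shows "\<exists>U d. unitary_mat m U \<and> (\<forall>i<m. 0 < d i) \<and> fblock C k = real_udiag m U d"
proof -
  have "t_adj C = C" using TPD t_adj_real[OF C real] by (auto simp: TPD_def t_symmetric_def t_hermitian_def)
  then have "adj (fblock C k) = fblock C k" using fblock_t_adj[OF C, of k] by simp
  then obtain U d where U: "unitary_mat m U" and eq: "fblock C k = real_udiag m U d"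
    using hermitian_udiag[OF fblock_carrier[OF C]] by metis
  have "0 < d i" if "i < m" for i
  proof -
    have "complex_of_real (d i) \<in># mat_eigenvalues (fblock C k)"
      unfolding eq mat_eigenvalues_udiag[OF U] using that by auto
    then have "complex_of_real (d i) \<in># t_eigenvalues C"
      unfolding t_eigenvalues_def is_tensorD(3)[OF C] using k by (auto simp: set_mset_sum)
    then show ?thesis using TPD by (auto simp: TPD_def)
  qed
  then show ?thesis using U eq by blast
qed

section \<open>From tensors to block-diagonal matrices\<close>

definition block_spectrum :: "nat \<Rightarrow> (nat \<Rightarrow> nat \<Rightarrow> 'a) \<Rightarrow> nat \<Rightarrow> 'a" where
  "block_spectrum m d i = d (i div m) (i mod m)"

lemma mset_blocks:
  "(\<Sum>k<p. image_mset (v k) (mset_set {..<m})) = image_mset (block_spectrum m v) (mset_set {..<m * p})"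
proof -
  have "image_mset (block_spectrum m v) (mset_set {..<m * p}) = (\<Sum>j<m * p. {#block_spectrum m v j#})"
    by (simp add: sum_single_mset)
  also have "\<dots> = (\<Sum>k<p. \<Sum>i<m. {#block_spectrum m v (i + k * m)#})" by (rule sum_blocks)
  also have "\<dots> = (\<Sum>k<p. \<Sum>i<m. {#v k i#})" by (intro sum.cong refl) (simp add: block_spectrum_def)
  also have "\<dots> = (\<Sum>k<p. image_mset (v k) (mset_set {..<m}))" by (simp add: sum_single_mset)
  finally show ?thesis ..
qed

text \<open>For a positive semidefinite block the singular values are the eigenvalues themselves;
  \<open>nonneg\<close> removes the absolute values.\<close>

lemma (in gauge) ui_norm_blocks:
  assumes T: "is_tensor m m p T" and N: "N = m * p"
    and U: "\<And>k. k < p \<Longrightarrow> unitary_mat m (U k)"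
    and eq: "\<And>k. k < p \<Longrightarrow> fblock T k = real_udiag m (U k) (v k)"
    and nonneg: "\<And>k i. k < p \<Longrightarrow> i < m \<Longrightarrow> 0 \<le> v k i"
  shows "ui_norm \<rho> T = R (block_spectrum m v)"
proof -
  have "t_singular_values T = (\<Sum>k<p. image_mset (v k) (mset_set {..<m}))"
    unfolding t_singular_values_def is_tensorD(3)[OF T]
  proof (rule sum.cong[OF refl])
    fix k assume "k \<in> {..<p}"
    then have k: "k < p" by simp
    have "mat_singular_values (fblock T k) = image_mset (\<lambda>i. \<bar>v k i\<bar>) (mset_set {..<m})"
      unfolding eq[OF k] by (rule mat_singular_values_udiag[OF U[OF k]])
    also have "\<dots> = image_mset (v k) (mset_set {..<m})"
      by (rule image_mset_cong) (use nonneg[OF k] in auto)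
    finally show "mat_singular_values (fblock T k) = image_mset (v k) (mset_set {..<m})" .
  qed
  then have "t_singular_values T = image_mset (block_spectrum m v) (mset_set {..<N})"
    by (simp add: mset_blocks N)
  then show ?thesis unfolding ui_norm_def by (intro R_mset) simp
qed

text \<open>\<open>d\<close> holds the eigenvalues of the blocks, whereas \<open>cpow_prod\<close>
  and \<open>log_sum\<close> expect logarithms.\<close>

definition spectral_factor :: "nat \<Rightarrow> nat \<Rightarrow> (nat \<Rightarrow> complex mat) \<Rightarrow> (nat \<Rightarrow> nat \<Rightarrow> real) \<Rightarrow> complex mat \<times> (nat \<Rightarrow> real)" where
  "spectral_factor m p U d = (bdiag p m U, block_spectrum m (\<lambda>k i. ln (d k i)))"

lemma t_prod_Cons: "Ds \<noteq> [] \<Longrightarrow> t_prod (C # Ds) = C \<star> t_prod Ds"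
  and t_sum_Cons: "Ds \<noteq> [] \<Longrightarrow> t_sum (C # Ds) = t_add C (t_sum Ds)"
  by (cases Ds; simp)+

context
  fixes m p :: nat and Cs :: "tensor list"
    and U :: "tensor \<Rightarrow> nat \<Rightarrow> complex mat" and d :: "tensor \<Rightarrow> nat \<Rightarrow> nat \<Rightarrow> real"
  assumes tensor: "\<And>C. C \<in> set Cs \<Longrightarrow> is_tensor m m p C"
    and U: "\<And>C k. C \<in> set Cs \<Longrightarrow> k < p \<Longrightarrow> unitary_mat m (U C k)"
    and eq: "\<And>C k. C \<in> set Cs \<Longrightarrow> k < p \<Longrightarrow> fblock C k = real_udiag m (U C k) (d C k)"
begin

abbreviation factors :: "tensor list \<Rightarrow> (complex mat \<times> (nat \<Rightarrow> real)) list" where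
  "factors \<equiv> map (\<lambda>C. spectral_factor m p (U C) (d C))"

lemma unitaries_spectral_factors: "unitaries (m * p) (factors Cs)"
  using U by (auto simp: spectral_factor_def intro!: bdiag_unitary)

text \<open>The induction starts at a single tensor because \<open>t_prod []\<close> is the empty
  list rather than an identity tensor. The recursion of \<open>cpow_prod\<close> ends in an identity
  matrix instead, which the base case absorbs.\<close>

lemma t_prod_cpow_blocks:
  assumes "Ds \<noteq> []" "set Ds \<subseteq> set Cs"
  shows "is_tensor m m p (t_prod (map (\<lambda>C. t_cpow C z) Ds)) \<and>
    cpow_prod (m * p) (factors Ds) z =
      bdiag p m (fblock (t_prod (map (\<lambda>C. t_cpow C z) Ds)))"
  using assms
proof (induction Ds rule: list_nonempty_induct)
  have factor: "is_tensor m m p (t_cpow C z)"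
    "udiag (m * p) (bdiag p m (U C)) (\<lambda>i. exp (z * of_real (block_spectrum m (\<lambda>k i. ln (d C k i)) i))) =
      bdiag p m (fblock (t_cpow C z))" if C: "C \<in> set Cs" for C
  proof -
    show "is_tensor m m p (t_cpow C z)" unfolding t_cpow_def by (rule t_fun_tensor[OF tensor[OF C]])
    have "bdiag p m (fblock (t_cpow C z)) = bdiag p m (\<lambda>k. udiag m (U C k) (\<lambda>i. exp (z * of_real (ln (d C k i)))))"
      unfolding t_cpow_def
      by (rule bdiag_cong) (rule fblock_t_fun_udiag[OF tensor[OF C] U[OF C] _ eq[OF C]])
    also have "\<dots> = udiag (m * p) (bdiag p m (U C)) (\<lambda>i. exp (z * of_real (ln (d C (i div m) (i mod m)))))"
      by (rule bdiag_udiag[OF U[OF C]])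
    finally show "udiag (m * p) (bdiag p m (U C)) (\<lambda>i. exp (z * of_real (block_spectrum m (\<lambda>k i. ln (d C k i)) i))) =
      bdiag p m (fblock (t_cpow C z))" by (simp add: block_spectrum_def)
  qed
  {
    case (single C)
    then show ?case using factor[of C] by (simp add: spectral_factor_def right_mult_one_mat[of _ "m * p" "m * p"])
  next
    case (cons C Ds)
    then have C: "C \<in> set Cs"
      and IH: "is_tensor m m p (t_prod (map (\<lambda>C. t_cpow C z) Ds))"
        "cpow_prod (m * p) (factors Ds) z = bdiag p m (fblock (t_prod (map (\<lambda>C. t_cpow C z) Ds)))"
      by auto
    let ?P = "t_prod (map (\<lambda>C. t_cpow C z) Ds)"
    have P: "t_prod (map (\<lambda>C. t_cpow C z) (C # Ds)) = t_cpow C z \<star> ?P"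
      using cons.hyps by (simp add: t_prod_Cons)
    have "cpow_prod (m * p) (factors (C # Ds)) z = bdiag p m (fblock (t_cpow C z)) * bdiag p m (fblock ?P)"
      using factor(2)[OF C] IH(2) by (simp add: spectral_factor_def)
    also have "\<dots> = bdiag p m (\<lambda>k. fblock (t_cpow C z) k * fblock ?P k)"
      by (rule bdiag_mult) (use fblock_carrier[OF factor(1)[OF C]] fblock_carrier[OF IH(1)] in auto)
    also have "\<dots> = bdiag p m (fblock (t_cpow C z \<star> ?P))"
      using fblock_tstar[OF factor(1)[OF C] IH(1)] by (intro bdiag_cong) simp
    finally show ?case using tstar_tensor[OF factor(1)[OF C] IH(1)] unfolding P by blast
  }
qed

text \<open>Self-adjointness is carried along in the induction so that the blocks of the sum can be
  diagonalised one by one.\<close>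

lemma t_sum_log_blocks:
  assumes "Ds \<noteq> []" "set Ds \<subseteq> set Cs"
  shows "is_tensor m m p (t_sum (map t_log Ds)) \<and>
    (\<forall>k<p. adj (fblock (t_sum (map t_log Ds)) k) = fblock (t_sum (map t_log Ds)) k) \<and>
    log_sum (m * p) (factors Ds) = bdiag p m (fblock (t_sum (map t_log Ds)))"
  using assms
proof (induction Ds rule: list_nonempty_induct)
  have factor: "is_tensor m m p (t_log C)"
    "\<forall>k<p. adj (fblock (t_log C) k) = fblock (t_log C) k"
    "udiag (m * p) (bdiag p m (U C)) (\<lambda>i. of_real (block_spectrum m (\<lambda>k i. ln (d C k i)) i)) =
      bdiag p m (fblock (t_log C))" if C: "C \<in> set Cs" for C
  proof -
    show "is_tensor m m p (t_log C)" unfolding t_log_def by (rule t_fun_tensor[OF tensor[OF C]])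
    have log: "fblock (t_log C) k = udiag m (U C k) (\<lambda>i. of_real (ln (d C k i)))" if "k < p" for k
      unfolding t_log_def by (rule fblock_t_fun_udiag[OF tensor[OF C] U[OF C that] that eq[OF C that]])
    then show "\<forall>k<p. adj (fblock (t_log C) k) = fblock (t_log C) k"
      using unitary_matD(1)[OF U[OF C]] by (simp add: udiag_adj)
    have "bdiag p m (fblock (t_log C)) = bdiag p m (\<lambda>k. udiag m (U C k) (\<lambda>i. of_real (ln (d C k i))))"
      by (rule bdiag_cong) (rule log)
    also have "\<dots> = udiag (m * p) (bdiag p m (U C)) (\<lambda>i. of_real (ln (d C (i div m) (i mod m))))"
      by (rule bdiag_udiag[OF U[OF C]])
    finally show "udiag (m * p) (bdiag p m (U C)) (\<lambda>i. of_real (block_spectrum m (\<lambda>k i. ln (d C k i)) i)) =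
      bdiag p m (fblock (t_log C))" by (simp add: block_spectrum_def)
  qed
  {
    case (single C)
    then show ?case using factor[of C] by (simp add: spectral_factor_def right_add_zero_mat[of _ "m * p" "m * p"])
  next
    case (cons C Ds)
    let ?S = "t_sum (map t_log Ds)"
    from cons have C: "C \<in> set Cs"
      and IH: "is_tensor m m p ?S" "\<forall>k<p. adj (fblock ?S k) = fblock ?S k"
        "log_sum (m * p) (factors Ds) = bdiag p m (fblock ?S)"
      by auto
    have S: "t_sum (map t_log (C # Ds)) = t_add (t_log C) ?S"
      using cons.hyps by (simp add: t_sum_Cons)
    note carr = fblock_carrier[OF factor(1)[OF C]] fblock_carrier[OF IH(1)]
    have "log_sum (m * p) (factors (C # Ds)) = bdiag p m (fblock (t_log C)) + bdiag p m (fblock ?S)"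
      using factor(3)[OF C] IH(3) by (simp add: spectral_factor_def)
    also have "\<dots> = bdiag p m (\<lambda>k. fblock (t_log C) k + fblock ?S k)"
      by (rule bdiag_add) (use carr in auto)
    also have "\<dots> = bdiag p m (fblock (t_add (t_log C) ?S))"
      using fblock_t_add[OF factor(1)[OF C] IH(1)] by (intro bdiag_cong) simp
    finally have H: "log_sum (m * p) (factors (C # Ds)) = bdiag p m (fblock (t_add (t_log C) ?S))" .
    have "adj (fblock (t_add (t_log C) ?S) k) = fblock (t_add (t_log C) ?S) k" if "k < p" for k
      unfolding fblock_t_add[OF factor(1)[OF C] IH(1)] adj_add[OF carr]
      using factor(2)[OF C] IH(2) that by simp
    then show ?case using t_add_tensor[OF factor(1)[OF C] IH(1)] H unfolding S by blast
  }
qed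

end

section \<open>From gauges to the tensor inequality\<close>

lemma (in gauge) convex_symmetric_R:
  fixes \<phi> :: "real \<Rightarrow> real"
  assumes "convex_on UNIV \<phi>" "continuous_on UNIV \<phi>" "\<And>x. 0 \<le> \<phi> x"
  shows "convex_symmetric N (\<lambda>y. R (\<lambda>j. \<phi> (y j)))"
  unfolding convex_symmetric_def
proof (intro conjI allI impI)
  fix Y :: "real \<Rightarrow> nat \<Rightarrow> real" assume "\<forall>j<N. continuous_on UNIV (\<lambda>t. Y t j)"
  then show "continuous_on UNIV (\<lambda>t. R (\<lambda>j. \<phi> (Y t j)))"
    by (intro continuous_R continuous_on_compose2[OF assms(2)]) auto
next
  fix y z :: "nat \<Rightarrow> real" assume "\<forall>j<N. y j = z j"
  then show "R (\<lambda>j. \<phi> (y j)) = R (\<lambda>j. \<phi> (z j))" by (intro R_cong) simp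
next
  fix y :: "nat \<Rightarrow> real" and \<pi> assume "\<pi> permutes {..<N}"
  then show "R (\<lambda>j. \<phi> (y (\<pi> j))) = R (\<lambda>j. \<phi> (y j))" by (rule R_permute)
qed (use R_compose_convex[OF assms(1,3)] R_compose_bounded[OF assms(2)] in auto)

text \<open>With at least one coordinate the gauge of a positive vector is positive, so
  \<open>ln\<close> stays within its domain of continuity.\<close>

lemma (in gauge) convex_symmetric_ln_R:
  fixes \<psi> :: "real \<Rightarrow> real"
  assumes "0 < N" "convex_on UNIV \<psi>" "continuous_on UNIV \<psi>"
  shows "convex_symmetric N (\<lambda>y. ln (R (\<lambda>j. exp (\<psi> (y j)))))"
  unfolding convex_symmetric_def
proof (intro conjI allI impI)
  fix Y :: "real \<Rightarrow> nat \<Rightarrow> real" assume "\<forall>j<N. continuous_on UNIV (\<lambda>t. Y t j)"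
  then have "continuous_on UNIV (\<lambda>t. R (\<lambda>j. exp (\<psi> (Y t j))))"
    by (intro continuous_R continuous_on_exp continuous_on_compose2[OF assms(3)]) auto
  moreover have "R (\<lambda>j. exp (\<psi> (Y t j))) \<noteq> 0" for t
    using R_pos[OF assms(1), of "\<lambda>j. exp (\<psi> (Y t j))"] by simp
  ultimately show "continuous_on UNIV (\<lambda>t. ln (R (\<lambda>j. exp (\<psi> (Y t j)))))"
    by (intro continuous_on_ln) auto
next
  fix y z :: "nat \<Rightarrow> real" assume "\<forall>j<N. y j = z j"
  then have "R (\<lambda>j. exp (\<psi> (y j))) = R (\<lambda>j. exp (\<psi> (z j)))" by (intro R_cong) simp
  then show "ln (R (\<lambda>j. exp (\<psi> (y j)))) = ln (R (\<lambda>j. exp (\<psi> (z j))))" by simp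
next
  fix y :: "nat \<Rightarrow> real" and \<pi> assume "\<pi> permutes {..<N}"
  then show "ln (R (\<lambda>j. exp (\<psi> (y (\<pi> j))))) = ln (R (\<lambda>j. exp (\<psi> (y j))))"
    using R_permute[of \<pi> "\<lambda>j. exp (\<psi> (y j))"] by simp
qed (use ln_R_exp_convex[OF assms(1,2)] ln_R_exp_bounded[OF assms(1,3)] in auto)

text \<open>The Fourier blocks of all tensors are assembled into block-diagonal matrices of size \<open>m * p\<close>;
  the bound for convex symmetric functions then applies to the joint spectra.\<close>

lemma tensor_golden_thompson:
  fixes Cs :: "tensor list"
  assumes ne: "Cs \<noteq> []"
    and Cs: "\<forall>C\<in>set Cs. is_tensor m m p C \<and> real_tensor C \<and> TPD C"
    and \<rho>: "symmetric_gauge (m * p) \<rho>"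
  shows "\<exists>x y.
    (\<forall>f :: real \<Rightarrow> real. (\<forall>x>0. 0 \<le> f x) \<longrightarrow>
      ui_norm \<rho> (t_fun (\<lambda>x. of_real (f x)) (t_exp (t_sum (map t_log Cs)))) =
        gauge.R (m * p) \<rho> (\<lambda>j. f (exp (x j)))) \<and>
    (\<forall>(f :: real \<Rightarrow> real) t. (\<forall>x>0. 0 \<le> f x) \<longrightarrow>
      ui_norm \<rho> (t_fun (\<lambda>x. of_real (f x))
        (t_abs (t_prod (map (\<lambda>C. t_cpow C (1 + \<i> * of_real t)) Cs)))) =
        gauge.R (m * p) \<rho> (\<lambda>j. f (exp (y t j)))) \<and>
    (\<forall>\<Phi>. convex_symmetric (m * p) \<Phi> \<longrightarrow> \<Phi> x \<le> (LINT t|lborel. \<Phi> (y t) * beta0 t))"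
proof -
  interpret gauge "m * p" \<rho> by unfold_locales (rule \<rho>)
  have tensor: "is_tensor m m p C" if "C \<in> set Cs" for C using Cs that by blast
  have "\<forall>C k. \<exists>U d. C \<in> set Cs \<longrightarrow> k < p \<longrightarrow> unitary_mat m U \<and> (\<forall>i<m. 0 < d i) \<and>
      fblock C k = real_udiag m U d"
    using TPD_fblock Cs by metis
  then obtain U d where Ud: "\<And>C k. C \<in> set Cs \<Longrightarrow> k < p \<Longrightarrow> unitary_mat m (U C k) \<and> (\<forall>i<m. 0 < d C k i) \<and>
      fblock C k = real_udiag m (U C k) (d C k)" by metis
  then have U: "\<And>C k. C \<in> set Cs \<Longrightarrow> k < p \<Longrightarrow> unitary_mat m (U C k)"
    and eq: "\<And>C k. C \<in> set Cs \<Longrightarrow> k < p \<Longrightarrow> fblock C k = real_udiag m (U C k) (d C k)" by blast+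
  define As where "As = map (\<lambda>C. spectral_factor m p (U C) (d C)) Cs"
  have As: "unitaries (m * p) As"
    unfolding As_def by (rule unitaries_spectral_factors) (use tensor U eq in auto)
  define S where "S = t_sum (map t_log Cs)"
  have "is_tensor m m p S \<and> (\<forall>k<p. adj (fblock S k) = fblock S k) \<and> log_sum (m * p) As = bdiag p m (fblock S)"
    unfolding S_def As_def by (rule t_sum_log_blocks[OF _ _ _ ne order_refl]) (use tensor U eq in auto)
  then have S: "is_tensor m m p S" and Sh: "\<And>k. k < p \<Longrightarrow> adj (fblock S k) = fblock S k"
    and HS: "log_sum (m * p) As = bdiag p m (fblock S)" by auto
  have "\<forall>k. \<exists>E x. k < p \<longrightarrow> unitary_mat m E \<and> fblock S k = real_udiag m E x"
    using hermitian_udiag[OF fblock_carrier[OF S] Sh] by metis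
  then obtain E x where E: "\<And>k. k < p \<Longrightarrow> unitary_mat m (E k)"
    and Sx: "\<And>k. k < p \<Longrightarrow> fblock S k = real_udiag m (E k) (x k)" by metis
  have H: "log_sum (m * p) As = real_udiag (m * p) (bdiag p m E) (block_spectrum m x)"
  proof -
    have "log_sum (m * p) As = bdiag p m (\<lambda>k. real_udiag m (E k) (x k))"
      unfolding HS by (rule bdiag_cong) (rule Sx)
    also have "\<dots> = udiag (m * p) (bdiag p m E) (\<lambda>i. of_real (x (i div m) (i mod m)))"
      by (rule bdiag_udiag[OF E])
    finally show ?thesis by (simp only: block_spectrum_def)
  qed
  define P where "P t = t_prod (map (\<lambda>C. t_cpow C (1 + \<i> * of_real t)) Cs)" for t
  have z: "Complex 1 t = 1 + \<i> * of_real t" for t by (simp add: complex_eq_iff)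
  have PG: "is_tensor m m p (P t) \<and> cpow_prod (m * p) As (Complex 1 t) = bdiag p m (fblock (P t))" for t
    unfolding z P_def As_def by (rule t_prod_cpow_blocks[OF _ _ _ ne order_refl]) (use tensor U eq in auto)
  then have P: "is_tensor m m p (P t)" and G: "cpow_prod (m * p) As (Complex 1 t) = bdiag p m (fblock (P t))" for t by auto
  define Q where "Q t = t_adj (P t) \<star> P t" for t
  have Q: "is_tensor m m p (Q t)" for t unfolding Q_def by (rule tstar_tensor[OF t_adj_tensor[OF P] P])
  note Pc = fblock_carrier[OF P]
  have fQ: "fblock (Q t) k = adj (fblock (P t) k) * fblock (P t) k" for t k
    unfolding Q_def fblock_tstar[OF t_adj_tensor[OF P] P] fblock_t_adj[OF P] ..
  have Qh: "adj (fblock (Q t) k) = fblock (Q t) k" for t k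
    unfolding fQ using Pc[of t k] by (simp add: adj_mult[where n = m and k = m and m = m])
  have "\<forall>t k. \<exists>V s. unitary_mat m V \<and> fblock (Q t) k = real_udiag m V s"
    using hermitian_udiag[OF fblock_carrier[OF Q] Qh] by metis
  then obtain V s where V: "\<And>t k. unitary_mat m (V t k)"
    and Qs: "\<And>t k. fblock (Q t) k = real_udiag m (V t k) (s t k)" by metis
  have gram: "adj (cpow_prod (m * p) As (Complex 1 t)) * cpow_prod (m * p) As (Complex 1 t) =
      udiag (m * p) (bdiag p m (V t)) (\<lambda>i. of_real (block_spectrum m (s t) i))" for t
  proof -
    have "adj (cpow_prod (m * p) As (Complex 1 t)) * cpow_prod (m * p) As (Complex 1 t) =
        bdiag p m (\<lambda>k. adj (fblock (P t) k)) * bdiag p m (fblock (P t))"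
      unfolding G using Pc by (simp add: bdiag_adj)
    also have "\<dots> = bdiag p m (\<lambda>k. adj (fblock (P t) k) * fblock (P t) k)"
      by (rule bdiag_mult) (use Pc in auto)
    also have "\<dots> = bdiag p m (\<lambda>k. real_udiag m (V t k) (s t k))"
      by (rule bdiag_cong) (simp only: fQ[symmetric] Qs)
    also have "\<dots> = udiag (m * p) (bdiag p m (V t)) (\<lambda>i. of_real (s t (i div m) (i mod m)))"
      by (rule bdiag_udiag[OF V])
    finally show ?thesis by (simp only: block_spectrum_def)
  qed
  have bV: "unitary_mat (m * p) (bdiag p m (V t))" for t by (rule bdiag_unitary[OF V])
  \<comment> \<open>Positivity is inherited from the full Gram matrix, where entry \<open>i\<close>
    of block \<open>k\<close> has index \<open>k * m + i\<close>.\<close>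
  have spos: "0 < s t k i" if "k < p" "i < m" for t k i
    using cpow_prod_gram_spectrum(2)[OF As bV gram block_index(1)[OF that]] block_index(2,3)[OF that]
    by (simp add: block_spectrum_def)
  \<comment> \<open>Halved because \<open>s t\<close> lists the squares of the singular values of
    \<open>P t\<close>.\<close>
  define y where "y t j = ln (block_spectrum m (s t) j) / 2" for t j
  show ?thesis
  proof (intro exI[of _ "block_spectrum m x"] exI[of _ y] conjI allI impI)
    fix f :: "real \<Rightarrow> real" assume f: "\<forall>x>0. 0 \<le> f x"
    have e: "fblock (t_exp S) k = udiag m (E k) (\<lambda>i. of_real (exp (x k i)))" if "k < p" for k
      unfolding t_exp_def by (rule fblock_t_fun_udiag[OF S E[OF that] that Sx[OF that]])
    have T: "is_tensor m m p (t_exp S)" unfolding t_exp_def by (rule t_fun_tensor[OF S])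
    have "ui_norm \<rho> (t_fun (\<lambda>x. of_real (f x)) (t_exp S)) = R (block_spectrum m (\<lambda>k i. f (exp (x k i))))"
      by (rule ui_norm_blocks[OF t_fun_tensor[OF T] refl E fblock_t_fun_udiag[OF T E _ e]]) (simp_all add: f)
    then show "ui_norm \<rho> (t_fun (\<lambda>x. of_real (f x)) (t_exp (t_sum (map t_log Cs)))) = R (\<lambda>j. f (exp (block_spectrum m x j)))"
      by (simp add: S_def block_spectrum_def[abs_def])
  next
    fix f :: "real \<Rightarrow> real" and t assume f: "\<forall>x>0. 0 \<le> f x"
    have e: "fblock (t_abs (P t)) k = udiag m (V t k) (\<lambda>i. of_real (sqrt (s t k i)))" if "k < p" for k
      unfolding t_abs_def Q_def[symmetric] by (rule fblock_t_fun_udiag[OF Q V that Qs])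
    have T: "is_tensor m m p (t_abs (P t))" unfolding t_abs_def Q_def[symmetric] by (rule t_fun_tensor[OF Q])
    have "ui_norm \<rho> (t_fun (\<lambda>x. of_real (f x)) (t_abs (P t))) = R (block_spectrum m (\<lambda>k i. f (sqrt (s t k i))))"
      by (rule ui_norm_blocks[OF t_fun_tensor[OF T] refl V fblock_t_fun_udiag[OF T V _ e]]) (simp_all add: f spos)
    also have "\<dots> = R (\<lambda>j. f (exp (y t j)))"
    proof (rule R_cong)
      fix j assume "j < m * p"
      then have "0 < block_spectrum m (s t) j" using block_position[of j m p] spos by (simp add: block_spectrum_def)
      then have "exp (y t j) = sqrt (block_spectrum m (s t) j)"
        by (simp add: y_def ln_sqrt[symmetric])
      then show "block_spectrum m (\<lambda>k i. f (sqrt (s t k i))) j = f (exp (y t j))" by (simp add: block_spectrum_def)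
    qed
    finally show "ui_norm \<rho> (t_fun (\<lambda>x. of_real (f x))
        (t_abs (t_prod (map (\<lambda>C. t_cpow C (1 + \<i> * of_real t)) Cs)))) = R (\<lambda>j. f (exp (y t j)))"
      by (simp add: P_def)
  next
    fix \<Phi> :: "(nat \<Rightarrow> real) \<Rightarrow> real" assume "convex_symmetric (m * p) \<Phi>"
    from convex_symmetric_golden_thompson[OF As bdiag_unitary[OF E] H bV gram this]
    show "\<Phi> (block_spectrum m x) \<le> (LINT t|lborel. \<Phi> (y t) * beta0 t)" by (simp add: y_def[abs_def])
  qed
qed

text \<open>A real-valued convex function log f(e^x) presupposes that f is positive. Part (1) spells
  this out, since \<open>ln 0\<close> is a default value and not minus infinity.\<close>

theorem mainTheorem9:
  fixes Cs :: "tensor list" and m p :: nat and \<rho> :: "real list \<Rightarrow> real"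
  assumes "Cs \<noteq> []"
    and "\<forall>C\<in>set Cs. is_tensor m m p C \<and> real_tensor C \<and> TPD C"
    and "symmetric_gauge (m * p) \<rho>"
  shows
    "(\<forall>f :: real \<Rightarrow> real.
        continuous_on {0<..} f \<longrightarrow> (\<forall>x>0. 0 < f x) \<longrightarrow>
        convex_on UNIV (\<lambda>x. ln (f (exp x))) \<longrightarrow>
        ui_norm \<rho> (t_fun (\<lambda>x. complex_of_real (f x)) (t_exp (t_sum (map t_log Cs))))
          \<le> exp (LINT t|lborel.
               ln (ui_norm \<rho> (t_fun (\<lambda>x. complex_of_real (f x))
                  (t_abs (t_prod (map (\<lambda>C. t_cpow C (1 + \<i> * complex_of_real t)) Cs)))))
               * beta0 t))
     \<and>
     (\<forall>g :: real \<Rightarrow> real.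
        continuous_on {0<..} g \<longrightarrow> (\<forall>x>0. 0 \<le> g x) \<longrightarrow>
        convex_on UNIV (\<lambda>x. g (exp x)) \<longrightarrow>
        ui_norm \<rho> (t_fun (\<lambda>x. complex_of_real (g x)) (t_exp (t_sum (map t_log Cs))))
          \<le> (LINT t|lborel.
               ui_norm \<rho> (t_fun (\<lambda>x. complex_of_real (g x))
                  (t_abs (t_prod (map (\<lambda>C. t_cpow C (1 + \<i> * complex_of_real t)) Cs))))
               * beta0 t))"
proof -
  interpret gauge "m * p" \<rho> by unfold_locales (rule assms(3))
  let ?lhs = "\<lambda>f. ui_norm \<rho> (t_fun (\<lambda>x. complex_of_real (f x)) (t_exp (t_sum (map t_log Cs))))"
  let ?rhs = "\<lambda>f t. ui_norm \<rho> (t_fun (\<lambda>x. complex_of_real (f x))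
    (t_abs (t_prod (map (\<lambda>C. t_cpow C (1 + \<i> * complex_of_real t)) Cs))))"
  from tensor_golden_thompson[OF assms] obtain x y where *:
    "(\<forall>f. (\<forall>x>0. 0 \<le> f x) \<longrightarrow> ?lhs f = R (\<lambda>j. f (exp (x j)))) \<and>
     (\<forall>f t. (\<forall>x>0. 0 \<le> f x) \<longrightarrow> ?rhs f t = R (\<lambda>j. f (exp (y t j)))) \<and>
     (\<forall>\<Phi>. convex_symmetric (m * p) \<Phi> \<longrightarrow> \<Phi> x \<le> (LINT t|lborel. \<Phi> (y t) * beta0 t))"
    by (elim exE)
  note lhs = *[THEN conjunct1] and rhs = *[THEN conjunct2, THEN conjunct1] and main = *[THEN conjunct2, THEN conjunct2]
  show ?thesis
  proof (intro conjI allI impI)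
    fix f :: "real \<Rightarrow> real"
    assume f: "continuous_on {0<..} f" "\<forall>x>0. 0 < f x" "convex_on UNIV (\<lambda>x. ln (f (exp x)))"
    have f0: "\<forall>x>0. 0 \<le> f x" using f(2) by (simp add: less_imp_le)
    show "?lhs f \<le> exp (LINT t|lborel. ln (?rhs f t) * beta0 t)"
    proof (cases "m * p = 0")
      \<comment> \<open>Without coordinates every gauge is 0, while the right-hand side is an
        exponential.\<close>
      case True
      have "\<not> j < m * p" for j unfolding True by simp
      then have "R y = 0" for y using R_zero_iff[of y] by blast
      then have "?lhs f = 0" using lhs f0 by simp
      then show ?thesis by simp
    next
      case False
      then have N: "0 < m * p" by simp
      define \<psi> where "\<psi> v = ln (f (exp v))" for v
      have exp_\<psi>: "exp (\<psi> v) = f (exp v)" for v unfolding \<psi>_def using f(2) by (intro exp_ln) simp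
      have "continuous_on UNIV (\<lambda>v. f (exp v))"
        by (rule continuous_on_compose2[OF f(1)]) (auto intro: continuous_intros)
      moreover have "f (exp v) \<noteq> 0" for v using f(2)[rule_format, of "exp v"] by simp
      ultimately have "continuous_on UNIV \<psi>" unfolding \<psi>_def by (intro continuous_on_ln) auto
      then have "convex_symmetric (m * p) (\<lambda>y. ln (R (\<lambda>j. exp (\<psi> (y j)))))"
        using f(3) by (intro convex_symmetric_ln_R N) (simp_all add: \<psi>_def)
      then have "ln (R (\<lambda>j. f (exp (x j)))) \<le> (LINT t|lborel. ln (R (\<lambda>j. f (exp (y t j)))) * beta0 t)"
        using main unfolding exp_\<psi> by blast
      then have "ln (?lhs f) \<le> (LINT t|lborel. ln (?rhs f t) * beta0 t)" using lhs rhs f0 by simp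
      then have "exp (ln (?lhs f)) \<le> exp (LINT t|lborel. ln (?rhs f t) * beta0 t)" by simp
      moreover have "0 < ?lhs f" using lhs f0 R_pos[OF N, of "\<lambda>j. f (exp (x j))"] f(2) by simp
      ultimately show ?thesis by (simp only: exp_ln)
    qed
  next
    fix g :: "real \<Rightarrow> real"
    assume g: "continuous_on {0<..} g" "\<forall>x>0. 0 \<le> g x" "convex_on UNIV (\<lambda>x. g (exp x))"
    have "continuous_on UNIV (\<lambda>v. g (exp v))"
      by (rule continuous_on_compose2[OF g(1)]) (auto intro: continuous_intros)
    then have "convex_symmetric (m * p) (\<lambda>y. R (\<lambda>j. g (exp (y j))))"
      using g by (intro convex_symmetric_R) auto
    then have "R (\<lambda>j. g (exp (x j))) \<le> (LINT t|lborel. R (\<lambda>j. g (exp (y t j))) * beta0 t)"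
      using main by blast
    then show "?lhs g \<le> (LINT t|lborel. ?rhs g t * beta0 t)" using lhs rhs g(2) by simp
  qed
qed

end
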